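(* Let $k$ be a positive integer, and let the random graph $R$ be picked uniformly from the set of all graphs on $\{1,\ldots,k\}$. For each $n$ let $R_n$ be a graph sampled uniformly at random from $(\mathrm{Ex}\,(k+1)C)_n$. Then for each $3\le i\le j\le k+2$, as $n\to\infty$, $$\mathbb{P}\big((\omega(R_n)=i)\wedge(\chi(R_n)=j)\big)\to\mathbb{P}\big((\omega(R)=i-2)\wedge(\chi(R)=j-2)\big),$$ and for all other values of $i,j$ the left side tends to $0$.
   Context: Graphs are finite and simple. $\mathrm{Ex}\,(k+1)C$ denotes the class of graphs which do not have $k+1$ pairwise vertex-disjoint cycles. For a class $\mathcal{A}$ of graphs, $\mathcal{A}_n$ denotes the set of graphs in $\mathcal{A}$ on the vertex set $\{1,\ldots,n\}$. $\chi$ denotes the chromatic number and $\omega$ the clique number. *)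

theory Defs
  imports "HOL-Probability.Probability"
begin

text \<open>A graph is a pair of a vertex set and a set of edges, an edge being a two-element vertex set.\<close>

type_synonym 'a graph = "'a set \<times> 'a set set"

abbreviation verts :: "'a graph \<Rightarrow> 'a set" where
  "verts G \<equiv> fst G"

abbreviation edges :: "'a graph \<Rightarrow> 'a set set" where
  "edges G \<equiv> snd G"

definition simple_graphs :: "'a graph set" where
  "simple_graphs = {G. finite (verts G) \<and> (\<forall>e\<in>edges G. e \<subseteq> verts G \<and> card e = 2)}"

text \<open>A cycle is given by the list of its vertices in cyclic order. It is a subgraph of \<open>G\<close>,
  not necessarily an induced one.\<close>

definition is_cycle :: "'a graph \<Rightarrow> 'a list \<Rightarrow> bool" where
  "is_cycle G c \<longleftrightarrow> 3 \<le> length c \<and> distinct c \<and> set c \<subseteq> verts G \<and>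
     (\<forall>i<length c. {c ! i, c ! (Suc i mod length c)} \<in> edges G)"

definition has_disjoint_cycles :: "nat \<Rightarrow> 'a graph \<Rightarrow> bool" where
  "has_disjoint_cycles m G \<longleftrightarrow>
     (\<exists>c :: nat \<Rightarrow> 'a list. (\<forall>i<m. is_cycle G (c i)) \<and>
        disjoint_family_on (\<lambda>i. set (c i)) {..<m})"

definition Ex_cycles :: "nat \<Rightarrow> 'a graph set" where
  "Ex_cycles m = {G \<in> simple_graphs. \<not> has_disjoint_cycles m G}"

definition on_vertices :: "nat graph set \<Rightarrow> nat \<Rightarrow> nat graph set" where
  "on_vertices A n = {G \<in> A. verts G = {1..n}}"

definition is_clique :: "'a graph \<Rightarrow> 'a set \<Rightarrow> bool" where
  "is_clique G C \<longleftrightarrow> C \<subseteq> verts G \<and> (\<forall>u\<in>C. \<forall>v\<in>C. u \<noteq> v \<longrightarrow> {u, v} \<in> edges G)"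

definition clique_number :: "'a graph \<Rightarrow> nat" where
  "clique_number G = Max {card C | C. is_clique G C}"

definition proper_colouring :: "'a graph \<Rightarrow> nat \<Rightarrow> ('a \<Rightarrow> nat) \<Rightarrow> bool" where
  "proper_colouring G q f \<longleftrightarrow> (\<forall>v\<in>verts G. f v < q) \<and>
     (\<forall>u\<in>verts G. \<forall>v\<in>verts G. {u, v} \<in> edges G \<longrightarrow> f u \<noteq> f v)"

definition chromatic_number :: "'a graph \<Rightarrow> nat" where
  "chromatic_number G = (LEAST q. \<exists>f. proper_colouring G q f)"

text \<open>The library's \<open>pmf_of_set\<close> is the uniform distribution only for finite nonempty sets;
  the following facts show that it is only applied to such sets.\<close>

lemma finite_on_vertices:
  assumes "A \<subseteq> simple_graphs"
  shows "finite (on_vertices A n)"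
proof (rule finite_subset)
  show "on_vertices A n \<subseteq> {{1..n}} \<times> Pow (Pow {1..n})"
  proof
    fix G assume "G \<in> on_vertices A n"
    then have "G \<in> simple_graphs" and V: "fst G = {1..n}"
      using assms unfolding on_vertices_def by blast+
    then have "snd G \<subseteq> Pow {1..n}"
      unfolding simple_graphs_def V[symmetric] by blast
    then show "G \<in> {{1..n}} \<times> Pow (Pow {1..n})"
      using V by (simp add: mem_Times_iff)
  qed
  show "finite ({{1..n}} \<times> Pow (Pow {1..n}))"
    by simp
qed

lemma on_vertices_simple_graphs_nonempty: "on_vertices simple_graphs n \<noteq> {}"
proof -
  have "({1..n}, {}) \<in> on_vertices simple_graphs n"
    by (simp add: on_vertices_def simple_graphs_def)
  then show ?thesis by blast
qed

lemma on_vertices_Ex_cycles_nonempty: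
  assumes "m \<ge> 1"
  shows "on_vertices (Ex_cycles m) n \<noteq> {}"
proof -
  have "\<not> is_cycle ({1..n}, {}) c" for c
    unfolding is_cycle_def by (cases c) auto
  moreover have "(0::nat) < m"
    using assms by simp
  ultimately have "\<not> has_disjoint_cycles m ({1..n}, {})"
    unfolding has_disjoint_cycles_def by blast
  then have "({1..n}, {}) \<in> on_vertices (Ex_cycles m) n"
    by (simp add: on_vertices_def Ex_cycles_def simple_graphs_def)
  then show ?thesis by blast
qed

definition uniform_prob :: "nat graph set \<Rightarrow> (nat graph \<Rightarrow> bool) \<Rightarrow> real" where
  "uniform_prob A P = measure_pmf.prob (pmf_of_set A) {G. P G}"

end

theory Submission
  imports Defs "HOL-Real_Asymp.Real_Asymp"
begin

text \<open>
  A set of vertices contains a cycle as soon as it spans at least as many edges as it has vertices,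
  so disjoint cycles may be replaced throughout by disjoint sets of this kind (\<open>cyclic\<close>), which
  are easy to lift along contractions.

  Upper bound. By the theorem of Erdos and Posa, a graph \<open>G\<close> without \<open>k + 1\<close> disjoint cycles has a
  blocker of bounded size. Enlarging it by at most \<open>k\<close> vertices one finds a set \<open>S\<close> of at most \<open>k\<close>
  hubs and a bounded set \<open>R\<close> such that \<open>M = V - S - R\<close> induces a forest and every \<open>v \<in> R\<close> has at
  most one neighbour in each tree of it. Encoding the forest by a parent map on \<open>M\<close>, one tree of
  size \<open>a\<close> allows \<open>(1 + a)\<^sup>r \<le> C (1 + \<epsilon>)\<^sup>a\<close> attachments to \<open>R\<close>; weighting roots by \<open>C\<close> and
  summing over all maps gives at most \<open>2\<^bsup>|S| n\<^esup> (n + C)\<^sup>n (1 + \<epsilon>)\<^sup>n\<close> graphs, up to polynomial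
  factors. If \<open>|S| < k\<close> this is exponentially smaller than the number \<open>2\<^bsup>k n\<^esup> n\<^sup>n\<close>, up to polynomial
  factors, of graphs made of \<open>k\<close> vertices joined arbitrarily to a forest. If \<open>|S| = k\<close>, a cycle
  avoiding \<open>S\<close> must meet nearly all disjoint edges whose ends are joined to all of \<open>S\<close>, so either
  there are few such edges or the forest contains long paths; both are exponentially unlikely.

  Hence almost every graph has a blocker \<open>B\<close> with \<open>|B| = k\<close> and \<open>k + 1\<close> disjoint edges outside \<open>B\<close>
  that are completely joined to \<open>B\<close>. Such a \<open>B\<close> is unique and the edges inside \<open>B\<close> are
  unconstrained, so \<open>G\<close> restricted to \<open>B\<close> is uniformly distributed, while both \<open>\<omega>\<close> and \<open>\<chi>\<close> exceed
  their values on \<open>B\<close> by exactly two.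
\<close>

subsection \<open>Cyclic vertex sets\<close>

text \<open>No asymptotic formula for the class is derived; an exponential gap between the bad
  graphs and the whole class is enough. So a graph may have many codes, polynomial factors are free,
  and upper bounds may replace forests by arbitrary self-maps. The obstacle is the leftover set
  \<open>R\<close>: its vertices may have linearly many neighbours in the forest, and allowing
  \<open>2 ^ n\<close> patterns for each would swamp every gain. With at most one neighbour per tree
  the number of patterns is bounded by a product over the trees, and trees are visible to a weight
  on the fixed points of the parent map. The loss of \<open>1 + \<epsilon>\<close> per vertex is
  affordable because the constants are fixed in a suitable order: \<open>r\<close> from
  \<open>k\<close>, the base \<open>\<Lambda> < 1\<close> of the exponential gain from
  \<open>k\<close>, then \<open>\<epsilon>\<close> with
  \<open>(1 + \<epsilon>) * \<Lambda> < 1\<close>, and finally \<open>C\<close> from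
  \<open>\<epsilon>\<close> and \<open>r\<close>. However large \<open>C\<close> is,
  \<open>(n + C) ^ n\<close> exceeds \<open>n ^ n\<close> at most by the constant factor
  \<open>exp C\<close>. A good blocker comes with \<open>k + 1\<close> disjoint edges because
  another set of \<open>k\<close> vertices cannot meet them all.\<close>

definition two_sets :: "'a set set \<Rightarrow> bool" where
  "two_sets E \<longleftrightarrow> (\<forall>e\<in>E. card e = 2)"

definition edges_in :: "'a set set \<Rightarrow> 'a set \<Rightarrow> 'a set set" where
  "edges_in E W = {e \<in> E. e \<subseteq> W}"

definition cyclic :: "'a set set \<Rightarrow> 'a set \<Rightarrow> bool" where
  "cyclic E W \<longleftrightarrow> finite W \<and> W \<noteq> {} \<and> card W \<le> card (edges_in E W)"

definition forest :: "'a set set \<Rightarrow> 'a set \<Rightarrow> bool" where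
  "forest E V \<longleftrightarrow> (\<forall>W\<subseteq>V. \<not> cyclic E W)"

definition deg :: "'a set set \<Rightarrow> 'a set \<Rightarrow> 'a \<Rightarrow> nat" where
  "deg E W x = card {e \<in> edges_in E W. x \<in> e}"

lemma finite_edges_in [simp]: "finite W \<Longrightarrow> finite (edges_in E W)"
  by (rule finite_subset[of _ "Pow W"]) (auto simp: edges_in_def)

lemma edges_in_mono: "E \<subseteq> E' \<Longrightarrow> W \<subseteq> W' \<Longrightarrow> edges_in E W \<subseteq> edges_in E' W'"
  by (auto simp: edges_in_def)

lemma card_edges_in_mono:
  "finite W' \<Longrightarrow> E \<subseteq> E' \<Longrightarrow> W \<subseteq> W' \<Longrightarrow> card (edges_in E W) \<le> card (edges_in E' W')"
  by (intro card_mono edges_in_mono) auto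

lemma two_setsD: "two_sets E \<Longrightarrow> {x, y} \<in> E \<Longrightarrow> x \<noteq> y"
  by (auto simp: two_sets_def)

lemma two_setsE:
  assumes "two_sets E" "e \<in> E"
  obtains x y where "e = {x, y}" "x \<noteq> y"
  using assms by (auto simp: two_sets_def card_2_iff)

lemma edges_in_doubleton [simp]: "{x, y} \<in> edges_in E W \<longleftrightarrow> {x, y} \<in> E \<and> x \<in> W \<and> y \<in> W"
  by (auto simp: edges_in_def)

lemma card_edges_in_remove:
  assumes "finite W"
  shows "card (edges_in E W) = card (edges_in E (W - {x})) + deg E W x"
proof -
  have "edges_in E W = edges_in E (W - {x}) \<union> {e \<in> edges_in E W. x \<in> e}"
    by (auto simp: edges_in_def)
  moreover have "edges_in E (W - {x}) \<inter> {e \<in> edges_in E W. x \<in> e} = {}"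
    by (auto simp: edges_in_def)
  ultimately show ?thesis
    unfolding deg_def using assms
    by (metis (no_types, lifting) card_Un_disjoint finite_Un finite_edges_in)
qed

lemma deg_eq:
  assumes "two_sets E" "x \<in> W"
  shows "deg E W x = card {y \<in> W. {x, y} \<in> E}"
proof -
  have "{e \<in> edges_in E W. x \<in> e} = (\<lambda>y. {x, y}) ` {y \<in> W. {x, y} \<in> E}"
  proof (intro equalityI subsetI)
    fix e assume e: "e \<in> {e \<in> edges_in E W. x \<in> e}"
    then have "e \<in> E" by (auto simp: edges_in_def)
    then obtain a b where ab: "e = {a, b}" using assms(1) by (meson two_setsE)
    then have "e = {x, if a = x then b else a}" using e by auto
    then show "e \<in> (\<lambda>y. {x, y}) ` {y \<in> W. {x, y} \<in> E}"
      using e ab by (auto simp: edges_in_def)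
  qed (use assms in auto)
  moreover have "inj_on (\<lambda>y. {x, y}) {y \<in> W. {x, y} \<in> E}"
    by (auto simp: inj_on_def doubleton_eq_iff)
  ultimately show ?thesis by (simp add: deg_def card_image)
qed

lemma handshake:
  assumes "two_sets E" "finite W"
  shows "(\<Sum>x\<in>W. deg E W x) = 2 * card (edges_in E W)"
proof -
  have "(\<Sum>x\<in>W. deg E W x) = (\<Sum>x\<in>W. \<Sum>e\<in>edges_in E W. if x \<in> e then 1 else 0)"
    using assms(2) by (intro sum.cong) (auto simp: deg_def sum.If_cases Int_def)
  also have "\<dots> = (\<Sum>e\<in>edges_in E W. \<Sum>x\<in>W. if x \<in> e then 1 else 0)"
    by (rule sum.swap)
  also have "\<dots> = (\<Sum>e\<in>edges_in E W. 2)"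
  proof (rule sum.cong)
    fix e assume e: "e \<in> edges_in E W"
    then have "W \<inter> e = e" by (auto simp: edges_in_def)
    moreover have "card e = 2" using e assms(1) by (auto simp: two_sets_def edges_in_def)
    ultimately show "(\<Sum>x\<in>W. if x \<in> e then 1 else 0) = (2::nat)"
      using assms(2) by (simp add: sum.If_cases)
  qed auto
  finally show ?thesis by simp
qed

text \<open>For \<open>c = 1\<close> and \<open>c = 2\<close> the number \<open>c choose 2\<close>
  of possible edges is smaller than \<open>c\<close>.\<close>

lemma cyclic_card_ge3:
  assumes "two_sets E" "cyclic E W"
  shows "3 \<le> card W"
proof (rule ccontr)
  have W: "finite W" "W \<noteq> {}" "card W \<le> card (edges_in E W)"
    using assms(2) by (auto simp: cyclic_def)
  have "edges_in E W \<subseteq> {e. e \<subseteq> W \<and> card e = 2}"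
    using assms(1) by (auto simp: edges_in_def two_sets_def)
  then have "card (edges_in E W) \<le> card W choose 2"
    using n_subsets[OF W(1), of 2] card_mono[of "{e. e \<subseteq> W \<and> card e = 2}"] W(1) by simp
  moreover assume "\<not> 3 \<le> card W"
  then have "card W = 0 \<or> card W = 1 \<or> card W = 2" by auto
  ultimately show False using W by (auto simp: numeral_2_eq_2)
qed

lemma triangle_cyclic:
  assumes E: "two_sets E" and abc: "{a, b} \<in> E" "{a, c} \<in> E" "{b, c} \<in> E"
  shows "cyclic E {a, b, c}"
proof -
  have ne: "a \<noteq> b" "a \<noteq> c" "b \<noteq> c" using two_setsD[OF E] abc by auto
  have "{{a, b}, {a, c}, {b, c}} \<subseteq> edges_in E {a, b, c}" using abc by (auto simp: edges_in_def)
  moreover have "card {{a, b}, {a, c}, {b, c}} = 3" using ne by (auto simp: doubleton_eq_iff)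
  ultimately have "3 \<le> card (edges_in E {a, b, c})"
    using card_mono[of "edges_in E {a, b, c}" "{{a, b}, {a, c}, {b, c}}"] by simp
  moreover have "card {a, b, c} = 3" using ne by auto
  ultimately show ?thesis by (simp add: cyclic_def)
qed

lemma cyclic_remove:
  assumes "two_sets E" "cyclic E W" "x \<in> W" "deg E W x \<le> 1"
  shows "cyclic E (W - {x})"
proof -
  have W: "finite W" "card W \<le> card (edges_in E W)" using assms(2) by (auto simp: cyclic_def)
  have "3 \<le> card W" by (rule cyclic_card_ge3[OF assms(1,2)])
  then have "2 \<le> card (W - {x})" using W(1) assms(3) by simp
  then have "W - {x} \<noteq> {}" by (metis card.empty not_numeral_le_zero)
  then show ?thesis
    using W assms(3,4) card_edges_in_remove[OF W(1), of E x] by (auto simp: cyclic_def)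
qed

lemma cyclic_mono: "cyclic E W \<Longrightarrow> E \<subseteq> E' \<Longrightarrow> cyclic E' W"
  unfolding cyclic_def using card_edges_in_mono[of W E E' W] by auto

text \<open>Write \<open>card (edges_in E W) = card W + t\<close>. Minimality forces every degree to
  be at least \<open>t + 2\<close>, so the handshake sum gives
  \<open>card W * t \<le> 2 * t\<close>, and \<open>card W \<ge> 3\<close> yields
  \<open>t = 0\<close>. The degrees are then at least two and average exactly two. Minimal cyclic
  sets thus behave like chordless cycles without any talk of paths.\<close>

lemma minimal_cyclic:
  assumes E: "two_sets E" and W: "cyclic E W" and min: "\<And>y. y \<in> W \<Longrightarrow> \<not> cyclic E (W - {y})"
  shows "card (edges_in E W) = card W" and "\<And>x. x \<in> W \<Longrightarrow> deg E W x = 2"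
proof -
  have fin: "finite W" and ge: "card W \<le> card (edges_in E W)" using W by (auto simp: cyclic_def)
  have W3: "3 \<le> card W" by (rule cyclic_card_ge3[OF E W])
  define t where "t = card (edges_in E W) - card W"
  have t: "card (edges_in E W) = card W + t" using ge by (simp add: t_def)
  have deg: "t + 2 \<le> deg E W x" if "x \<in> W" for x
  proof -
    have c: "card (W - {x}) = card W - 1" using that fin by simp
    then have "2 \<le> card (W - {x})" using W3 by simp
    then have "W - {x} \<noteq> {}" by (metis card.empty not_numeral_le_zero)
    then have "card (edges_in E (W - {x})) < card W - 1"
      using min[OF that] fin c by (auto simp: cyclic_def)
    then show ?thesis using card_edges_in_remove[OF fin, of E x] t by simp
  qed
  have "card W * (t + 2) = (\<Sum>x\<in>W. t + 2)" by simp
  also have "\<dots> \<le> (\<Sum>x\<in>W. deg E W x)" by (rule sum_mono) (use deg in auto)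
  also have "\<dots> = 2 * (card W + t)" using handshake[OF E fin] t by simp
  finally have "card W * t \<le> 2 * t" by (simp add: algebra_simps)
  moreover have "3 * t \<le> card W * t" using W3 by (rule mult_right_mono) simp
  ultimately have "3 * t \<le> 2 * t" by (rule order_trans[rotated])
  then have t0: "t = 0" by simp
  then show "card (edges_in E W) = card W" using t by simp
  fix x assume x: "x \<in> W"
  have s: "(\<Sum>x\<in>W. deg E W x - 2) = (\<Sum>x\<in>W. deg E W x) - (\<Sum>x\<in>W. 2)"
    by (rule sum_subtractf_nat) (use deg t0 in \<open>metis add_0\<close>)
  have "(\<Sum>x\<in>W. deg E W x - 2) = 0"
    unfolding s using handshake[OF E fin] t t0 by simp
  then have "deg E W x - 2 = 0" using x fin by simp
  then show "deg E W x = 2" using deg[OF x] by simp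
qed

lemma ex_minimal_cyclic:
  assumes "cyclic E W"
  obtains W' where "W' \<subseteq> W" "cyclic E W'" "\<And>y. y \<in> W' \<Longrightarrow> \<not> cyclic E (W' - {y})"
proof -
  have "\<exists>W'\<subseteq>W. cyclic E W' \<and> (\<forall>y\<in>W'. \<not> cyclic E (W' - {y}))"
    using assms
  proof (induction "card W" arbitrary: W rule: less_induct)
    case less
    show ?case
    proof (cases "\<exists>y\<in>W. cyclic E (W - {y})")
      case True
      then obtain y where y: "y \<in> W" "cyclic E (W - {y})" by blast
      have "finite W" using less by (auto simp: cyclic_def)
      then have "card (W - {y}) < card W" using y(1) by (rule card_Diff1_less)
      then show ?thesis using less(1)[OF _ y(2)] by blast
    qed (use less in blast)
  qed
  then show thesis using that by blast
qed

text \<open>The edges between consecutive vertices are pairwise distinct: if two of them coincided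
  at different positions, each position would be the cyclic successor of the other, which is
  impossible for length at least three.\<close>

lemma is_cycle_cyclic:
  assumes "is_cycle G c"
  shows "cyclic (edges G) (set c)"
proof -
  let ?l = "length c"
  let ?f = "\<lambda>i. {c ! i, c ! (Suc i mod ?l)}"
  have l: "3 \<le> ?l" and d: "distinct c" and e: "\<And>i. i < ?l \<Longrightarrow> ?f i \<in> edges G"
    using assms by (auto simp: is_cycle_def)
  have inj: "inj_on ?f {..<?l}"
  proof (rule inj_onI)
    fix i j assume ij: "i \<in> {..<?l}" "j \<in> {..<?l}" "?f i = ?f j"
    have m: "Suc i mod ?l < ?l" "Suc j mod ?l < ?l" using l by (auto intro: mod_less_divisor)
    show "i = j"
    proof (rule ccontr)
      assume ne: "i \<noteq> j"
      then have "c ! i \<noteq> c ! j" using d ij by (simp add: nth_eq_iff_index_eq)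
      then have "c ! i = c ! (Suc j mod ?l)" "c ! (Suc i mod ?l) = c ! j"
        using ij(3) by (auto simp: doubleton_eq_iff)
      then have *: "i = Suc j mod ?l" "j = Suc i mod ?l" using d ij m by (auto simp: nth_eq_iff_index_eq)
      have "Suc i = ?l \<or> Suc i < ?l" "Suc j = ?l \<or> Suc j < ?l" using ij(1,2) by auto
      then have "(j = 0 \<and> Suc i = ?l) \<or> j = Suc i" "(i = 0 \<and> Suc j = ?l) \<or> i = Suc j"
        using * by (metis mod_less mod_self)+
      then show False using l by linarith
    qed
  qed
  have "?f ` {..<?l} \<subseteq> edges_in (edges G) (set c)"
  proof
    fix x assume "x \<in> ?f ` {..<?l}"
    then obtain i where i: "i < ?l" "x = ?f i" by auto
    then have "Suc i mod ?l < ?l" by (intro mod_less_divisor) auto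
    then show "x \<in> edges_in (edges G) (set c)" using e[OF i(1)] i by auto
  qed
  then have "card (?f ` {..<?l}) \<le> card (edges_in (edges G) (set c))" by (intro card_mono) auto
  then have "card (set c) \<le> card (edges_in (edges G) (set c))"
    using card_image[OF inj] distinct_card[OF d] by simp
  then show ?thesis using l by (auto simp: cyclic_def)
qed

text \<open>Take a longest path inside a minimal cyclic set. By maximality both neighbours of its
  first vertex lie on it, and one of them is not the second vertex; the initial segment up to that
  neighbour closes up to a cycle.\<close>

lemma cyclic_has_cycle:
  assumes E: "two_sets (edges G)" and W: "cyclic (edges G) W" "W \<subseteq> verts G"
  obtains c where "is_cycle G c" "set c \<subseteq> W"
proof -
  obtain W' where W': "W' \<subseteq> W" "cyclic (edges G) W'"
    and min: "\<And>y. y \<in> W' \<Longrightarrow> \<not> cyclic (edges G) (W' - {y})"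
    using ex_minimal_cyclic[OF W(1)] by metis
  have fin: "finite W'" using W' by (auto simp: cyclic_def)
  define path where "path = (\<lambda>xs. distinct xs \<and> set xs \<subseteq> W' \<and> xs \<noteq> [] \<and>
    (\<forall>i. Suc i < length xs \<longrightarrow> {xs ! i, xs ! Suc i} \<in> edges G))"
  obtain w where w: "w \<in> W'" using W'(2) by (auto simp: cyclic_def)
  have "path [w]" using w by (simp add: path_def)
  moreover have "\<forall>xs. path xs \<longrightarrow> length xs < Suc (card W')"
    using fin by (auto simp: path_def less_Suc_eq_le dest: card_mono simp flip: distinct_card)
  ultimately obtain xs where xs: "path xs" and longest: "\<And>ys. path ys \<Longrightarrow> length ys \<le> length xs"
    using ex_has_greatest_nat[of path "[w]" length "Suc (card W')"] by (metis less_imp_le)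
  have d: "distinct xs" and sub: "set xs \<subseteq> W'" and ne: "xs \<noteq> []"
    and adj: "\<And>i. Suc i < length xs \<Longrightarrow> {xs ! i, xs ! Suc i} \<in> edges G"
    using xs by (auto simp: path_def)
  have h: "xs ! 0 \<in> W'" using sub ne by auto
  have on: "y \<in> set xs" if y: "y \<in> W'" "{xs ! 0, y} \<in> edges G" for y
  proof (rule ccontr)
    assume "y \<notin> set xs"
    moreover have "{(y # xs) ! i, (y # xs) ! Suc i} \<in> edges G" if "Suc i < length (y # xs)" for i
      using that adj y(2) by (cases i) (auto simp: insert_commute)
    ultimately have "path (y # xs)" using d sub y by (auto simp: path_def)
    then show False using longest[of "y # xs"] by simp
  qed
  have "card {y \<in> W'. {xs ! 0, y} \<in> edges G} = 2"
    using minimal_cyclic(2)[OF E W'(2) min h] deg_eq[OF E h] by simp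
  then obtain y where y: "y \<in> W'" "{xs ! 0, y} \<in> edges G" "y \<noteq> xs ! 1"
    by (smt (verit) card_2_iff mem_Collect_eq insertI1 insert_commute)
  obtain j where j: "j < length xs" "xs ! j = y" using on[OF y(1,2)] by (metis in_set_conv_nth)
  have "j \<noteq> 0" using two_setsD[OF E y(2)] j(2) by metis
  moreover have "j \<noteq> 1" using y(3) j by auto
  ultimately have j2: "2 \<le> j" by simp
  have "is_cycle G (take (Suc j) xs)"
    unfolding is_cycle_def
  proof (intro conjI allI impI)
    show "3 \<le> length (take (Suc j) xs)" using j j2 by simp
    show "distinct (take (Suc j) xs)" using d by simp
    show "set (take (Suc j) xs) \<subseteq> verts G"
      using set_take_subset[of "Suc j" xs] sub W'(1) W(2) by blast
    fix i assume "i < length (take (Suc j) xs)"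
    then have i: "i \<le> j" using j by simp
    have len: "length (take (Suc j) xs) = Suc j" using j by simp
    show "{take (Suc j) xs ! i, take (Suc j) xs ! (Suc i mod length (take (Suc j) xs))} \<in> edges G"
      unfolding len
    proof (cases "i = j")
      case True
      then show "{take (Suc j) xs ! i, take (Suc j) xs ! (Suc i mod Suc j)} \<in> edges G"
        using y(2) j by (simp add: insert_commute)
    next
      case False
      then have "Suc i < Suc j" using i by simp
      then show "{take (Suc j) xs ! i, take (Suc j) xs ! (Suc i mod Suc j)} \<in> edges G"
        using adj[of i] j by simp
    qed
  qed
  moreover have "set (take (Suc j) xs) \<subseteq> W"
    using set_take_subset[of "Suc j" xs] sub W'(1) by blast
  ultimately show thesis using that by blast
qed

section \<open>Packings of disjoint cyclic sets\<close>

definition packs :: "'a set set \<Rightarrow> 'a set \<Rightarrow> nat \<Rightarrow> bool" where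
  "packs E V m \<longleftrightarrow> (\<exists>f :: nat \<Rightarrow> 'a set. (\<forall>i<m. f i \<subseteq> V \<and> cyclic E (f i)) \<and>
     disjoint_family_on f {..<m})"

lemma has_disjoint_cycles_iff_packs:
  assumes "two_sets (edges G)"
  shows "has_disjoint_cycles m G \<longleftrightarrow> packs (edges G) (verts G) m"
proof
  assume "has_disjoint_cycles m G"
  then obtain c where c: "\<And>i. i < m \<Longrightarrow> is_cycle G (c i)" "disjoint_family_on (\<lambda>i. set (c i)) {..<m}"
    by (auto simp: has_disjoint_cycles_def)
  then show "packs (edges G) (verts G) m" unfolding packs_def
    by (intro exI[of _ "\<lambda>i. set (c i)"]) (auto simp: is_cycle_cyclic, auto simp: is_cycle_def)
next
  assume "packs (edges G) (verts G) m"
  then obtain f where f: "\<And>i. i < m \<Longrightarrow> f i \<subseteq> verts G \<and> cyclic (edges G) (f i)"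
    "disjoint_family_on f {..<m}"
    by (auto simp: packs_def)
  have "\<forall>i\<in>{..<m}. \<exists>c. is_cycle G c \<and> set c \<subseteq> f i"
    using cyclic_has_cycle[OF assms] f(1) by (metis lessThan_iff)
  then obtain c where c: "\<And>i. i < m \<Longrightarrow> is_cycle G (c i) \<and> set (c i) \<subseteq> f i"
    by (metis lessThan_iff)
  have "disjoint_family_on (\<lambda>i. set (c i)) {..<m}"
    using f(2) c unfolding disjoint_family_on_def by (metis (no_types, lifting) Int_mono lessThan_iff subset_empty)
  then show "has_disjoint_cycles m G" using c by (auto simp: has_disjoint_cycles_def)
qed

lemma packsI:
  assumes "finite I" "m \<le> card I" "\<And>i. i \<in> I \<Longrightarrow> f i \<subseteq> V" "\<And>i. i \<in> I \<Longrightarrow> cyclic E (f i)"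
    "disjoint_family_on f I"
  shows "packs E V m"
proof -
  obtain g where g: "bij_betw g {..<card I} I"
    using ex_bij_betw_nat_finite[OF assms(1)] by (auto simp: atLeast0LessThan)
  then have gI: "g i \<in> I" if "i < card I" for i using that by (auto simp: bij_betw_def)
  have "disjoint_family_on (\<lambda>i. f (g i)) {..<m}"
    unfolding disjoint_family_on_def
  proof (intro ballI impI)
    fix i j assume "i \<in> {..<m}" "j \<in> {..<m}" "i \<noteq> j"
    then have "g i \<noteq> g j" "g i \<in> I" "g j \<in> I"
      using g gI assms(2) by (auto simp: bij_betw_def inj_on_def)
    then show "f (g i) \<inter> f (g j) = {}" using assms(5) by (auto simp: disjoint_family_on_def)
  qed
  then show ?thesis unfolding packs_def using gI assms(2-4)
    by (intro exI[of _ "\<lambda>i. f (g i)"]) (meson less_le_trans)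
qed

lemma packs_mono_set:
  assumes "packs E V m" "V \<subseteq> V'"
  shows "packs E V' m"
  using assms unfolding packs_def by (meson subset_trans)

lemma packs_Suc:
  assumes "packs E (V - W) m" "cyclic E W" "W \<subseteq> V"
  shows "packs E V (Suc m)"
proof -
  obtain f where f: "\<And>i. i < m \<Longrightarrow> f i \<subseteq> V - W \<and> cyclic E (f i)" "disjoint_family_on f {..<m}"
    using assms(1) by (auto simp: packs_def)
  have fW: "f i \<inter> W = {}" if "i < m" for i using f(1)[OF that] by blast
  have "disjoint_family_on (f(m := W)) {..<Suc m}"
    unfolding disjoint_family_on_def
  proof (intro ballI impI)
    fix i j assume ij: "i \<in> {..<Suc m}" "j \<in> {..<Suc m}" "i \<noteq> j"
    then consider "i < m" "j < m" | "i < m" "j = m" | "i = m" "j < m" by force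
    then show "(f(m := W)) i \<inter> (f(m := W)) j = {}"
      using f(2) fW ij(3) by cases (auto simp: disjoint_family_on_def)
  qed
  moreover have "(f(m := W)) i \<subseteq> V \<and> cyclic E ((f(m := W)) i)" if "i < Suc m" for i
  proof (cases "i = m")
    case False
    then show ?thesis using that f(1)[of i] by auto
  qed (use assms in auto)
  ultimately show ?thesis unfolding packs_def by blast
qed

text \<open>The common form of undoing a reduction of the graph: \<open>g\<close> will be the
  preimage under a contraction, or the reinsertion of a suppressed vertex.\<close>

lemma packs_lift:
  assumes "packs E' V' m"
    and lift: "\<And>W. W \<subseteq> V' \<Longrightarrow> cyclic E' W \<Longrightarrow> g W \<subseteq> V \<and> cyclic E (g W)"
    and disj: "\<And>W U. W \<subseteq> V' \<Longrightarrow> U \<subseteq> V' \<Longrightarrow> W \<inter> U = {} \<Longrightarrow> g W \<inter> g U = {}"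
  shows "packs E V m"
proof -
  obtain f where f: "\<And>i. i < m \<Longrightarrow> f i \<subseteq> V' \<and> cyclic E' (f i)" "disjoint_family_on f {..<m}"
    using assms(1) by (auto simp: packs_def)
  show ?thesis unfolding packs_def
    by (intro exI[of _ "\<lambda>i. g (f i)"]) (use f lift disj in \<open>auto simp: disjoint_family_on_def\<close>)
qed

subsection \<open>Graphs without short cycles are sparse\<close>

text \<open>Delete a cyclic set \<open>W\<close> of least size. It spans exactly
  \<open>card W\<close> edges, and every outside vertex has at most four neighbours in it, so at
  most \<open>4 * card V\<close> edges disappear and the density hypothesis survives for
  \<open>m\<close> in place of \<open>Suc m\<close>.\<close>

lemma dense_packs:
  assumes E: "two_sets E"
  shows "finite V \<Longrightarrow> V \<noteq> {} \<Longrightarrow> 4 * m * card V \<le> card (edges_in E V) \<Longrightarrow> packs E V m"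
proof (induction m arbitrary: V)
  case 0
  then show ?case by (auto simp: packs_def disjoint_family_on_def)
next
  case (Suc m)
  have "card V \<le> 4 * Suc m * card V" by simp
  then have "cyclic E V" using Suc.prems unfolding cyclic_def by linarith
  then obtain W where W: "W \<subseteq> V" "cyclic E W" and
    least: "\<And>U. U \<subseteq> V \<Longrightarrow> cyclic E U \<Longrightarrow> card W \<le> card U"
    using ex_has_least_nat[of "\<lambda>W. W \<subseteq> V \<and> cyclic E W" V card] by (metis order_refl)
  have fW: "finite W" using W by (auto simp: cyclic_def)
  have W3: "3 \<le> card W" by (rule cyclic_card_ge3[OF E W(2)])
  have min: "\<not> cyclic E (W - {y})" if "y \<in> W" for y
    using least[of "W - {y}"] W(1) card_Diff1_less[OF fW that] by fastforce
  have eW: "card (edges_in E W) = card W" and dW: "\<And>x. x \<in> W \<Longrightarrow> deg E W x = 2"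
    using minimal_cyclic[OF E W(2)] min by auto
  \<comment> \<open>Add \<open>x\<close> to \<open>W\<close> and drop two vertices \<open>y\<close>
    and \<open>z\<close> of \<open>W\<close>. The new set has \<open>card W - 1\<close> vertices and
    has lost at most \<open>3 + 3\<close> of the \<open>card W + card N\<close> edges. Being smaller
    than \<open>W\<close> it is not cyclic, which forces \<open>card N \<le> 4\<close>.\<close>
  have few: "card {y \<in> W. {x, y} \<in> E} \<le> 4" if x: "x \<in> V - W" for x
  proof -
    define N where "N = {y \<in> W. {x, y} \<in> E}"
    obtain y where y: "y \<in> W" using W3 by fastforce
    have "card (W - {y}) \<ge> 2" using W3 y fW by simp
    then obtain z where z: "z \<in> W" "z \<noteq> y" by (metis card.empty Diff_iff all_not_in_conv insertI1 not_numeral_le_zero)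
    have "{u \<in> insert x W. {x, u} \<in> E} = N" using two_setsD[OF E] by (auto simp: N_def)
    then have "deg E (insert x W) x = card N" using deg_eq[OF E, of x "insert x W"] by simp
    then have 1: "card (edges_in E (insert x W)) = card W + card N"
      using card_edges_in_remove[of "insert x W" E x] fW x eW by simp
    have le3: "deg E U u \<le> 3" if "U \<subseteq> insert x W" "u \<in> W" "u \<in> U" for U u
    proof -
      have "{v \<in> U. {u, v} \<in> E} \<subseteq> insert x {v \<in> W. {u, v} \<in> E}" using that by auto
      then have "deg E U u \<le> card (insert x {v \<in> W. {u, v} \<in> E})"
        unfolding deg_eq[OF E that(3)] using fW by (intro card_mono) auto
      also have "\<dots> \<le> Suc (card {v \<in> W. {u, v} \<in> E})" by (rule card_insert_le_m1) auto
      also have "\<dots> = 3" using dW[OF that(2)] deg_eq[OF E that(2)] by simp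
      finally show ?thesis .
    qed
    let ?U = "insert x W - {y} - {z}"
    have "card (edges_in E (insert x W)) \<le> card (edges_in E ?U) + 6"
      using card_edges_in_remove[of "insert x W" E y] card_edges_in_remove[of "insert x W - {y}" E z]
        le3[of "insert x W" y] le3[of "insert x W - {y}" z] fW y z by auto
    moreover have cU: "card ?U = card W - 1" using x y z fW W3 by auto
    moreover have "card (edges_in E ?U) < card ?U"
    proof (rule ccontr)
      assume "\<not> card (edges_in E ?U) < card ?U"
      moreover have "0 < card ?U" using cU W3 by simp
      then have "?U \<noteq> {}" by (metis card.empty less_irrefl)
      ultimately have "cyclic E ?U" using fW by (auto simp: cyclic_def)
      moreover have "?U \<subseteq> V" using x W by auto
      ultimately show False using least[of ?U] cU W3 by fastforce
    qed
    ultimately show ?thesis using 1 W3 unfolding N_def by linarith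
  qed
  have "edges_in E V \<subseteq> edges_in E (V - W) \<union> edges_in E W \<union> (\<Union>x\<in>V - W. (\<lambda>y. {x, y}) ` {y \<in> W. {x, y} \<in> E})"
  proof
    fix e assume e: "e \<in> edges_in E V"
    then obtain a b where ab: "e = {a, b}" "e \<in> E" "a \<in> V" "b \<in> V"
      using E by (auto simp: edges_in_def elim: two_setsE)
    consider "a \<in> W" "b \<in> W" | "a \<notin> W" "b \<notin> W" | "a \<notin> W" "b \<in> W" | "a \<in> W" "b \<notin> W" by blast
    then show "e \<in> edges_in E (V - W) \<union> edges_in E W \<union> (\<Union>x\<in>V - W. (\<lambda>y. {x, y}) ` {y \<in> W. {x, y} \<in> E})"
    proof cases
      case 4
      then have "e \<in> (\<lambda>y. {b, y}) ` {y \<in> W. {b, y} \<in> E}" using ab by (auto simp: insert_commute)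
      then show ?thesis using 4 ab by blast
    qed (use ab in auto)
  qed
  then have "card (edges_in E V) \<le> card (edges_in E (V - W) \<union> edges_in E W \<union> (\<Union>x\<in>V - W. (\<lambda>y. {x, y}) ` {y \<in> W. {x, y} \<in> E}))"
    using Suc.prems fW by (intro card_mono) auto
  also have "\<dots> \<le> card (edges_in E (V - W)) + card (edges_in E W) + card (\<Union>x\<in>V - W. (\<lambda>y. {x, y}) ` {y \<in> W. {x, y} \<in> E})"
    by (meson card_Un_le add_le_mono1 le_trans)
  also have "card (\<Union>x\<in>V - W. (\<lambda>y. {x, y}) ` {y \<in> W. {x, y} \<in> E}) \<le> (\<Sum>x\<in>V - W. card ((\<lambda>y. {x, y}) ` {y \<in> W. {x, y} \<in> E}))"
    using Suc.prems by (intro card_UN_le) auto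
  also have "\<dots> \<le> (\<Sum>x\<in>V - W. 4)"
    using few fW by (intro sum_mono order_trans[OF card_image_le]) auto
  also have "\<dots> = 4 * (card V - card W)" using W fW by (simp add: card_Diff_subset)
  finally have *: "card (edges_in E V) \<le> card (edges_in E (V - W)) + card W + 4 * (card V - card W)"
    using eW by simp
  have cW: "card W \<le> card V" using W Suc.prems by (intro card_mono) auto
  have ge: "4 * m * card V \<le> card (edges_in E (V - W))" using * Suc.prems(3) cW by (simp add: distrib_right)
  have "packs E (V - W) m"
  proof (cases "V - W = {}")
    case True
    have "edges_in E (V - W) = {}" unfolding True using E by (auto simp: edges_in_def two_sets_def)
    then have "card (edges_in E (V - W)) = 0" by simp
    then have "m = 0" using ge Suc.prems(1,2) by simp
    then show ?thesis by (auto simp: packs_def disjoint_family_on_def)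
  next
    case False
    have "4 * m * card (V - W) \<le> 4 * m * card V" using Suc.prems(1) by (intro mult_le_mono card_mono) auto
    then have "4 * m * card (V - W) \<le> card (edges_in E (V - W))" using ge by (rule order_trans)
    then show ?thesis using Suc.IH[of "V - W"] False Suc.prems(1) by simp
  qed
  then show ?case using packs_Suc W by blast
qed

text \<open>This says that the girth exceeds \<open>l\<close>, since minimal cyclic sets are
  cycles.\<close>

definition no_short :: "'a set set \<Rightarrow> 'a set \<Rightarrow> nat \<Rightarrow> bool" where
  "no_short E V l \<longleftrightarrow> (\<forall>W\<subseteq>V. cyclic E W \<longrightarrow> l < card W)"

text \<open>A maximum independent set dominates its complement, and in the absence of isolated
  vertices the complement dominates it. The smaller of the two has at most half of the
  vertices.\<close>

lemma half_dominating:
  assumes E: "two_sets E" and V: "finite V" "V \<subseteq> \<Union>(edges_in E V)"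
  obtains D where "D \<subseteq> V" "2 * card D \<le> card V" "\<And>v. v \<in> V - D \<Longrightarrow> \<exists>d\<in>D. {v, d} \<in> E"
proof -
  define indep where "indep = (\<lambda>I. I \<subseteq> V \<and> (\<forall>x\<in>I. \<forall>y\<in>I. {x, y} \<notin> E))"
  have "indep {}" by (simp add: indep_def)
  moreover have "\<forall>I. indep I \<longrightarrow> card I \<le> card V"
    using V(1) by (auto simp: indep_def intro: card_mono)
  ultimately obtain I where I: "indep I" and max: "\<And>J. indep J \<Longrightarrow> card J \<le> card I"
    using ex_has_greatest_nat[of indep "{}" card "Suc (card V)"] by (metis le_imp_less_Suc)
  have IV: "I \<subseteq> V" using I by (simp add: indep_def)
  then have fI: "finite I" using V(1) finite_subset by blast
  have dI: "\<exists>d\<in>I. {v, d} \<in> E" if v: "v \<in> V - I" for v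
  proof (rule ccontr)
    assume "\<not> (\<exists>d\<in>I. {v, d} \<in> E)"
    moreover have "{v, v} \<notin> E" using two_setsD[OF E, of v v] by auto
    ultimately have "indep (insert v I)" using I v
      by (auto simp: indep_def insert_commute)
    then show False using max[of "insert v I"] fI v by simp
  qed
  have dc: "\<exists>d\<in>V - I. {v, d} \<in> E" if v: "v \<in> V - (V - I)" for v
  proof -
    obtain e where e: "e \<in> E" "e \<subseteq> V" "v \<in> e" using V(2) v by (auto simp: edges_in_def)
    then obtain a b where "e = {a, b}" using E by (metis two_setsE)
    then obtain u where u: "e = {v, u}" using e(3) by auto
    then have "u \<notin> I" using I v e by (auto simp: indep_def)
    then show ?thesis using e u by auto
  qed
  have "card I + card (V - I) = card V" using IV V(1) fI
    by (simp add: card_Diff_subset card_mono)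
  then consider "2 * card I \<le> card V" | "2 * card (V - I) \<le> card V" by linarith
  then show thesis
    using that[of I] that[of "V - I"] dI dc IV by cases blast+
qed

text \<open>The fibres of \<open>\<phi>\<close> are stars centred in \<open>D\<close>. Contracting
  them yields a graph on \<open>D\<close> whose surplus of edges over vertices is no smaller,
  provided there are no short cycles, while the girth drops at most by a factor of three. With
  \<open>D\<close> at most half of the vertices, repeated contraction increases the density until
  \<open>dense_packs\<close> applies.\<close>

locale star_contraction =
  fixes E :: "'a set set" and V D :: "'a set" and \<phi> :: "'a \<Rightarrow> 'a"
  assumes E: "two_sets E" and V: "finite V" and DV: "D \<subseteq> V"
    and centre: "\<And>v. v \<in> V \<Longrightarrow> \<phi> v \<in> D" and fixed: "\<And>v. v \<in> D \<Longrightarrow> \<phi> v = v"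
    and star: "\<And>v. v \<in> V - D \<Longrightarrow> {v, \<phi> v} \<in> E"
begin

definition cross :: "'a set set" where
  "cross = {e \<in> edges_in E V. card (\<phi> ` e) = 2}"

definition contracted :: "'a set set" where
  "contracted = (\<lambda>e. \<phi> ` e) ` cross"

lemma two_sets_contracted: "two_sets contracted"
  by (auto simp: two_sets_def contracted_def cross_def)

lemma contracted_subset: "e \<in> contracted \<Longrightarrow> e \<subseteq> D"
  using centre by (auto simp: contracted_def cross_def edges_in_def)

text \<open>Star edges and cross edges are told apart by the image under \<open>\<phi>\<close>,
  which has one element for the former and two for the latter, so the two counts add up.\<close>

lemma edges_in_star_bound:
  assumes W: "W \<subseteq> V" "\<phi> ` W \<subseteq> W" and C: "C \<subseteq> cross" "\<Union>C \<subseteq> W"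
  shows "card (W - D) + card C \<le> card (edges_in E W)"
proof -
  have fW: "finite W" using W V finite_subset by blast
  have idem: "\<phi> (\<phi> v) = \<phi> v" if "v \<in> V" for v using centre fixed that by auto
  let ?s = "\<lambda>w. {w, \<phi> w}"
  have "inj_on ?s (W - D)"
  proof (rule inj_onI)
    fix u v assume uv: "u \<in> W - D" "v \<in> W - D" "{u, \<phi> u} = {v, \<phi> v}"
    then have "\<phi> u \<in> D" "\<phi> v \<in> D" using centre W by auto
    then show "u = v" using uv by (auto simp: doubleton_eq_iff)
  qed
  then have 1: "card (?s ` (W - D)) = card (W - D)" by (rule card_image)
  have "card (\<phi> ` {w, \<phi> w}) = 1" if "w \<in> W" for w using idem W(1) that by auto
  then have disj: "?s ` (W - D) \<inter> C = {}" using C(1) by (fastforce simp: cross_def)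
  have sub: "?s ` (W - D) \<union> C \<subseteq> edges_in E W"
    using star W C by (auto simp: cross_def edges_in_def)
  then have "finite C" using fW by (meson finite_edges_in finite_subset le_supE)
  then have "card (?s ` (W - D) \<union> C) = card (W - D) + card C"
    using 1 disj fW by (simp add: card_Un_disjoint)
  then show ?thesis using card_mono[OF _ sub] fW by simp
qed

text \<open>The preimage of a cyclic set \<open>W\<close> gains one star edge for each vertex
  outside \<open>D\<close>, and every contracted edge lifts to a cross edge. Hence it is again
  cyclic, and preimages of disjoint sets are disjoint.\<close>

lemma contracted_packs:
  assumes "packs contracted D m"
  shows "packs E V m"
proof (rule packs_lift[OF assms, of "\<lambda>W. {v \<in> V. \<phi> v \<in> W}"])
  fix W assume W: "W \<subseteq> D" "cyclic contracted W"
  let ?g = "{v \<in> V. \<phi> v \<in> W}"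
  let ?C = "{e \<in> cross. \<phi> ` e \<subseteq> W}"
  have "edges_in contracted W = (\<lambda>e. \<phi> ` e) ` ?C" by (auto simp: edges_in_def contracted_def)
  moreover have "finite ?C" using V by (auto simp: cross_def)
  ultimately have "card (edges_in contracted W) \<le> card ?C" by (simp add: card_image_le)
  moreover have "card W \<le> card (edges_in contracted W)" using W by (simp add: cyclic_def)
  moreover have "card (?g - D) + card ?C \<le> card (edges_in E ?g)"
    using centre fixed DV by (intro edges_in_star_bound) (auto simp: cross_def edges_in_def)
  moreover have "?g \<inter> D = W" using W(1) DV fixed by auto
  moreover have "card ?g = card (?g - D) + card (?g \<inter> D)" using V
    by (simp add: card_Int_Diff[of ?g D])
  moreover have "W \<noteq> {}" using W by (simp add: cyclic_def)
  ultimately show "?g \<subseteq> V \<and> cyclic E ?g" using V by (auto simp: cyclic_def)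
qed auto

text \<open>Lift \<open>card W\<close> contracted edges to cross edges and add their ends to
  \<open>W\<close>. The result has at most \<open>card W + 2 * card W\<close> vertices and is cyclic
  by the star bound; this is the origin of the factor 3.\<close>

lemma contracted_no_short:
  assumes "no_short E V (3 * l)"
  shows "no_short contracted D l"
  unfolding no_short_def
proof (intro allI impI)
  fix W assume W: "W \<subseteq> D" "cyclic contracted W"
  have fW: "finite W" using W by (simp add: cyclic_def)
  obtain K where K: "K \<subseteq> edges_in contracted W" "card K = card W"
    using W(2) obtain_subset_with_card_n[of "card W" "edges_in contracted W"]
    by (auto simp: cyclic_def)
  have "\<forall>e\<in>K. \<exists>c\<in>cross. \<phi> ` c = e" using K(1) unfolding edges_in_def contracted_def by blast
  then obtain h where h: "\<And>e. e \<in> K \<Longrightarrow> h e \<in> cross \<and> \<phi> ` h e = e" by metis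
  have fK: "finite K" using K(1) fW by (meson finite_edges_in finite_subset)
  have "inj_on h K" using h by (metis inj_onI)
  then have cC: "card (h ` K) = card W" using K(2) by (simp add: card_image)
  define U where "U = W \<union> \<Union>(h ` K)"
  have hV: "h e \<subseteq> V" "card (h e) = 2" if "e \<in> K" for e
    using h[OF that] E by (auto simp: cross_def edges_in_def two_sets_def)
  have UV: "U \<subseteq> V" using hV W(1) DV by (auto simp: U_def)
  have \<phi>h: "\<phi> v \<in> W" if "e \<in> K" "v \<in> h e" for v e
    using h[OF that(1)] that K(1) by (auto simp: edges_in_def)
  have \<phi>W: "\<phi> v = v" if "v \<in> W" for v using fixed W(1) that by auto
  have "card (U - D) + card (h ` K) \<le> card (edges_in E U)"
    by (rule edges_in_star_bound) (use UV h \<phi>h \<phi>W in \<open>auto simp: U_def\<close>)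
  moreover have "U \<inter> D = W" using W(1) \<phi>h fixed by (auto simp: U_def) metis
  moreover have fU: "finite U" using UV V finite_subset by blast
  moreover have "card U = card (U - D) + card (U \<inter> D)" using fU
    by (simp add: card_Int_Diff[of U D])
  ultimately have "card U \<le> card (edges_in E U)" using cC by simp
  moreover have "U \<noteq> {}" using W(2) by (auto simp: cyclic_def U_def)
  ultimately have "cyclic E U" using fU by (simp add: cyclic_def)
  then have "3 * l < card U" using assms UV by (simp add: no_short_def)
  also have "card U \<le> card W + card (\<Union>(h ` K))" unfolding U_def by (rule card_Un_le)
  also have "card (\<Union>(h ` K)) \<le> (\<Sum>e\<in>K. card (h e))" using fK by (rule card_UN_le)
  also have "\<dots> = 2 * card W" using hV K(2) by simp
  finally show "l < card W" by simp
qed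

text \<open>An edge inside a fibre is a star edge, as otherwise it forms a triangle with the centre.
  Two cross edges with the same image would span, together with their two centres, a cyclic set of
  at most \<open>2 + 2 + 2 = 6\<close> vertices. So only \<open>card (V - D)\<close> edges are lost
  by contracting.\<close>

lemma card_edges_le:
  assumes "no_short E V 6"
  shows "card (edges_in E V) + card D \<le> card contracted + card V"
proof -
  have idem: "\<phi> (\<phi> v) = \<phi> v" if "v \<in> V" for v using centre fixed that by auto
  have sub: "edges_in E V - cross \<subseteq> (\<lambda>v. {v, \<phi> v}) ` (V - D)"
  proof
    fix e assume e: "e \<in> edges_in E V - cross"
    then obtain u v where uv: "e = {u, v}" "u \<noteq> v" "u \<in> V" "v \<in> V" "{u, v} \<in> E"
      using E by (auto simp: edges_in_def elim: two_setsE)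
    then have same: "\<phi> u = \<phi> v" using e by (auto simp: cross_def card_2_iff)
    show "e \<in> (\<lambda>v. {v, \<phi> v}) ` (V - D)"
    proof (cases "u \<in> D \<or> v \<in> D")
      case True
      then show ?thesis
      proof
        assume "u \<in> D"
        then have "\<phi> v = u" "v \<notin> D" using same fixed uv by auto
        then have "e = {v, \<phi> v}" using uv by auto
        then show ?thesis using uv \<open>v \<notin> D\<close> by blast
      next
        assume "v \<in> D"
        then have "\<phi> u = v" "u \<notin> D" using same fixed uv by auto
        then have "e = {u, \<phi> u}" using uv by auto
        then show ?thesis using uv \<open>u \<notin> D\<close> by blast
      qed
    next
      case False
      let ?W = "{u, v, \<phi> u}"
      have ne: "\<phi> u \<noteq> u" "\<phi> u \<noteq> v" using False centre uv by metis+
      have "{u, \<phi> u} \<in> E" "{v, \<phi> u} \<in> E" using star[of u] star[of v] False uv same by auto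
      then have "cyclic E ?W" using uv(5) by (intro triangle_cyclic[OF E])
      moreover have c3: "card ?W = 3" using ne uv(2) by auto
      moreover have "?W \<subseteq> V" using uv centre DV by auto
      ultimately have "6 < card ?W" using assms unfolding no_short_def by blast
      then show ?thesis using c3 by simp
    qed
  qed
  have "inj_on (\<lambda>e. \<phi> ` e) cross"
  proof (rule inj_onI, rule ccontr)
    fix e e' assume e: "e \<in> cross" "e' \<in> cross" "\<phi> ` e = \<phi> ` e'" "e \<noteq> e'"
    define X where "X = \<phi> ` e"
    define U where "U = X \<union> e \<union> e'"
    have c: "card X = 2" "card e = 2" "card e' = 2" "e \<subseteq> V" "e' \<subseteq> V"
      using e E by (auto simp: cross_def X_def two_sets_def edges_in_def)
    have XD: "X \<subseteq> D" using c centre by (auto simp: X_def)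
    have UV: "U \<subseteq> V" using c XD DV by (auto simp: U_def)
    have fU: "finite U" using UV V finite_subset by blast
    have \<phi>U: "\<phi> ` U \<subseteq> X" using e(3) XD fixed by (auto simp: U_def X_def)
    have "card (U - D) + card {e, e'} \<le> card (edges_in E U)"
      by (rule edges_in_star_bound) (use UV \<phi>U e in \<open>auto simp: U_def\<close>)
    moreover have "U \<inter> D = X"
    proof (intro equalityI subsetI)
      fix u assume "u \<in> U \<inter> D"
      then show "u \<in> X" using \<phi>U fixed[of u] by (metis IntD1 IntD2 image_subset_iff)
    qed (use XD in \<open>auto simp: U_def\<close>)
    moreover have "card U = card (U - D) + card (U \<inter> D)" using fU
      by (simp add: card_Int_Diff[of U D])
    ultimately have "card U \<le> card (edges_in E U)" using c e(4) by simp
    moreover have "U \<noteq> {}" using c by (auto simp: U_def)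
    ultimately have "cyclic E U" using fU by (simp add: cyclic_def)
    then have "6 < card U" using assms UV by (simp add: no_short_def)
    moreover have "card U \<le> card X + card e + card e'"
      unfolding U_def by (meson add_le_mono1 card_Un_le le_trans)
    ultimately show False using c by simp
  qed
  then have "card contracted = card cross" by (simp add: contracted_def card_image)
  moreover have "card (edges_in E V - cross) \<le> card (V - D)"
    using V by (intro order_trans[OF card_mono[OF _ sub] card_image_le]) auto
  moreover have "card (V - D) + card D = card V"
    using V DV by (metis card_Diff_subset card_mono finite_subset le_add_diff_inverse2)
  moreover have "cross \<subseteq> edges_in E V" by (auto simp: cross_def)
  then have "card (edges_in E V) = card (edges_in E V - cross) + card cross"
    using V by (metis card_Diff_subset card_mono finite_edges_in finite_subset le_add_diff_inverse2)
  ultimately show ?thesis by linarith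
qed

end

text \<open>Each round of contraction preserves the surplus of edges over vertices from below and
  halves the vertex set, so the bound on the surplus per vertex halves as well; \<open>3 ^ j\<close>
  pays for the girth lost in \<open>j\<close> rounds. The base case is
  \<open>dense_packs\<close>.\<close>

lemma sparse_if_no_short:
  "two_sets E \<Longrightarrow> finite V \<Longrightarrow> no_short E V (6 * 3 ^ j) \<Longrightarrow> \<not> packs E V m \<Longrightarrow>
    2 ^ j * card (edges_in E V) \<le> 2 ^ j * card V + 4 * m * card V"
proof (induction j arbitrary: E V)
  case 0
  show ?case
  proof (cases "V = {}")
    case True
    then have "edges_in E V = {}" using 0 by (auto simp: edges_in_def two_sets_def)
    then show ?thesis by simp
  next
    case False
    then show ?thesis using dense_packs[OF 0(1,2) False, of m] 0(4) by fastforce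
  qed
next
  case (Suc j)
  \<comment> \<open>Isolated vertices are discarded first, since they would not be dominated from
    the other side.\<close>
  define U where "U = \<Union>(edges_in E V)"
  have UV: "U \<subseteq> V" by (auto simp: U_def edges_in_def)
  then have fU: "finite U" using Suc.prems finite_subset by blast
  have eq: "edges_in E U = edges_in E V" by (auto simp: U_def edges_in_def)
  have "U \<subseteq> \<Union>(edges_in E U)" unfolding eq by (simp add: U_def)
  then obtain D where D: "D \<subseteq> U" "2 * card D \<le> card U" "\<And>v. v \<in> U - D \<Longrightarrow> \<exists>d\<in>D. {v, d} \<in> E"
    using half_dominating[OF Suc.prems(1) fU] by metis
  then obtain d where d: "\<And>v. v \<in> U - D \<Longrightarrow> d v \<in> D \<and> {v, d v} \<in> E" by metis
  define \<phi> where "\<phi> = (\<lambda>v. if v \<in> D then v else d v)"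
  interpret star_contraction E U D \<phi>
    by unfold_locales (use Suc.prems(1) fU D d in \<open>auto simp: \<phi>_def\<close>)
  have ns: "no_short E U l" if "no_short E V l" for l
    using that UV by (auto simp: no_short_def)
  have fD: "finite D" using D fU finite_subset by blast
  have "no_short contracted D (6 * 3 ^ j)"
    by (rule contracted_no_short) (use ns[OF Suc.prems(3)] in \<open>simp add: mult.left_commute mult.commute\<close>)
  moreover have "\<not> packs contracted D m"
    using contracted_packs packs_mono_set[OF _ UV] Suc.prems(4) by blast
  moreover have "edges_in contracted D = contracted" using contracted_subset by (auto simp: edges_in_def)
  ultimately have IH: "2 ^ j * card contracted \<le> 2 ^ j * card D + 4 * m * card D"
    using Suc.IH[OF two_sets_contracted fD] by simp
  have "no_short E V 6"
    unfolding no_short_def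
  proof (intro allI impI)
    fix W assume "W \<subseteq> V" "cyclic E W"
    then have "6 * 3 ^ Suc j < card W" using Suc.prems(3) by (auto simp: no_short_def)
    moreover have "(6::nat) * 1 \<le> 6 * 3 ^ Suc j" by (intro mult_le_mono) auto
    ultimately show "6 < card W" by linarith
  qed
  then have "card (edges_in E V) + card D \<le> card contracted + card U"
    using card_edges_le ns eq by simp
  then have "2 ^ j * (card (edges_in E V) + card D) \<le> 2 ^ j * (card contracted + card U)" by simp
  moreover have cU: "card U \<le> card V" using UV Suc.prems(2) by (simp add: card_mono)
  then have "2 ^ j * card U \<le> 2 ^ j * card V" by simp
  moreover have "m * (2 * card D) \<le> m * card V" using D(2) cU by (intro mult_le_mono) auto
  ultimately have "2 * (2 ^ j * card (edges_in E V)) \<le> 2 * (2 ^ j * card V) + 4 * (m * card V)"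
    using IH unfolding distrib_left mult.assoc mult.left_commute[of m 2] by linarith
  then show ?case by (simp add: mult.assoc)
qed

subsection \<open>Blockers and hubs\<close>

lemma forest_mono: "forest E V \<Longrightarrow> U \<subseteq> V \<Longrightarrow> forest E U"
  by (auto simp: forest_def)

text \<open>The average degree of a nonempty forest is below two.\<close>

lemma forest_leaf:
  assumes E: "two_sets E" and M: "finite M" "M \<noteq> {}" and F: "forest E M"
  obtains y where "y \<in> M" "deg E M y \<le> 1"
proof (rule ccontr)
  assume "\<not> thesis"
  then have "(\<Sum>y\<in>M. 2) \<le> (\<Sum>y\<in>M. deg E M y)" using that by (intro sum_mono) force
  moreover have "card (edges_in E M) < card M" using M F unfolding forest_def cyclic_def by auto
  ultimately show False using handshake[OF E M(1)] by simp
qed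

lemma forest_insert:
  assumes E: "two_sets E" and F: "forest E (V - {x})" and d: "deg E V x \<le> 1" and V: "finite V"
  shows "forest E V"
  unfolding forest_def
proof (intro allI impI notI)
  fix W assume W: "W \<subseteq> V" "cyclic E W"
  show False
  proof (cases "x \<in> W")
    case True
    have "{e \<in> edges_in E W. x \<in> e} \<subseteq> {e \<in> edges_in E V. x \<in> e}" using W by (auto simp: edges_in_def)
    then have "deg E W x \<le> deg E V x" unfolding deg_def using V by (intro card_mono) auto
    then have "cyclic E (W - {x})" using cyclic_remove[OF E W(2) True] d by simp
    moreover have "W - {x} \<subseteq> V - {x}" using W by auto
    ultimately show False using F unfolding forest_def by blast
  next
    case False
    then have "W \<subseteq> V - {x}" using W by auto
    then show False using F W(2) unfolding forest_def by blast
  qed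
qed

text \<open>Remove short cycles and vertices of degree at most one, and suppress vertices of degree two
  (their neighbours are not adjacent in the absence of triangles). What remains has minimum degree
  three and no short cycle, so it is too dense for \<open>sparse_if_no_short\<close> unless it is empty.\<close>

theorem erdos_posa:
  "\<exists>f. \<forall>(E :: 'a set set) V. two_sets E \<longrightarrow> finite V \<longrightarrow> \<not> packs E V (Suc k) \<longrightarrow>
    (\<exists>B\<subseteq>V. card B \<le> f \<and> forest E (V - B))"
proof (induction k)
  case 0
  have base: "\<exists>B\<subseteq>V. card B \<le> 0 \<and> forest E (V - B)" if "\<not> packs E V (Suc 0)" for E :: "'a set set" and V
  proof -
    have p: "packs E U 0" for U by (auto simp: packs_def disjoint_family_on_def)
    have "forest E V" unfolding forest_def
    proof (intro allI impI notI)
      fix W assume "W \<subseteq> V" "cyclic E W"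
      then show False using packs_Suc[OF p] that by blast
    qed
    then show ?thesis by (intro exI[of _ "{}"]) auto
  qed
  show ?case by (rule exI[of _ 0], intro allI impI, erule base)
next
  case (Suc k)
  then obtain f where f: "\<And>(E :: 'a set set) V. two_sets E \<Longrightarrow> finite V \<Longrightarrow> \<not> packs E V (Suc k) \<Longrightarrow>
    \<exists>B\<subseteq>V. card B \<le> f \<and> forest E (V - B)" by blast
  \<comment> \<open>Only \<open>8 * (k + 2) < 2 ^ j\<close> matters. Minimum degree three gives
    \<open>3 * card V \<le> 2 * card (edges_in E V)\<close>, which together with the sparsity bound
    would yield \<open>2 ^ j \<le> 8 * (k + 2)\<close>.\<close>
  define j where "j = 8 * Suc (Suc k)"
  define l :: nat where "l = 6 * 3 ^ j"
  have j: "8 * Suc (Suc k) < 2 ^ j" unfolding j_def by (rule less_exp)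
  have l3: "3 \<le> l" using one_le_power[of "3::nat" j] unfolding l_def by linarith
  have step: "\<exists>B\<subseteq>V. card B \<le> f + l \<and> forest E (V - B)"
    if "two_sets E" "finite V" "\<not> packs E V (Suc (Suc k))" for E :: "'a set set" and V
    using that
  proof (induction "card V" arbitrary: E V rule: less_induct)
    case less
    note E = less.prems(1) and V = less.prems(2)
    consider (empty) "V = {}"
      | (short) W where "W \<subseteq> V" "cyclic E W" "card W \<le> l"
      | (leaf) x where "x \<in> V" "deg E V x \<le> 1"
      | (two) x where "no_short E V l" "x \<in> V" "deg E V x = 2"
      | (three) "no_short E V l" "V \<noteq> {}" "\<And>x. x \<in> V \<Longrightarrow> 3 \<le> deg E V x"
    proof -
      assume a: "V = {} \<Longrightarrow> thesis" "\<And>W. W \<subseteq> V \<Longrightarrow> cyclic E W \<Longrightarrow> card W \<le> l \<Longrightarrow> thesis"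
        "\<And>x. x \<in> V \<Longrightarrow> deg E V x \<le> 1 \<Longrightarrow> thesis"
        "\<And>x. no_short E V l \<Longrightarrow> x \<in> V \<Longrightarrow> deg E V x = 2 \<Longrightarrow> thesis"
        "no_short E V l \<Longrightarrow> V \<noteq> {} \<Longrightarrow> (\<And>x. x \<in> V \<Longrightarrow> 3 \<le> deg E V x) \<Longrightarrow> thesis"
      have "no_short E V l \<or> (\<exists>W\<subseteq>V. cyclic E W \<and> card W \<le> l)"
        by (auto simp: no_short_def not_less)
      moreover have "(\<exists>x\<in>V. deg E V x \<le> 1) \<or> (\<exists>x\<in>V. deg E V x = 2) \<or> (\<forall>x\<in>V. 3 \<le> deg E V x)"
        by (metis One_nat_def Suc_1 not_less_eq_eq numeral_3_eq_3 le_antisym)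
      ultimately show thesis using a by blast
    qed
    then show ?case
    proof cases
      case empty
      then show ?thesis by (auto simp: forest_def cyclic_def)
    next
      case short
      \<comment> \<open>The outer hypothesis for \<open>k\<close> finishes this case at once. The
        short set is therefore paid for only once, and the bound stays at
        \<open>f + l\<close>.\<close>
      have "\<not> packs E (V - W) (Suc k)" using packs_Suc[OF _ short(2,1)] less.prems(3) by blast
      then obtain B where B: "B \<subseteq> V - W" "card B \<le> f" "forest E (V - W - B)"
        using f[OF E, of "V - W"] V by blast
      have "card (B \<union> W) \<le> f + l" using B(2) short(3) card_Un_le[of B W] by linarith
      moreover have "V - (B \<union> W) = V - W - B" by auto
      ultimately show ?thesis using B short(1) by (intro exI[of _ "B \<union> W"]) auto
    next
      case leaf
      have "card (V - {x}) < card V" using V leaf(1) by (rule card_Diff1_less)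
      moreover have "\<not> packs E (V - {x}) (Suc (Suc k))" using less.prems(3) packs_mono_set by blast
      ultimately obtain B where B: "B \<subseteq> V - {x}" "card B \<le> f + l" "forest E (V - {x} - B)"
        using less.hyps[OF _ E, of "V - {x}"] V by blast
      have "{e \<in> edges_in E (V - B). x \<in> e} \<subseteq> {e \<in> edges_in E V. x \<in> e}" by (auto simp: edges_in_def)
      then have "deg E (V - B) x \<le> deg E V x" unfolding deg_def using V by (intro card_mono) auto
      moreover have "V - B - {x} = V - {x} - B" by auto
      ultimately have "forest E (V - B)" using forest_insert[OF E, of "V - B" x] B(3) leaf(2) V by simp
      then show ?thesis using B by blast
    next
      case two
      have "card {y \<in> V. {x, y} \<in> E} = 2" using two(2,3) deg_eq[OF E] by simp
      then obtain a b where ab: "{y \<in> V. {x, y} \<in> E} = {a, b}" "a \<noteq> b" by (auto simp: card_2_iff)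
      then have mem: "a \<in> V" "b \<in> V" "{x, a} \<in> E" "{x, b} \<in> E" by auto
      then have ne: "a \<noteq> x" "b \<noteq> x" using two_setsD[OF E] by auto
      have new: "{a, b} \<notin> E"
      proof
        assume "{a, b} \<in> E"
        then have "cyclic E {x, a, b}" using mem by (intro triangle_cyclic[OF E])
        moreover have "card {x, a, b} = 3" using ab(2) ne by auto
        moreover have "{x, a, b} \<subseteq> V" using two(2) mem by auto
        ultimately have "l < 3" using two(1) unfolding no_short_def by metis
        then show False using l3 by simp
      qed
      define E' where "E' = insert {a, b} E"
      have E': "two_sets E'" using E ab(2) by (auto simp: E'_def two_sets_def)
      have del: "card (edges_in E W) = card (edges_in E (W - {x})) + card ({a, b} \<inter> W)"
        if "W \<subseteq> V" "x \<in> W" for W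
      proof -
        have "{y \<in> W. {x, y} \<in> E} = {a, b} \<inter> W" using ab(1) that by auto
        then show ?thesis using card_edges_in_remove[of W E x] deg_eq[OF E that(2)] that V finite_subset by metis
      qed
      have add: "card (edges_in E' W) = card (edges_in E W) + (if {a, b} \<subseteq> W then 1 else 0)" if "finite W" for W
      proof (cases "{a, b} \<subseteq> W")
        case True
        then have "edges_in E' W = insert {a, b} (edges_in E W)" by (auto simp: E'_def edges_in_def)
        then show ?thesis using True new that by (simp add: edges_in_def)
      next
        case False
        then have "edges_in E' W = edges_in E W" by (auto simp: E'_def edges_in_def)
        then show ?thesis using False by simp
      qed
      \<comment> \<open>A cyclic set that contains both \<open>a\<close> and \<open>b\<close> may
        use the new edge. Reinserting \<open>x\<close> adds one vertex and trades this edge for the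
        two edges at \<open>x\<close>.\<close>
      let ?g = "\<lambda>W. if {a, b} \<subseteq> W then insert x W else W"
      have "packs E V m" if "packs E' (V - {x}) m" for m
      proof (rule packs_lift[OF that, of ?g])
        fix W assume W: "W \<subseteq> V - {x}" "cyclic E' W"
        have fW: "finite W" using W by (auto simp: cyclic_def)
        show "?g W \<subseteq> V \<and> cyclic E (?g W)"
        proof (cases "{a, b} \<subseteq> W")
          case True
          then have "{a, b} \<inter> insert x W = {a, b}" by auto
          moreover have "insert x W - {x} = W" using W by auto
          ultimately have "card (edges_in E (insert x W)) = card (edges_in E W) + 2"
            using del[of "insert x W"] W(1) two(2) ab(2) by auto
          moreover have "card (insert x W) = Suc (card W)" using W(1) fW by (metis Diff_iff card_insert_disjoint insertI1 subsetD)
          ultimately show ?thesis using W add[OF fW] True two(2) by (auto simp: cyclic_def)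
        next
          case False
          then show ?thesis using W add[OF fW] by (auto simp: cyclic_def)
        qed
      next
        fix W U assume "W \<subseteq> V - {x}" "U \<subseteq> V - {x}" "W \<inter> U = {}"
        then show "?g W \<inter> ?g U = {}" by auto
      qed
      then have "\<not> packs E' (V - {x}) (Suc (Suc k))" using less.prems(3) by blast
      moreover have "card (V - {x}) < card V" using V two(2) by (rule card_Diff1_less)
      ultimately obtain B where B: "B \<subseteq> V - {x}" "card B \<le> f + l" "forest E' (V - {x} - B)"
        using less.hyps[OF _ E', of "V - {x}"] V by blast
      have "forest E (V - B)"
        unfolding forest_def
      proof (intro allI impI notI)
        fix W assume W: "W \<subseteq> V - B" "cyclic E W"
        have fW: "finite W" using W by (auto simp: cyclic_def)
        \<comment> \<open>Dropping \<open>x\<close> costs one vertex and may cost two edges. It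
          costs two only if both neighbours lie in \<open>W\<close>, and then the new edge between
          them makes up for one.\<close>
        have "cyclic E' (W - {x})"
        proof (cases "x \<in> W")
          case False
          then show ?thesis using cyclic_mono[OF W(2), of E'] by (simp add: E'_def subset_insertI)
        next
          case True
          have W3: "3 \<le> card W" by (rule cyclic_card_ge3[OF E W(2)])
          have c: "card (W - {x}) = card W - 1" using True fW by simp
          then have "0 < card (W - {x})" using W3 by simp
          then have "W - {x} \<noteq> {}" by (metis card.empty less_irrefl)
          moreover have "card ({a, b} \<inter> W) \<le> Suc (if {a, b} \<subseteq> W - {x} then 1 else 0)"
          proof (cases "{a, b} \<subseteq> W - {x}")
            case False
            then have "{a, b} \<inter> W \<subseteq> {a} \<or> {a, b} \<inter> W \<subseteq> {b}" using ne by auto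
            then have "card ({a, b} \<inter> W) \<le> card {a} \<or> card ({a, b} \<inter> W) \<le> card {b}"
              by (meson card_mono finite.emptyI finite.insertI)
            then show ?thesis by simp
          qed (use ab(2) in \<open>auto simp: Int_absorb2\<close>)
          moreover have "card W \<le> card (edges_in E W)" using W by (simp add: cyclic_def)
          moreover have "W \<subseteq> V" using W(1) by auto
          moreover have "finite (W - {x})" using fW by simp
          ultimately have "card (W - {x}) \<le> card (edges_in E' (W - {x}))"
            using del[OF _ True] add[of "W - {x}"] c by linarith
          then show ?thesis using fW \<open>W - {x} \<noteq> {}\<close> by (simp add: cyclic_def)
        qed
        moreover have "W - {x} \<subseteq> V - {x} - B" using W(1) by auto
        ultimately show False using B(3) unfolding forest_def by blast
      qed
      then show ?thesis using B by blast
    next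
      case three
      have "3 * card V = (\<Sum>x\<in>V. 3)" by simp
      also have "\<dots> \<le> (\<Sum>x\<in>V. deg E V x)" using three(3) by (intro sum_mono) auto
      also have "\<dots> = 2 * card (edges_in E V)" by (rule handshake[OF E V])
      finally have "2 ^ j * (3 * card V) \<le> 2 ^ j * (2 * card (edges_in E V))" by simp
      moreover have "2 ^ j * card (edges_in E V) \<le> 2 ^ j * card V + 4 * Suc (Suc k) * card V"
        using three(1) less.prems(3) unfolding l_def by (intro sparse_if_no_short[OF E V])
      ultimately have "2 ^ j * card V \<le> 8 * Suc (Suc k) * card V"
        by (simp only: mult.left_commute[of _ 3] mult.left_commute[of _ 2])
      moreover have "8 * Suc (Suc k) * card V < 2 ^ j * card V" using j three(2) V by (intro mult_strict_right_mono) auto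
      ultimately show ?thesis by linarith
    qed
  qed
  show ?case by (intro exI[of _ "f + l"] allI impI step)
qed

text \<open>The families \<open>A v\<close> consist of subtrees of the forest. A leaf \<open>y\<close> that is a member by itself is
  taken greedily; any other leaf may be deleted from all members, since two members
  meeting in \<open>y\<close> also meet in its neighbour.\<close>

definition representatives :: "('b \<Rightarrow> 'a set set) \<Rightarrow> 'b set \<Rightarrow> 'b set \<Rightarrow> 'a set \<Rightarrow> ('b \<Rightarrow> 'a set) \<Rightarrow> bool" where
  "representatives A B S X f \<longleftrightarrow> card X \<le> card S \<and> (\<forall>v\<in>S. f v \<in> A v) \<and> disjoint_family_on f S \<and>
      (\<forall>v\<in>B - S. \<forall>P\<in>A v. P \<inter> X \<noteq> {})"

text \<open>Inside a forest the inequality on \<open>card P\<close> is an equality and expresses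
  that \<open>P\<close> is connected. Stated by counting, it is easily seen to survive the removal
  of a leaf. The outcome is a duality between packing and covering, with a cover no larger than the
  packing.\<close>

lemma forest_representatives:
  fixes A :: "'b \<Rightarrow> 'a set set"
  assumes E: "two_sets E"
  shows "finite V \<Longrightarrow> forest E V \<Longrightarrow> finite B \<Longrightarrow>
    (\<And>v P. v \<in> B \<Longrightarrow> P \<in> A v \<Longrightarrow> P \<subseteq> V \<and> P \<noteq> {} \<and> card P \<le> Suc (card (edges_in E P))) \<Longrightarrow>
    \<exists>S X f. S \<subseteq> B \<and> X \<subseteq> V \<and> representatives A B S X f"
proof (induction "card V" arbitrary: V B A rule: less_induct)
  case less
  note V = less.prems(1) and F = less.prems(2) and B = less.prems(3) and A = less.prems(4)
  show ?case
  proof (cases "V = {}")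
    case True
    then have "A v = {}" if "v \<in> B" for v using A[OF that] by blast
    then show ?thesis by (intro exI[of _ "{}"]) (auto simp: representatives_def disjoint_family_on_def)
  next
    case False
    obtain y where y: "y \<in> V" "deg E V y \<le> 1" using forest_leaf[OF E V False F] by blast
    have less': "card (V - {y}) < card V" using V y(1) by (rule card_Diff1_less)
    have V': "finite (V - {y})" using V by simp
    have F': "forest E (V - {y})" using F by (rule forest_mono) auto
    show ?thesis
    proof (cases "\<exists>v\<in>B. {y} \<in> A v")
      case True
      then obtain v where v: "v \<in> B" "{y} \<in> A v" by blast
      have "\<exists>S X f. S \<subseteq> B - {v} \<and> X \<subseteq> V - {y} \<and> representatives (\<lambda>w. {P \<in> A w. y \<notin> P}) (B - {v}) S X f"
        by (rule less.hyps[OF less' V' F']) (use B A in auto)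
      then obtain S X f where S0: "S \<subseteq> B - {v}" "X \<subseteq> V - {y}"
        and rep: "representatives (\<lambda>w. {P \<in> A w. y \<notin> P}) (B - {v}) S X f" by blast
      have S: "S \<subseteq> B - {v}" "X \<subseteq> V - {y}" "card X \<le> card S"
        "\<And>w. w \<in> S \<Longrightarrow> f w \<in> A w \<and> y \<notin> f w" "disjoint_family_on f S"
        "\<And>w P. w \<in> B - {v} - S \<Longrightarrow> P \<in> A w \<Longrightarrow> y \<notin> P \<Longrightarrow> P \<inter> X \<noteq> {}"
        using rep S0 unfolding representatives_def by auto
      have "finite S" "finite X" using S(1,2) B V finite_subset by blast+
      then have "card (insert y X) \<le> card (insert v S)" using S(1-3) by (auto simp: card_insert_if)
      moreover have "disjoint_family_on (f(v := {y})) (insert v S)"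
        using S(1,4,5) unfolding disjoint_family_on_def by auto
      moreover have "\<forall>w\<in>insert v S. (f(v := {y})) w \<in> A w" using S(1,4) v by auto
      moreover have "\<forall>w\<in>B - insert v S. \<forall>P\<in>A w. P \<inter> insert y X \<noteq> {}" using S(6) by blast
      moreover have "insert v S \<subseteq> B" "insert y X \<subseteq> V" using S(1,2) v y by auto
      ultimately have "representatives A B (insert v S) (insert y X) (f(v := {y}))"
        by (simp add: representatives_def)
      then show ?thesis using \<open>insert v S \<subseteq> B\<close> \<open>insert y X \<subseteq> V\<close> by blast
    next
      case False
      have degP: "deg E P y \<le> 1" if "P \<subseteq> V" for P
      proof -
        have "{e \<in> edges_in E P. y \<in> e} \<subseteq> {e \<in> edges_in E V. y \<in> e}" using that by (auto simp: edges_in_def)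
        then have "deg E P y \<le> deg E V y" unfolding deg_def using V by (intro card_mono) auto
        then show ?thesis using y(2) by simp
      qed
      have ne: "P - {y} \<noteq> {}" if "v \<in> B" "P \<in> A v" for v P
        using False A[OF that] that by (metis Diff_eq_empty_iff subset_singletonD)
      have "\<exists>S X f. S \<subseteq> B \<and> X \<subseteq> V - {y} \<and> representatives (\<lambda>w. (\<lambda>P. P - {y}) ` A w) B S X f"
      proof (rule less.hyps[OF less' V' F' B])
        fix v P assume v: "v \<in> B" "P \<in> (\<lambda>P. P - {y}) ` A v"
        then obtain Q where Q: "Q \<in> A v" "P = Q - {y}" by blast
        note AQ = A[OF v(1) Q(1)]
        have fQ: "finite Q" using AQ V finite_subset by blast
        have "card P \<le> Suc (card (edges_in E P))"
        proof (cases "y \<in> Q")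
          case True
          then show ?thesis using AQ card_edges_in_remove[OF fQ, of E y] degP[of Q] Q(2) fQ by fastforce
        qed (use AQ Q in simp)
        then show "P \<subseteq> V - {y} \<and> P \<noteq> {} \<and> card P \<le> Suc (card (edges_in E P))"
          using AQ Q(2) ne[OF v(1) Q(1)] by auto
      qed
      then obtain S X f where S0: "S \<subseteq> B" "X \<subseteq> V - {y}"
        and rep: "representatives (\<lambda>w. (\<lambda>P. P - {y}) ` A w) B S X f" by blast
      have S: "S \<subseteq> B" "X \<subseteq> V - {y}" "card X \<le> card S"
        "\<And>w. w \<in> S \<Longrightarrow> f w \<in> (\<lambda>P. P - {y}) ` A w" "disjoint_family_on f S"
        "\<And>w P. w \<in> B - S \<Longrightarrow> P \<in> A w \<Longrightarrow> (P - {y}) \<inter> X \<noteq> {}"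
        using rep S0 unfolding representatives_def by auto
      have "\<forall>w\<in>S. \<exists>Q. Q \<in> A w \<and> f w = Q - {y}" using S(4) by blast
      then obtain h where h: "\<And>w. w \<in> S \<Longrightarrow> h w \<in> A w \<and> f w = h w - {y}" by (auto dest!: bchoice)
      \<comment> \<open>If \<open>y\<close> had no neighbour in \<open>P\<close>, removing it would
        lose a vertex but no edge, and \<open>P - {y}\<close> would be a cyclic subset of the
        forest.\<close>
      have nb: "\<exists>z\<in>P. z \<noteq> y \<and> {y, z} \<in> E" if v: "v \<in> B" "P \<in> A v" "y \<in> P" for v P
      proof (rule ccontr)
        assume "\<not> (\<exists>z\<in>P. z \<noteq> y \<and> {y, z} \<in> E)"
        then have "{z \<in> P. {y, z} \<in> E} = {}" by (auto dest: two_setsD[OF E])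
        then have "deg E P y = 0" unfolding deg_eq[OF E v(3)] by (metis card.empty)
        moreover have fP: "finite P" using A[OF v(1,2)] V finite_subset by blast
        ultimately have "card (P - {y}) \<le> card (edges_in E (P - {y}))"
          using A[OF v(1,2)] card_edges_in_remove[OF fP, of E y] v(3) by fastforce
        then have "cyclic E (P - {y})" using ne[OF v(1,2)] fP by (simp add: cyclic_def)
        moreover have "P - {y} \<subseteq> V" using A[OF v(1,2)] by auto
        ultimately show False using F unfolding forest_def by blast
      qed
      have "disjoint_family_on h S"
        unfolding disjoint_family_on_def
      proof (intro ballI impI)
        fix v w assume vw: "v \<in> S" "w \<in> S" "v \<noteq> w"
        then have d: "f v \<inter> f w = {}" using S(5) by (auto simp: disjoint_family_on_def)
        have "y \<notin> h v \<or> y \<notin> h w"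
        proof (rule ccontr)
          assume "\<not> (y \<notin> h v \<or> y \<notin> h w)"
          then have y': "y \<in> h v" "y \<in> h w" by auto
          have A': "v \<in> B" "h v \<in> A v" "w \<in> B" "h w \<in> A w" using vw h S(1) by auto
          obtain z where z: "z \<in> h v" "z \<noteq> y" "{y, z} \<in> E" using nb[OF A'(1,2) y'(1)] by blast
          obtain z' where z': "z' \<in> h w" "z' \<noteq> y" "{y, z'} \<in> E" using nb[OF A'(3,4) y'(2)] by blast
          have "z \<in> V" "z' \<in> V" using z(1) z'(1) A[OF A'(1,2)] A[OF A'(3,4)] by auto
          then have "{z, z'} \<subseteq> {u \<in> V. {y, u} \<in> E}" using z z' by auto
          then have "card {z, z'} \<le> card {u \<in> V. {y, u} \<in> E}" using V by (intro card_mono) auto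
          then have "card {z, z'} \<le> 1" using y(2) unfolding deg_eq[OF E y(1)] by linarith
          then have "z = z'" by (cases "z = z'") auto
          then have "z \<in> f v \<inter> f w" using z z' h vw by auto
          then show False using d by auto
        qed
        then show "h v \<inter> h w = {}" using d h vw by auto
      qed
      moreover have "\<forall>w\<in>B - S. \<forall>P\<in>A w. P \<inter> X \<noteq> {}" using S(6) by blast
      moreover have "X \<subseteq> V" using S(2) by blast
      ultimately have "representatives A B S X h" using S(3) h by (auto simp: representatives_def)
      then show ?thesis using S(1) \<open>X \<subseteq> V\<close> by blast
    qed
  qed
qed

text \<open>For each vertex \<open>v\<close> of a blocker consider the subtrees of the forest that
  close a cycle with \<open>v\<close>. Vertices with disjoint representatives yield disjoint cycles,
  so there are at most \<open>k\<close> of them; they become the hubs. The cover \<open>X\<close>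
  joins \<open>R\<close>, after which no other vertex of the blocker lies on a cycle through the
  rest of the forest alone. The bound on \<open>R\<close> is \<open>f\<close> for the blocker plus
  \<open>k\<close> for \<open>X\<close>.\<close>

theorem hub_structure:
  "\<exists>r. \<forall>(E :: 'a set set) V. two_sets E \<longrightarrow> finite V \<longrightarrow> \<not> packs E V (Suc k) \<longrightarrow>
    (\<exists>S R. S \<subseteq> V \<and> R \<subseteq> V \<and> S \<inter> R = {} \<and> card S \<le> k \<and> card R \<le> r \<and> forest E (V - S - R) \<and>
      (\<forall>v\<in>R. forest E (insert v (V - S - R))))"
proof -
  obtain f where f: "\<And>(E :: 'a set set) V. two_sets E \<Longrightarrow> finite V \<Longrightarrow> \<not> packs E V (Suc k) \<Longrightarrow>
    \<exists>B\<subseteq>V. card B \<le> f \<and> forest E (V - B)" using erdos_posa[of k] by blast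
  have main: "\<exists>S R. S \<subseteq> V \<and> R \<subseteq> V \<and> S \<inter> R = {} \<and> card S \<le> k \<and> card R \<le> f + k \<and> forest E (V - S - R) \<and>
      (\<forall>v\<in>R. forest E (insert v (V - S - R)))"
    if E: "two_sets E" and V: "finite V" and np: "\<not> packs E V (Suc k)" for E :: "'a set set" and V
  proof -
    obtain B where B: "B \<subseteq> V" "card B \<le> f" "forest E (V - B)" using f[OF E V np] by blast
    have fB: "finite B" using B(1) V finite_subset by blast
    define A where "A = (\<lambda>v. {P. P \<subseteq> V - B \<and> P \<noteq> {} \<and> card P \<le> Suc (card (edges_in E P)) \<and> cyclic E (insert v P)})"
    have "\<exists>S X g. S \<subseteq> B \<and> X \<subseteq> V - B \<and> representatives A B S X g"
      by (rule forest_representatives[OF E _ B(3) fB]) (use V in \<open>auto simp: A_def\<close>)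
    then obtain S X g where S0: "S \<subseteq> B" "X \<subseteq> V - B" and rep: "representatives A B S X g" by blast
    have S: "S \<subseteq> B" "X \<subseteq> V - B" "card X \<le> card S"
      "\<And>v. v \<in> S \<Longrightarrow> g v \<in> A v" "disjoint_family_on g S"
      "\<And>v P. v \<in> B - S \<Longrightarrow> P \<in> A v \<Longrightarrow> P \<inter> X \<noteq> {}"
      using rep S0 unfolding representatives_def by auto
    have fS: "finite S" using S(1) fB finite_subset by blast
    have cS: "card S \<le> k"
    proof (rule ccontr)
      assume "\<not> card S \<le> k"
      moreover have "disjoint_family_on (\<lambda>v. insert v (g v)) S"
        using S(1,4,5) unfolding disjoint_family_on_def A_def by auto
      ultimately have "packs E V (Suc k)"
        using S(1,4) B(1) fS by (intro packsI[of S _ "\<lambda>v. insert v (g v)"]) (auto simp: A_def)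
      then show False using np by simp
    qed
    define R where "R = (B - S) \<union> X"
    have M: "V - S - R = V - B - X" using S(1) by (auto simp: R_def)
    have "forest E (insert v (V - B - X))" if v: "v \<in> R" for v
    proof (cases "v \<in> X")
      case True
      then show ?thesis using forest_mono[OF B(3)] S(2) by auto
    next
      case False
      then have vB: "v \<in> B - S" using v by (auto simp: R_def)
      show ?thesis
        unfolding forest_def
      proof (intro allI impI notI)
        fix U assume U: "U \<subseteq> insert v (V - B - X)" "cyclic E U"
        then obtain W where W: "W \<subseteq> U" "cyclic E W" "\<And>y. y \<in> W \<Longrightarrow> \<not> cyclic E (W - {y})"
          using ex_minimal_cyclic by metis
        have fW: "finite W" using W by (simp add: cyclic_def)
        have vW: "v \<in> W"
        proof (rule ccontr)
          assume "v \<notin> W"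
          then have "W \<subseteq> V - B" using W(1) U(1) by auto
          then show False using B(3) W(2) by (auto simp: forest_def)
        qed
        have W3: "3 \<le> card W" by (rule cyclic_card_ge3[OF E W(2)])
        let ?P = "W - {v}"
        \<comment> \<open>Taking \<open>v\<close> out of the minimal set removes two edges, so
          \<open>W - {v}\<close> has one vertex more than edges and belongs to \<open>A v\<close>.
          It would have to meet \<open>X\<close>, which \<open>W\<close> avoids.\<close>
        have "card (edges_in E W) = card W" "deg E W v = 2"
          using minimal_cyclic[OF E W(2,3)] vW by auto
        then have "card (edges_in E ?P) + 2 = card W" using card_edges_in_remove[OF fW, of E v] by simp
        moreover have cP: "card ?P = card W - 1" using vW fW by simp
        moreover have "0 < card ?P" using cP W3 by simp
        then have "?P \<noteq> {}" by (metis card.empty less_irrefl)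
        moreover have "insert v ?P = W" using vW by auto
        ultimately have "?P \<in> A v" using W U(1) by (auto simp: A_def)
        then show False using S(6)[OF vB] W(1) U(1) by blast
      qed
    qed
    moreover have "forest E (V - B - X)" using B(3) by (rule forest_mono) auto
    moreover have "card R \<le> f + k"
    proof -
      have "card R \<le> card (B - S) + card X" unfolding R_def by (rule card_Un_le)
      also have "card (B - S) \<le> card B" using fB by (intro card_mono) auto
      finally show ?thesis using B(2) S(3) cS by simp
    qed
    moreover have "S \<subseteq> V" "R \<subseteq> V" "S \<inter> R = {}" using S(1,2) B(1) by (auto simp: R_def)
    ultimately show ?thesis using cS unfolding M[symmetric] by blast
  qed
  show ?thesis by (intro exI[of _ "f + k"] allI impI main)
qed

subsection \<open>Encoding by parent maps\<close>

definition parent_edges :: "'a set \<Rightarrow> ('a \<Rightarrow> 'a) \<Rightarrow> 'a set set" where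
  "parent_edges M p = (\<lambda>u. {u, p u}) ` {u \<in> M. p u \<noteq> u}"

text \<open>The rank \<open>h\<close> certifies that iterating \<open>p\<close> never runs in a
  circle, and its bound by \<open>card M\<close> guarantees that \<open>card M\<close> iterations
  reach a root.\<close>

definition ranked :: "'a set \<Rightarrow> ('a \<Rightarrow> 'a) \<Rightarrow> ('a \<Rightarrow> nat) \<Rightarrow> bool" where
  "ranked M p h \<longleftrightarrow> (\<forall>u\<in>M. p u \<in> M \<and> h u < card M \<and> (p u \<noteq> u \<longrightarrow> h (p u) < h u))"

lemma edges_in_insert:
  assumes E: "two_sets E" and y: "y \<in> M"
  shows "edges_in E M = edges_in E (M - {y}) \<union> (\<lambda>u. {y, u}) ` {u \<in> M. {y, u} \<in> E}"
proof (intro equalityI subsetI)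
  fix e assume e: "e \<in> edges_in E M"
  show "e \<in> edges_in E (M - {y}) \<union> (\<lambda>u. {y, u}) ` {u \<in> M. {y, u} \<in> E}"
  proof (cases "y \<in> e")
    case True
    obtain a b where ab: "e = {a, b}" using e E by (auto simp: edges_in_def elim: two_setsE)
    then have "e = {y, if a = y then b else a}" using True by auto
    then show ?thesis using e ab by (auto simp: edges_in_def)
  qed (use e in \<open>auto simp: edges_in_def\<close>)
qed (use y in \<open>auto simp: edges_in_def\<close>)

text \<open>A vertex of degree at most one is put back as a child of its only neighbour, or as a
  root if it has none, with the largest rank and the colour opposite to its parent. The parent map
  serves the counting, the two-colouring the chromatic number.\<close>

lemma forest_parent_colour:
  assumes E: "two_sets E"
  shows "finite M \<Longrightarrow> forest E M \<Longrightarrow> \<exists>p h (c :: 'a \<Rightarrow> nat). ranked M p h \<and>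
    edges_in E M = parent_edges M p \<and> (\<forall>u\<in>M. c u < 2 \<and> (p u \<noteq> u \<longrightarrow> c (p u) \<noteq> c u))"
proof (induction "card M" arbitrary: M rule: less_induct)
  case less
  note M = less.prems(1)
  show ?case
  proof (cases "M = {}")
    case True
    then have "edges_in E M = {}" using E by (auto simp: edges_in_def two_sets_def)
    then show ?thesis using True by (auto simp: ranked_def parent_edges_def)
  next
    case False
    obtain y where y: "y \<in> M" "deg E M y \<le> 1" using forest_leaf[OF E M False less.prems(2)] by blast
    let ?M = "M - {y}"
    have "card ?M < card M" using M y(1) by (rule card_Diff1_less)
    moreover have "finite ?M" "forest E ?M" using M less.prems(2) forest_mono[of E M ?M] by auto
    ultimately have "\<exists>p h (c :: 'a \<Rightarrow> nat). ranked ?M p h \<and>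
      edges_in E ?M = parent_edges ?M p \<and> (\<forall>u\<in>?M. c u < 2 \<and> (p u \<noteq> u \<longrightarrow> c (p u) \<noteq> c u))"
      by (rule less.hyps)
    then obtain p h and c :: "'a \<Rightarrow> nat" where p: "ranked ?M p h" "edges_in E ?M = parent_edges ?M p"
      "\<forall>u\<in>?M. c u < 2 \<and> (p u \<noteq> u \<longrightarrow> c (p u) \<noteq> c u)" by blast
    obtain q where q: "q \<in> M" "(\<lambda>u. {y, u}) ` {u \<in> M. {y, u} \<in> E} = (if q = y then {} else {{y, q}})"
    proof (cases "{u \<in> M. {y, u} \<in> E} = {}")
      case True
      show thesis by (rule that[OF y(1)]) (use True in auto)
    next
      case False
      moreover have "finite {u \<in> M. {y, u} \<in> E}" using M by simp
      ultimately have "card {u \<in> M. {y, u} \<in> E} \<noteq> 0" by (simp only: card_0_eq not_False_eq_True)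
      moreover have "card {u \<in> M. {y, u} \<in> E} \<le> 1" using y(2) unfolding deg_eq[OF E y(1)] .
      ultimately have "card {u \<in> M. {y, u} \<in> E} = 1" by linarith
      then obtain q where q: "{u \<in> M. {y, u} \<in> E} = {q}" by (auto simp: card_1_singleton_iff)
      then have "q \<in> M" "{y, q} \<in> E" by auto
      then show thesis using that[of q] q two_setsD[OF E, of y q] by auto
    qed
    define p' where "p' = p(y := q)"
    define h' where "h' = h(y := card M - 1)"
    define c' where "c' = c(y := (if q = y then 0 else 1 - c q))"
    have cM: "card ?M = card M - 1" using y M by simp
    have "ranked M p' h'" unfolding ranked_def
    proof (intro ballI conjI impI)
      fix u assume u: "u \<in> M"
      have cp: "0 < card M" using M False by (simp add: card_gt_0_iff)
      show "p' u \<in> M" using u p(1) q(1) by (auto simp: p'_def ranked_def)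
      show "h' u < card M"
      proof (cases "u = y")
        case False
        then have "h u < card ?M" using u p(1) by (auto simp: ranked_def)
        then show ?thesis using False cM by (simp add: h'_def)
      qed (use cp in \<open>simp add: h'_def\<close>)
      assume ne: "p' u \<noteq> u"
      show "h' (p' u) < h' u"
      proof (cases "u = y")
        case True
        then have "q \<in> ?M" using ne q(1) by (auto simp: p'_def)
        then show ?thesis using True p(1) cM by (auto simp: p'_def h'_def ranked_def)
      next
        case False
        then have "u \<in> ?M" using u by auto
        then show ?thesis using False p(1) ne by (auto simp: p'_def h'_def ranked_def)
      qed
    qed
    moreover have "edges_in E M = parent_edges M p'"
    proof -
      have "{u \<in> M. p' u \<noteq> u} = {u \<in> ?M. p u \<noteq> u} \<union> (if q = y then {} else {y})"
        using y(1) by (auto simp: p'_def)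
      then have "parent_edges M p' = parent_edges ?M p \<union> (if q = y then {} else {{y, q}})"
        by (auto simp: parent_edges_def p'_def)
      then show ?thesis using edges_in_insert[OF E y(1)] q(2) p(2) by simp
    qed
    moreover have "c' u < 2 \<and> (p' u \<noteq> u \<longrightarrow> c' (p' u) \<noteq> c' u)" if u: "u \<in> M" for u
    proof (cases "u = y")
      case True
      have "c q < 2" if "q \<noteq> y" using that p(3) q(1) by auto
      then show ?thesis using True by (cases "q = y") (auto simp: c'_def p'_def less_2_cases_iff)
    next
      case False
      then have "u \<in> ?M" using u by auto
      moreover from this have "p u \<noteq> y" using p(1) by (auto simp: ranked_def)
      ultimately show ?thesis using False p(3) by (auto simp: c'_def p'_def)
    qed
    ultimately show ?thesis by blast
  qed
qed

lemma forest_two_colouring: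
  assumes E: "two_sets E" and M: "finite M" and F: "forest E M"
  obtains c :: "'a \<Rightarrow> nat" where "\<And>u. u \<in> M \<Longrightarrow> c u < 2"
    "\<And>u v. u \<in> M \<Longrightarrow> v \<in> M \<Longrightarrow> {u, v} \<in> E \<Longrightarrow> c u \<noteq> c v"
proof -
  obtain p h and c :: "'a \<Rightarrow> nat" where p: "edges_in E M = parent_edges M p"
    "\<forall>u\<in>M. c u < 2 \<and> (p u \<noteq> u \<longrightarrow> c (p u) \<noteq> c u)"
    using forest_parent_colour[OF E M F] by blast
  have "c u \<noteq> c v" if "u \<in> M" "v \<in> M" "{u, v} \<in> E" for u v
  proof -
    have "{u, v} \<in> parent_edges M p" using that p(1) by (simp flip: p(1))
    then obtain w where "w \<in> M" "p w \<noteq> w" "{u, v} = {w, p w}" by (auto simp: parent_edges_def)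
    then show ?thesis using p(2) by (auto simp: doubleton_eq_iff)
  qed
  then show thesis using that p(2) by blast
qed

lemma funpow_fixed: "p u = u \<Longrightarrow> (p ^^ n) u = u"
  by (induction n) auto

lemma funpow_closed:
  assumes "\<And>u. u \<in> M \<Longrightarrow> p u \<in> M"
  shows "u \<in> M \<Longrightarrow> (p ^^ n) u \<in> M"
  by (induction n) (auto simp: assms)

lemma ranked_funpow_fixed:
  assumes "ranked M p h"
  shows "u \<in> M \<Longrightarrow> h u \<le> n \<Longrightarrow> p ((p ^^ n) u) = (p ^^ n) u"
proof (induction n arbitrary: u)
  case 0
  then show ?case using assms by (force simp: ranked_def)
next
  case (Suc n)
  show ?case
  proof (cases "p u = u")
    case True
    then show ?thesis using funpow_fixed[of p u "Suc n"] by simp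
  next
    case False
    then have "p u \<in> M" "h (p u) \<le> n" using assms Suc.prems by (force simp: ranked_def)+
    then have "p ((p ^^ n) (p u)) = (p ^^ n) (p u)" by (rule Suc.IH)
    then show ?thesis by (simp add: funpow_swap1)
  qed
qed

lemma ranked_inj_on:
  assumes "ranked M p h"
  shows "inj_on (\<lambda>u. {u, p u}) {u \<in> M. p u \<noteq> u}"
proof (rule inj_onI, rule ccontr)
  fix u w assume u: "u \<in> {u \<in> M. p u \<noteq> u}" and w: "w \<in> {u \<in> M. p u \<noteq> u}"
    and "{u, p u} = {w, p w}" "u \<noteq> w"
  then have "p u = w" "p w = u" by (auto simp: doubleton_eq_iff)
  moreover have "h (p u) < h u" "h (p w) < h w" using assms u w by (auto simp: ranked_def)
  ultimately show False by simp
qed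

text \<open>Trees are named by their roots, which are the fixed points of the parent map.\<close>

lemma forest_neighbours_distinct_roots:
  assumes E: "two_sets E" and M: "finite M" and p: "ranked M p h" and eM: "parent_edges M p \<subseteq> E"
    and v: "v \<notin> M" "forest E (insert v M)" and n: "card M \<le> n"
  shows "inj_on (p ^^ n) {a \<in> M. {v, a} \<in> E}"
proof (rule inj_onI, rule ccontr)
  fix a b assume a: "a \<in> {a \<in> M. {v, a} \<in> E}" and b: "b \<in> {a \<in> M. {v, a} \<in> E}"
    and root: "(p ^^ n) a = (p ^^ n) b" and ne: "a \<noteq> b"
  have closed: "\<And>u. u \<in> M \<Longrightarrow> p u \<in> M" using p by (auto simp: ranked_def)
  \<comment> \<open>The ancestors of \<open>a\<close> and \<open>b\<close> form a set closed under
    \<open>p\<close> with the single root \<open>t\<close>, so it spans at least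
    \<open>card A - 1\<close> edges. Adding \<open>v\<close> brings one vertex and two edges, which
    makes the set cyclic.\<close>
  define A where "A = range (\<lambda>i. (p ^^ i) a) \<union> range (\<lambda>i. (p ^^ i) b)"
  have AM: "A \<subseteq> M" using a b funpow_closed[of M p, OF closed] by (auto simp: A_def)
  then have fA: "finite A" using M finite_subset by blast
  have pA: "p u \<in> A" if u: "u \<in> A" for u
  proof -
    obtain i where "u = (p ^^ i) a \<or> u = (p ^^ i) b" using u by (auto simp: A_def)
    then have "p u = (p ^^ Suc i) a \<or> p u = (p ^^ Suc i) b" by auto
    then show ?thesis unfolding A_def by blast
  qed
  define t where "t = (p ^^ n) a"
  have rk: "h a \<le> n" "h b \<le> n" using p a b n by (force simp: ranked_def)+
  have tfix: "p t = t" using ranked_funpow_fixed[OF p _ rk(1)] a by (simp add: t_def)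
  have only: "u = t" if u: "u \<in> A" "p u = u" for u
  proof -
    obtain i x where i: "u = (p ^^ i) x" "x = a \<or> x = b" using u by (auto simp: A_def)
    have "u = (p ^^ n) u" using funpow_fixed[of p u n] u(2) by simp
    also have "\<dots> = (p ^^ i) ((p ^^ n) x)" unfolding i(1)
      by (metis add.commute comp_apply funpow_add)
    also have "(p ^^ n) x = t" using i(2) root t_def by auto
    also have "(p ^^ i) t = t" using tfix by (rule funpow_fixed)
    finally show ?thesis .
  qed
  have tA: "t \<in> A" by (auto simp: A_def t_def)
  let ?s = "\<lambda>u. {u, p u}"
  have "inj_on ?s (A - {t})"
    by (rule inj_on_subset[OF ranked_inj_on[OF p]]) (use AM only in auto)
  then have 1: "card (?s ` (A - {t})) = card A - 1" using fA tA by (simp add: card_image)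
  have aA: "a \<in> A" "b \<in> A" unfolding A_def by (metis UnI1 UnI2 funpow_0 rangeI)+
  have vA: "v \<notin> A" using v AM by auto
  have sub: "?s ` (A - {t}) \<union> {{v, a}, {v, b}} \<subseteq> edges_in E (insert v A)"
  proof -
    have "?s u \<in> E" if "u \<in> A - {t}" for u using that only AM eM by (auto simp: parent_edges_def)
    then show ?thesis using pA a b aA by (auto simp: edges_in_def)
  qed
  have "card A - 1 + 2 = card (?s ` (A - {t}) \<union> {{v, a}, {v, b}})"
  proof -
    have "?s ` (A - {t}) \<inter> {{v, a}, {v, b}} = {}" using vA pA by (auto simp: doubleton_eq_iff)
    moreover have "card {{v, a}, {v, b}} = 2" using ne vA aA by (auto simp: doubleton_eq_iff)
    ultimately show ?thesis using 1 fA by (subst card_Un_disjoint) auto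
  qed
  also have "\<dots> \<le> card (edges_in E (insert v A))" using fA sub by (intro card_mono) auto
  finally have "card (insert v A) \<le> card (edges_in E (insert v A))"
    using vA fA tA by (simp add: card_insert_if)
  then have "cyclic E (insert v A)" using fA by (simp add: cyclic_def)
  then show False using v(2) AM unfolding forest_def by blast
qed

text \<open>For \<open>card M \<le> n\<close> these are the parent maps of rooted forests on
  \<open>M\<close>, and \<open>p ^^ n\<close> sends every vertex to the root of its tree.\<close>

definition parent_maps :: "nat \<Rightarrow> 'a set \<Rightarrow> ('a \<Rightarrow> 'a) set" where
  "parent_maps n M = {p \<in> M \<rightarrow>\<^sub>E M. \<forall>u\<in>M. p ((p ^^ n) u) = (p ^^ n) u}"

text \<open>At most one vertex is taken from each tree: these are the possible neighbourhoods in
  \<open>M\<close> of a vertex of \<open>R\<close>.\<close>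

definition transversals :: "nat \<Rightarrow> ('a \<Rightarrow> 'a) \<Rightarrow> 'a set \<Rightarrow> 'a set set" where
  "transversals n p M = {A. A \<subseteq> M \<and> inj_on (p ^^ n) A}"

definition assemble ::
  "'a set \<Rightarrow> 'a set \<Rightarrow> 'a set set \<Rightarrow> ('a \<Rightarrow> 'a) \<Rightarrow> ('a \<Rightarrow> 'a set) \<Rightarrow> ('a \<Rightarrow> 'a set) \<Rightarrow> 'a set set" where
  "assemble M R Q p att N =
     Q \<union> parent_edges M p \<union> (\<Union>v\<in>R. (\<lambda>a. {v, a}) ` att v) \<union> (\<Union>u\<in>M. (\<lambda>s. {s, u}) ` N u)"

lemma assemble_cover:
  assumes E: "two_sets E" and V: "finite V" "\<And>e. e \<in> E \<Longrightarrow> e \<subseteq> V" and M: "M = V - S - R"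
    and SR: "S \<subseteq> V" "R \<subseteq> V" "S \<inter> R = {}"
    and F: "forest E M" "\<And>v. v \<in> R \<Longrightarrow> forest E (insert v M)" and n: "card M \<le> n"
  obtains p h att where "p \<in> parent_maps n M" "ranked M p h" "edges_in E M = parent_edges M p"
    "att \<in> R \<rightarrow>\<^sub>E transversals n p M"
    "E = assemble M R (edges_in E (S \<union> R)) p att (\<lambda>u\<in>M. {s \<in> S. {s, u} \<in> E})"
proof -
  have fM: "finite M" using V(1) M by auto
  obtain p0 h where p0: "ranked M p0 h" "edges_in E M = parent_edges M p0"
    using forest_parent_colour[OF E fM F(1)] by blast
  define p where "p = restrict p0 M"
  have p: "ranked M p h" using p0(1) by (auto simp: ranked_def p_def)
  have eM: "edges_in E M = parent_edges M p" unfolding p0(2) by (auto simp: parent_edges_def p_def)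
  have "h u \<le> n" if "u \<in> M" for u using p that n by (force simp: ranked_def)
  then have pm: "p \<in> parent_maps n M"
    using p ranked_funpow_fixed[OF p] by (auto simp: parent_maps_def ranked_def p_def)
  define att where "att = (\<lambda>v\<in>R. {a \<in> M. {v, a} \<in> E})"
  have sub: "parent_edges M p \<subseteq> E" unfolding eM[symmetric] by (auto simp: edges_in_def)
  have "att \<in> R \<rightarrow>\<^sub>E transversals n p M"
    unfolding att_def transversals_def
    using forest_neighbours_distinct_roots[OF E fM p sub _ F(2) n] M by auto
  moreover have "E = assemble M R (edges_in E (S \<union> R)) p att (\<lambda>u\<in>M. {s \<in> S. {s, u} \<in> E})" (is "E = ?A")
  proof (intro equalityI subsetI)
    fix e assume e: "e \<in> E"
    then obtain a b where ab: "e = {a, b}" "{b, a} \<in> E" "{a, b} \<in> E" using E by (metis two_setsE insert_commute)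
    then have abV: "a \<in> V" "b \<in> V" using V(2)[OF e] by auto
    then consider "a \<in> S \<union> R" "b \<in> S \<union> R" | "a \<in> M" "b \<in> M" | "a \<in> M" "b \<in> R" | "a \<in> R" "b \<in> M"
      | "a \<in> M" "b \<in> S" | "a \<in> S" "b \<in> M" unfolding M by blast
    then show "e \<in> ?A"
    proof cases
      case 1
      then have "e \<in> edges_in E (S \<union> R)" using e ab by (auto simp: edges_in_def)
      then show ?thesis by (auto simp: assemble_def)
    next
      case 2
      then have "e \<in> parent_edges M p" using e ab unfolding eM[symmetric] by (auto simp: edges_in_def)
      then show ?thesis by (auto simp: assemble_def)
    next
      case 3
      then have "a \<in> att b" using ab by (auto simp: att_def)
      moreover have "e = {b, a}" using ab by auto
      ultimately show ?thesis using 3 unfolding assemble_def by blast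
    next
      case 4
      then have "b \<in> att a" using ab by (auto simp: att_def)
      then show ?thesis using 4 ab(1) unfolding assemble_def by blast
    next
      case 5
      then have "b \<in> (\<lambda>u\<in>M. {s \<in> S. {s, u} \<in> E}) a" using ab by auto
      moreover have "e = {b, a}" using ab by auto
      ultimately show ?thesis using 5 unfolding assemble_def by blast
    next
      case 6
      then have "a \<in> (\<lambda>u\<in>M. {s \<in> S. {s, u} \<in> E}) b" using ab by auto
      then show ?thesis using 6 ab(1) unfolding assemble_def by blast
    qed
  next
    fix e assume "e \<in> ?A"
    then show "e \<in> E" using sub by (auto simp: assemble_def edges_in_def att_def)
  qed
  ultimately show thesis using that pm p eM by blast
qed

section \<open>Counting assembled graphs\<close>

lemma finite_parent_maps [simp]: "finite M \<Longrightarrow> finite (parent_maps n M)"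
  by (rule finite_subset[of _ "M \<rightarrow>\<^sub>E M"]) (auto simp: parent_maps_def intro: finite_PiE)

lemma finite_transversals [simp]: "finite M \<Longrightarrow> finite (transversals n p M)"
  by (rule finite_subset[of _ "Pow M"]) (auto simp: transversals_def)

text \<open>Only the pair of parent map and hub pattern is restricted, by \<open>K\<close>; the
  edges inside \<open>T\<close> and the attachments of \<open>R\<close> stay free. All the
  information about bad graphs will be put into \<open>K\<close>.\<close>

definition assembled :: "nat \<Rightarrow> 'a set \<Rightarrow> 'a set \<Rightarrow> 'a set \<Rightarrow> (('a \<Rightarrow> 'a) \<times> ('a \<Rightarrow> 'a set)) set \<Rightarrow> 'a set set set" where
  "assembled n M R T K = (\<lambda>(Q, (p, N), att). assemble M R Q p att N) `
     (Pow (Pow T) \<times> (SIGMA x : K. R \<rightarrow>\<^sub>E transversals n (fst x) M))"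

lemma finite_assembled:
  assumes "finite M" "finite R" "finite T" "finite K"
  shows "finite (assembled n M R T K)"
  unfolding assembled_def using assms by (intro finite_imageI finite_cartesian_product finite_SigmaI finite_PiE) auto

text \<open>The supply \<open>Pow (Pow T)\<close> for the edges inside \<open>T\<close> is wasteful,
  but \<open>T\<close> will be the union of the hubs and \<open>R\<close>, whose size is bounded in
  terms of \<open>k\<close>.\<close>

lemma card_assembled_le:
  assumes "finite M" "finite R" "finite T" "finite K"
  shows "card (assembled n M R T K) \<le>
    2 ^ 2 ^ card T * (\<Sum>x\<in>K. card (transversals n (fst x) M) ^ card R)"
proof -
  have fin: "finite (R \<rightarrow>\<^sub>E transversals n p M)" for p using assms by (intro finite_PiE) auto
  have "card (assembled n M R T K) \<le> card (Pow (Pow T) \<times> (SIGMA x : K. R \<rightarrow>\<^sub>E transversals n (fst x) M))"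
    unfolding assembled_def using assms fin by (intro card_image_le finite_cartesian_product finite_SigmaI) auto
  also have "\<dots> = 2 ^ 2 ^ card T * (\<Sum>x\<in>K. card (R \<rightarrow>\<^sub>E transversals n (fst x) M))"
    using assms fin by (simp add: card_cartesian_product card_Pow)
  also have "(\<Sum>x\<in>K. card (R \<rightarrow>\<^sub>E transversals n (fst x) M)) = (\<Sum>x\<in>K. card (transversals n (fst x) M) ^ card R)"
    using assms by (simp add: card_PiE)
  finally show ?thesis .
qed

text \<open>A transversal is coded by choosing, for each root, either \<open>None\<close> or the one
  vertex taken from its tree.\<close>

lemma card_transversals_le:
  assumes M: "finite M" and p: "p \<in> parent_maps n M"
  shows "card (transversals n p M) \<le> (\<Prod>t\<in>{u \<in> M. p u = u}. Suc (card {u \<in> M. (p ^^ n) u = t}))"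
proof -
  let ?T = "{u \<in> M. p u = u}" and ?\<rho> = "p ^^ n"
  have closed: "\<And>u. u \<in> M \<Longrightarrow> p u \<in> M" using p by (auto simp: parent_maps_def)
  have \<rho>T: "?\<rho> u \<in> ?T" if "u \<in> M" for u
    using that p funpow_closed[of M p, OF closed] by (auto simp: parent_maps_def)
  let ?F = "\<lambda>t. insert None (Some ` {u \<in> M. ?\<rho> u = t})"
  let ?g = "\<lambda>A. \<lambda>t\<in>?T. if \<exists>a\<in>A. ?\<rho> a = t then Some (THE a. a \<in> A \<and> ?\<rho> a = t) else None"
  have val: "?g A (?\<rho> a) = Some a" if "A \<in> transversals n p M" "a \<in> A" for A a
  proof -
    have "(THE b. b \<in> A \<and> ?\<rho> b = ?\<rho> a) = a"
      using that by (intro the_equality) (auto simp: transversals_def inj_on_def)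
    moreover have "?\<rho> a \<in> ?T" using that \<rho>T by (auto simp: transversals_def)
    ultimately show ?thesis using that(2) by auto
  qed
  have none: "?g A t = None" if "t \<in> ?T" "\<not> (\<exists>a\<in>A. ?\<rho> a = t)" for A t using that by auto
  have mem: "a \<in> A \<longleftrightarrow> a \<in> M \<and> ?g A (?\<rho> a) = Some a" if A: "A \<in> transversals n p M" for A a
  proof
    assume "a \<in> A"
    then show "a \<in> M \<and> ?g A (?\<rho> a) = Some a" using val[OF A] A by (auto simp: transversals_def)
  next
    assume a: "a \<in> M \<and> ?g A (?\<rho> a) = Some a"
    then have some: "?g A (?\<rho> a) \<noteq> None" by (metis option.distinct(1))
    have T: "?\<rho> a \<in> ?T" using a by (intro \<rho>T) simp
    have "\<exists>b\<in>A. ?\<rho> b = ?\<rho> a"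
    proof (rule ccontr)
      assume "\<not> ?thesis"
      then have "?g A (?\<rho> a) = None" by (rule none[OF T])
      then show False using some by contradiction
    qed
    then obtain b where b: "b \<in> A" "?\<rho> b = ?\<rho> a" by blast
    then show "a \<in> A" using val[OF A b(1)] a by simp
  qed
  have "inj_on ?g (transversals n p M)"
    by (rule inj_onI, rule set_eqI) (metis (no_types, lifting) mem)
  moreover have "?g ` transversals n p M \<subseteq> PiE ?T ?F"
  proof (intro image_subsetI PiE_I)
    fix A t assume A: "A \<in> transversals n p M" and t: "t \<in> ?T"
    show "?g A t \<in> ?F t"
    proof (cases "\<exists>a\<in>A. ?\<rho> a = t")
      case True
      then obtain a where a: "a \<in> A" "?\<rho> a = t" by blast
      then show ?thesis using val[OF A a(1)] A by (auto simp: transversals_def)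
    qed (use none[OF t] in simp)
  qed auto
  moreover have "finite (PiE ?T ?F)" using M by (intro finite_PiE) auto
  ultimately have "card (transversals n p M) \<le> card (PiE ?T ?F)" by (rule card_inj_on_le)
  also have "\<dots> = (\<Prod>t\<in>?T. card (?F t))" using M by (simp add: card_PiE)
  also have "\<dots> = (\<Prod>t\<in>?T. Suc (card {u \<in> M. ?\<rho> u = t}))"
    using M by (intro prod.cong) (auto simp: card_insert_if card_image)
  finally show ?thesis .
qed

text \<open>This is \<open>C\<close> to the number of roots. As a product over \<open>M\<close> it
  can be summed vertex by vertex over a product set of maps.\<close>

definition weight :: "real \<Rightarrow> 'a set \<Rightarrow> ('a \<Rightarrow> 'a) \<Rightarrow> real" where
  "weight C M p = (\<Prod>u\<in>M. if p u = u then C else 1)"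

lemma card_transversals_weight:
  assumes M: "finite M" and p: "p \<in> parent_maps n M"
    and C: "\<And>a::nat. (1 + real a) ^ r \<le> C * (1 + \<epsilon>) ^ a" and d: "d \<le> r" and \<epsilon>: "\<epsilon> \<ge> 0"
  shows "real (card (transversals n p M)) ^ d \<le> (1 + \<epsilon>) ^ card M * weight C M p"
proof -
  let ?T = "{u \<in> M. p u = u}" and ?c = "\<lambda>t. card {u \<in> M. (p ^^ n) u = t}"
  have "{} \<in> transversals n p M" by (simp add: transversals_def)
  then have "1 \<le> real (card (transversals n p M))"
    using M by (metis One_nat_def card_gt_0_iff empty_iff finite_transversals less_eq_Suc_le real_of_nat_ge_one_iff)
  then have "real (card (transversals n p M)) ^ d \<le> real (card (transversals n p M)) ^ r"
    using d by (rule power_increasing[rotated])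
  also have "\<dots> \<le> real (\<Prod>t\<in>?T. Suc (?c t)) ^ r"
    using card_transversals_le[OF M p] by (intro power_mono) (simp_all del: of_nat_prod)
  also have "\<dots> = (\<Prod>t\<in>?T. (1 + real (?c t)) ^ r)" by (simp add: prod_power_distrib)
  also have "\<dots> \<le> (\<Prod>t\<in>?T. C * (1 + \<epsilon>) ^ ?c t)" using C by (intro prod_mono) auto
  also have "\<dots> = (\<Prod>t\<in>?T. C) * (1 + \<epsilon>) ^ (\<Sum>t\<in>?T. ?c t)" by (simp add: prod.distrib power_sum)
  also have "(\<Sum>t\<in>?T. ?c t) = card M"
  proof -
    have closed: "\<And>u. u \<in> M \<Longrightarrow> p u \<in> M" using p by (auto simp: parent_maps_def)
    have "(p ^^ n) ` M \<subseteq> ?T"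
      using p funpow_closed[of M p, OF closed] by (auto simp: parent_maps_def)
    then show ?thesis using M sum.group[of M ?T "p ^^ n" "\<lambda>_. 1::nat"] by simp
  qed
  also have "(\<Prod>t\<in>?T. C) = weight C M p" unfolding weight_def
    using M by (subst prod.If_cases) (auto simp: Int_def)
  finally show ?thesis by (simp add: mult.commute)
qed

lemma card_assembled_weight:
  assumes fin: "finite M" "finite R" "finite T" and K: "K \<subseteq> parent_maps n M \<times> (M \<rightarrow>\<^sub>E Pow S)" "finite S"
    and C: "\<And>a::nat. (1 + real a) ^ r \<le> C * (1 + \<epsilon>) ^ a" and R: "card R \<le> r" and \<epsilon>: "\<epsilon> \<ge> 0"
    and T: "card T \<le> d"
  shows "real (card (assembled n M R T K)) \<le> 2 ^ 2 ^ d * (1 + \<epsilon>) ^ card M * (\<Sum>x\<in>K. weight C M (fst x))"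
proof -
  have fK: "finite K"
    using fin K by (intro finite_subset[OF K(1)] finite_cartesian_product finite_PiE) auto
  have "real (card (assembled n M R T K)) \<le> real (2 ^ 2 ^ card T * (\<Sum>x\<in>K. card (transversals n (fst x) M) ^ card R))"
    using card_assembled_le[OF fin fK] by (simp del: of_nat_mult of_nat_power of_nat_sum)
  also have "\<dots> = 2 ^ 2 ^ card T * (\<Sum>x\<in>K. real (card (transversals n (fst x) M)) ^ card R)" by simp
  also have "\<dots> \<le> 2 ^ 2 ^ d * (\<Sum>x\<in>K. (1 + \<epsilon>) ^ card M * weight C M (fst x))"
  proof (intro mult_mono sum_mono)
    show "(2::real) ^ 2 ^ card T \<le> 2 ^ 2 ^ d" using T by (intro power_increasing) auto
    fix x assume "x \<in> K"
    then have "fst x \<in> parent_maps n M" using K by auto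
    then show "real (card (transversals n (fst x) M)) ^ card R \<le> (1 + \<epsilon>) ^ card M * weight C M (fst x)"
      by (rule card_transversals_weight[OF fin(1) _ C R \<epsilon>])
  qed (auto intro!: sum_nonneg)
  also have "\<dots> = 2 ^ 2 ^ d * (1 + \<epsilon>) ^ card M * (\<Sum>x\<in>K. weight C M (fst x))"
    by (simp add: sum_distrib_left mult.assoc)
  finally show ?thesis .
qed

text \<open>The sum factorises: a vertex contributes \<open>C\<close> for being its own parent and 1
  for every other permitted parent.\<close>

lemma sum_weight_PiE:
  assumes M: "finite M" and F: "\<And>u. u \<in> M \<Longrightarrow> finite (F u) \<and> u \<in> F u"
  shows "(\<Sum>p\<in>PiE M F. weight C M p) = (\<Prod>u\<in>M. real (card (F u)) - 1 + C)"
proof -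
  have "(\<Sum>p\<in>PiE M F. weight C M p) = (\<Prod>u\<in>M. \<Sum>y\<in>F u. if y = u then C else 1)"
    unfolding weight_def using M F by (subst prod_sum_PiE) auto
  also have "\<dots> = (\<Prod>u\<in>M. real (card (F u)) - 1 + C)"
  proof (rule prod.cong)
    fix u assume "u \<in> M"
    then have u: "finite (F u)" "u \<in> F u" using F by auto
    then have "(\<Sum>y\<in>F u. if y = u then C else 1) = C + (\<Sum>y\<in>F u - {u}. if y = u then C else 1)"
      by (simp add: sum.remove)
    also have "(\<Sum>y\<in>F u - {u}. if y = u then C else 1) = (\<Sum>y\<in>F u - {u}. 1)"
      by (rule sum.cong) auto
    finally have "(\<Sum>y\<in>F u. if y = u then C else 1) = C + real (card (F u - {u}))" by simp
    moreover have "real (card (F u)) = 1 + real (card (F u - {u}))"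
      using card_Suc_Diff1[OF u] by (metis of_nat_Suc)
    ultimately show "(\<Sum>y\<in>F u. if y = u then C else 1) = real (card (F u)) - 1 + C" by simp
  qed simp
  finally show ?thesis .
qed

subsection \<open>Weighted counts of encodings\<close>

lemma card_small_subsets_le:
  assumes "finite M"
  shows "card {Z. Z \<subseteq> M \<and> card Z \<le> d} \<le> Suc (card M) ^ d"
proof (induction d)
  case 0
  have "{Z. Z \<subseteq> M \<and> card Z \<le> 0} = {{}}" using assms by (auto simp: card_eq_0_iff dest: finite_subset)
  then show ?case by simp
next
  case (Suc d)
  let ?X = "insert None (Some ` M) \<times> {Z. Z \<subseteq> M \<and> card Z \<le> d}"
  have fin: "finite {Z. Z \<subseteq> M \<and> card Z \<le> d}" using assms by simp
  have "{Z. Z \<subseteq> M \<and> card Z \<le> Suc d} \<subseteq> (\<lambda>(y, Z). set_option y \<union> Z) ` ?X"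
  proof
    fix Z assume "Z \<in> {Z. Z \<subseteq> M \<and> card Z \<le> Suc d}"
    then have Z: "Z \<subseteq> M" "card Z \<le> Suc d" by auto
    show "Z \<in> (\<lambda>(y, Z). set_option y \<union> Z) ` ?X"
    proof (cases "Z = {}")
      case True
      then have "(None, Z) \<in> ?X" by simp
      then show ?thesis by (rule rev_image_eqI) simp
    next
      case False
      then obtain y where y: "y \<in> Z" by blast
      have "finite Z" using Z(1) assms finite_subset by blast
      then have "card (Z - {y}) \<le> d" using y Z(2) by simp
      then have "(Some y, Z - {y}) \<in> ?X" using y Z by auto
      then show ?thesis by (rule rev_image_eqI) (use y in auto)
    qed
  qed
  then have "card {Z. Z \<subseteq> M \<and> card Z \<le> Suc d} \<le> card ((\<lambda>(y, Z). set_option y \<union> Z) ` ?X)"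
    using assms fin by (intro card_mono) auto
  also have "\<dots> \<le> card ?X" using assms fin by (intro card_image_le) auto
  also have "\<dots> = Suc (card M) * card {Z. Z \<subseteq> M \<and> card Z \<le> d}"
    using assms by (simp add: card_cartesian_product card_insert_if card_image)
  also have "\<dots> \<le> Suc (card M) * Suc (card M) ^ d" using Suc by (intro mult_le_mono) auto
  finally show ?case by simp
qed

text \<open>An exponential Markov bound: each counted set has
  \<open>t ^ card Z \<ge> t powr z\<close> because \<open>t \<le> 1\<close>, and over all subsets
  these weights sum to \<open>(1 + t) ^ card M\<close>.\<close>

lemma card_subsets_exponential:
  fixes t :: real
  assumes M: "finite M" and t: "0 < t" "t \<le> 1"
  shows "real (card {Z. Z \<subseteq> M \<and> real (card Z) \<le> z}) * t powr z \<le> (1 + t) ^ card M"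
proof -
  let ?A = "{Z. Z \<subseteq> M \<and> real (card Z) \<le> z}"
  have "real (card ?A) * t powr z = (\<Sum>Z\<in>?A. t powr z)" by simp
  also have "\<dots> \<le> (\<Sum>Z\<in>?A. t ^ card Z)"
  proof (rule sum_mono)
    fix Z assume "Z \<in> ?A"
    then have "t powr z \<le> t powr real (card Z)" using t by (intro powr_mono') auto
    then show "t powr z \<le> t ^ card Z" using t by (simp add: powr_realpow)
  qed
  also have "\<dots> \<le> (\<Sum>Z\<in>Pow M. t ^ card Z)" using M t by (intro sum_mono2) auto
  also have "\<dots> = (\<Sum>Z\<in>Pow M. (\<Prod>u\<in>Z. t) * (\<Prod>u\<in>M - Z. 1))" by simp
  also have "\<dots> = (\<Prod>u\<in>M. t + 1)" by (rule prod_add[OF M, symmetric])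
  finally show ?thesis by (simp add: add.commute)
qed

lemma sum_UNION_le:
  fixes f :: "'b \<Rightarrow> real"
  assumes "finite I" "\<And>i. i \<in> I \<Longrightarrow> finite (A i)" "\<And>y. 0 \<le> f y"
  shows "(\<Sum>y\<in>(\<Union>i\<in>I. A i). f y) \<le> (\<Sum>i\<in>I. \<Sum>y\<in>A i. f y)"
proof -
  have "(\<Sum>y\<in>(\<Union>i\<in>I. A i). f y) = (\<Sum>y\<in>snd ` (SIGMA i : I. A i). f y)"
    by (rule sum.cong) force+
  also have "\<dots> \<le> (\<Sum>y\<in>(SIGMA i : I. A i). f (snd y))"
    using assms by (intro order_trans[OF sum_image_le]) auto
  also have "\<dots> = (\<Sum>i\<in>I. \<Sum>y\<in>A i. f y)"
    using assms by (subst sum.Sigma) (auto simp: case_prod_unfold)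
  finally show ?thesis .
qed

definition full :: "'a set \<Rightarrow> 'a set \<Rightarrow> ('a \<Rightarrow> 'a set) \<Rightarrow> 'a set" where
  "full M S N = {u \<in> M. N u = S}"

text \<open>The same exponential weighting with base 1/2: giving the pattern \<open>S\<close> weight
  1/2 at each vertex turns the sum over all patterns into a power of
  \<open>2 ^ card S - 1 / 2\<close>.\<close>

lemma card_few_full:
  assumes M: "finite M" and S: "finite S"
  shows "real (card {N \<in> M \<rightarrow>\<^sub>E Pow S. real (card (full M S N)) \<le> a}) * (1 / 2) powr a
    \<le> (2 ^ card S - 1 / 2) ^ card M"
proof -
  let ?A = "{N \<in> M \<rightarrow>\<^sub>E Pow S. real (card (full M S N)) \<le> a}"
  have fin: "finite (M \<rightarrow>\<^sub>E Pow S)" using M S by (intro finite_PiE) auto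
  have "real (card ?A) * (1 / 2) powr a = (\<Sum>N\<in>?A. (1 / 2) powr a)" by simp
  also have "\<dots> \<le> (\<Sum>N\<in>?A. (1 / 2) ^ card (full M S N))"
  proof (rule sum_mono)
    fix N assume "N \<in> ?A"
    then have "(1 / 2) powr a \<le> (1 / 2 :: real) powr real (card (full M S N))" by (intro powr_mono') auto
    then show "(1 / 2) powr a \<le> (1 / 2 :: real) ^ card (full M S N)" by (simp add: powr_realpow)
  qed
  also have "\<dots> \<le> (\<Sum>N\<in>M \<rightarrow>\<^sub>E Pow S. (1 / 2) ^ card (full M S N))" using fin by (intro sum_mono2) auto
  also have "\<dots> = (\<Sum>N\<in>M \<rightarrow>\<^sub>E Pow S. \<Prod>u\<in>M. if N u = S then 1 / 2 else 1)"
    unfolding full_def using M by (intro sum.cong refl) (simp add: prod.If_cases Int_def)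
  also have "\<dots> = (\<Prod>u\<in>M. \<Sum>X\<in>Pow S. if X = S then 1 / 2 else 1)"
    using M S by (subst prod_sum_PiE) auto
  also have "(\<Sum>X\<in>Pow S. if X = S then 1 / 2 else 1) = (2 ^ card S - 1 / 2 :: real)"
  proof -
    have "(\<Sum>X\<in>Pow S. if X = S then 1 / 2 else 1) = 1 / 2 + (\<Sum>X\<in>Pow S - {S}. if X = S then 1 / 2 else 1 :: real)"
      using S by (subst sum.remove[of "Pow S" S]) auto
    also have "(\<Sum>X\<in>Pow S - {S}. if X = S then 1 / 2 else 1 :: real) = (\<Sum>X\<in>Pow S - {S}. 1)"
      by (rule sum.cong) auto
    also have "\<dots> = 2 ^ card S - 1" using S by (simp add: card_Diff_subset card_Pow of_nat_diff)
    finally show ?thesis by simp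
  qed
  finally show ?thesis by simp
qed

lemma sum_weight_parent_maps_le:
  assumes M: "finite M" and x: "real (card M) + C \<le> x" and C: "1 \<le> C"
    and K: "K \<subseteq> parent_maps n M"
  shows "(\<Sum>p\<in>K. weight C M p) \<le> x ^ card M"
proof -
  have "(\<Sum>p\<in>K. weight C M p) \<le> (\<Sum>p\<in>M \<rightarrow>\<^sub>E M. weight C M p)"
    using K M C by (intro sum_mono2 finite_PiE) (auto simp: parent_maps_def weight_def intro!: prod_nonneg)
  also have "\<dots> = (\<Prod>u\<in>M. real (card M) - 1 + C)" using M by (intro sum_weight_PiE) auto
  also have "\<dots> \<le> (\<Prod>u\<in>M. x)" using x C by (intro prod_mono) auto
  finally show ?thesis by simp
qed

lemma weight_nonneg: "0 \<le> C \<Longrightarrow> 0 \<le> weight C M p"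
  by (auto simp: weight_def intro: prod_nonneg)

lemma card_patterns:
  "finite M \<Longrightarrow> finite S \<Longrightarrow> card (M \<rightarrow>\<^sub>E Pow S) = 2 ^ (card S * card M)"
  by (simp add: card_PiE card_Pow power_mult)

lemma sum_weight_all_le:
  assumes M: "finite M" and S: "finite S" and x: "real (card M) + C \<le> x" and C: "1 \<le> C"
  shows "(\<Sum>y\<in>parent_maps n M \<times> (M \<rightarrow>\<^sub>E Pow S). weight C M (fst y)) \<le> 2 ^ (card S * card M) * x ^ card M"
proof -
  have "(\<Sum>y\<in>parent_maps n M \<times> (M \<rightarrow>\<^sub>E Pow S). weight C M (fst y)) =
      (\<Sum>p\<in>parent_maps n M. \<Sum>N\<in>M \<rightarrow>\<^sub>E Pow S. weight C M p)"
    by (subst sum.cartesian_product) (auto simp: case_prod_unfold)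
  also have "\<dots> = 2 ^ (card S * card M) * (\<Sum>p\<in>parent_maps n M. weight C M p)"
    using card_patterns[OF M S] by (simp add: sum_distrib_left)
  also have "\<dots> \<le> 2 ^ (card S * card M) * x ^ card M"
    using sum_weight_parent_maps_le[OF M x C order_refl] by (intro mult_left_mono) auto
  finally show ?thesis .
qed

definition independent_map :: "('a \<Rightarrow> 'a) \<Rightarrow> 'a set \<Rightarrow> bool" where
  "independent_map p U \<longleftrightarrow> (\<forall>u\<in>U. p u \<in> U \<longrightarrow> p u = u)"

text \<open>The parent of a vertex of \<open>U\<close> is the vertex itself or lies outside
  \<open>U\<close>, so its factor drops from \<open>x\<close> to \<open>x - card U\<close>. Over all
  of \<open>U\<close> this saves a factor of order
  \<open>exp (- (card U)\<^sup>2 / x)\<close>.\<close>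

lemma sum_weight_independent_le:
  assumes M: "finite M" and x: "real (card M) + C \<le> x" and C: "1 \<le> C"
    and U: "U \<subseteq> M" and K: "K \<subseteq> {p \<in> parent_maps n M. independent_map p U}" and q: "0 \<le> q" "q \<le> real (card U)"
  shows "(\<Sum>p\<in>K. weight C M p) \<le> x ^ card M * exp (- (q\<^sup>2 / x))"
proof -
  let ?F = "\<lambda>u. if u \<in> U then insert u (M - U) else M"
  have fU: "finite U" using U M finite_subset by blast
  have cU: "card U \<le> card M" using U M by (simp add: card_mono)
  then have x0: "0 < x" "real (card U) \<le> x" using x C by linarith+
  have "K \<subseteq> PiE M ?F"
  proof
    fix p assume "p \<in> K"
    then have p: "p \<in> parent_maps n M" "independent_map p U" using K by auto
    show "p \<in> PiE M ?F"
    proof (rule PiE_I)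
      fix u assume "u \<in> M"
      then show "p u \<in> ?F u" using p by (auto simp: parent_maps_def independent_map_def)
    qed (use p in \<open>auto simp: parent_maps_def\<close>)
  qed
  then have "(\<Sum>p\<in>K. weight C M p) \<le> (\<Sum>p\<in>PiE M ?F. weight C M p)"
    using M C by (intro sum_mono2 finite_PiE) (auto intro: weight_nonneg)
  also have "\<dots> = (\<Prod>u\<in>M. real (card (?F u)) - 1 + C)" using M U by (intro sum_weight_PiE) auto
  also have "\<dots> \<le> (\<Prod>u\<in>M. if u \<in> U then x - card U else x)"
  proof (intro prod_mono conjI)
    fix u assume u: "u \<in> M"
    have c: "card (?F u) = (if u \<in> U then Suc (card M - card U) else card M)"
      using M U fU by (simp add: card_Diff_subset)
    have "0 < card M" using u M by (auto simp: card_gt_0_iff)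
    then show "0 \<le> real (card (?F u)) - 1 + C" using C c by auto
    show "real (card (?F u)) - 1 + C \<le> (if u \<in> U then x - card U else x)"
      using x cU unfolding c by (auto simp: of_nat_diff)
  qed
  also have "\<dots> = (x - card U) ^ card U * x ^ (card M - card U)"
    using M U fU by (simp add: prod.If_cases Int_absorb1 Diff_eq[symmetric] card_Diff_subset)
  also have "\<dots> \<le> (x * exp (- (card U / x))) ^ card U * x ^ (card M - card U)"
  proof (intro mult_right_mono power_mono)
    have "1 - card U / x \<le> exp (- (card U / x))" using exp_ge_add_one_self[of "- (card U / x)"] by simp
    then have "x * (1 - card U / x) \<le> x * exp (- (card U / x))" using x0 by (intro mult_left_mono) auto
    then show "x - card U \<le> x * exp (- (card U / x))" using x0 by (simp add: right_diff_distrib)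
  qed (use x0 in auto)
  also have "\<dots> = x ^ card M * exp (- (card U / x)) ^ card U"
    using cU by (simp add: power_mult_distrib flip: power_add)
  also have "exp (- (card U / x)) ^ card U = exp (- ((card U)\<^sup>2 / x))"
    by (simp add: power2_eq_square flip: exp_of_nat_mult)
  also have "x ^ card M * exp (- ((card U)\<^sup>2 / x)) \<le> x ^ card M * exp (- (q\<^sup>2 / x))"
    using x0 q by (intro mult_left_mono) (auto intro!: divide_right_mono power_mono)
  finally show ?thesis .
qed

text \<open>After at most \<open>z\<close> deletions no forest edge joins two vertices adjacent to
  all hubs. This situation arises when a maximal matching among these vertices is small.\<close>

definition nearly_independent ::
  "nat \<Rightarrow> 'a set \<Rightarrow> 'a set \<Rightarrow> real \<Rightarrow> (('a \<Rightarrow> 'a) \<times> ('a \<Rightarrow> 'a set)) set" where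
  "nearly_independent n M S z = {(p, N). p \<in> parent_maps n M \<and> N \<in> M \<rightarrow>\<^sub>E Pow S \<and>
     (\<exists>Z\<subseteq>M. real (card Z) \<le> z \<and> independent_map p (full M S N - Z))}"

text \<open>The first summand covers patterns with at most \<open>a\<close> vertices joined to all
  hubs. For the others, a union bound over the deleted sets \<open>Z\<close> leaves an independent
  set of at least \<open>a - z\<close> vertices.\<close>

lemma sum_weight_nearly_independent_le:
  assumes M: "finite M" and S: "finite S" and x: "real (card M) + C \<le> x" and C: "1 \<le> C"
    and t: "0 < t" "t \<le> 1" and za: "0 \<le> z" "z \<le> a"
  shows "(\<Sum>y\<in>nearly_independent n M S z. weight C M (fst y)) \<le> x ^ card M *
    (2 powr a * (2 ^ card S - 1 / 2) ^ card M +
     2 ^ (card S * card M) * ((1 + t) ^ card M / t powr z) * exp (- ((a - z)\<^sup>2 / x)))"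
proof -
  define P where "P = (\<lambda>N. {p \<in> parent_maps n M. \<exists>Z\<subseteq>M. real (card Z) \<le> z \<and> independent_map p (full M S N - Z)})"
  define Few where "Few = {N \<in> M \<rightarrow>\<^sub>E Pow S. real (card (full M S N)) \<le> a}"
  define \<Z> where "\<Z> = {Z. Z \<subseteq> M \<and> real (card Z) \<le> z}"
  have finN: "finite (M \<rightarrow>\<^sub>E Pow S)" using M S by (intro finite_PiE) auto
  have finP: "finite (P N)" for N using M by (simp add: P_def)
  have fin\<Z>: "finite \<Z>" using M by (simp add: \<Z>_def)
  have x0: "0 < x" using x C by linarith
  have "nearly_independent n M S z = (\<lambda>(N, p). (p, N)) ` (SIGMA N : M \<rightarrow>\<^sub>E Pow S. P N)"
    by (auto simp: nearly_independent_def P_def image_iff; blast)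
  moreover have "inj_on (\<lambda>(N, p). (p, N)) (SIGMA N : M \<rightarrow>\<^sub>E Pow S. P N)" by (auto simp: inj_on_def)
  ultimately have "(\<Sum>y\<in>nearly_independent n M S z. weight C M (fst y)) =
      (\<Sum>(N, p)\<in>(SIGMA N : M \<rightarrow>\<^sub>E Pow S. P N). weight C M p)"
    by (simp add: sum.reindex case_prod_unfold)
  also have "\<dots> = (\<Sum>N\<in>M \<rightarrow>\<^sub>E Pow S. \<Sum>p\<in>P N. weight C M p)"
    using finN finP by (subst sum.Sigma) auto
  also have "\<dots> \<le> (\<Sum>N\<in>M \<rightarrow>\<^sub>E Pow S. (if N \<in> Few then x ^ card M else 0) +
      real (card \<Z>) * (x ^ card M * exp (- ((a - z)\<^sup>2 / x))))"
  proof (rule sum_mono)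
    fix N assume N: "N \<in> M \<rightarrow>\<^sub>E Pow S"
    show "(\<Sum>p\<in>P N. weight C M p) \<le> (if N \<in> Few then x ^ card M else 0) +
      real (card \<Z>) * (x ^ card M * exp (- ((a - z)\<^sup>2 / x)))"
    proof (cases "N \<in> Few")
      case True
      have "(\<Sum>p\<in>P N. weight C M p) \<le> x ^ card M"
        by (rule sum_weight_parent_maps_le[OF M x C]) (auto simp: P_def)
      moreover have "0 \<le> real (card \<Z>) * (x ^ card M * exp (- ((a - z)\<^sup>2 / x)))" using x0 by simp
      ultimately show ?thesis using True by simp
    next
      case False
      then have big: "a \<le> real (card (full M S N))" using N by (auto simp: Few_def)
      let ?Q = "\<lambda>Z. {p \<in> parent_maps n M. independent_map p (full M S N - Z)}"
      have "P N = (\<Union>Z\<in>\<Z>. ?Q Z)" by (auto simp: P_def \<Z>_def)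
      then have "(\<Sum>p\<in>P N. weight C M p) \<le> (\<Sum>Z\<in>\<Z>. \<Sum>p\<in>?Q Z. weight C M p)"
        using fin\<Z> M C by (simp only:) (intro sum_UNION_le, auto intro: weight_nonneg)
      also have "\<dots> \<le> (\<Sum>Z\<in>\<Z>. x ^ card M * exp (- ((a - z)\<^sup>2 / x)))"
      proof (rule sum_mono)
        fix Z assume Z: "Z \<in> \<Z>"
        then have fZ: "finite Z" using M finite_subset by (auto simp: \<Z>_def)
        have "card (full M S N) - card Z \<le> card (full M S N - Z)" by (rule diff_card_le_card_Diff[OF fZ])
        then have "a - z \<le> real (card (full M S N - Z))" using big Z by (auto simp: \<Z>_def)
        then show "(\<Sum>p\<in>?Q Z. weight C M p) \<le> x ^ card M * exp (- ((a - z)\<^sup>2 / x))"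
          using za by (intro sum_weight_independent_le[OF M x C _ order_refl]) (auto simp: full_def)
      qed
      finally show ?thesis using False by simp
    qed
  qed
  also have "\<dots> = real (card Few) * x ^ card M +
      2 ^ (card S * card M) * (real (card \<Z>) * (x ^ card M * exp (- ((a - z)\<^sup>2 / x))))"
  proof -
    have "(M \<rightarrow>\<^sub>E Pow S) \<inter> Few = Few" by (auto simp: Few_def)
    then show ?thesis using finN card_patterns[OF M S] by (simp add: sum.distrib sum.If_cases Few_def Int_def)
  qed
  also have "\<dots> \<le> (2 powr a * (2 ^ card S - 1 / 2) ^ card M) * x ^ card M +
      2 ^ (card S * card M) * (((1 + t) ^ card M / t powr z) * (x ^ card M * exp (- ((a - z)\<^sup>2 / x))))"
  proof (intro add_mono mult_mono order_refl)
    have "real (card Few) * (1 / 2) powr a \<le> (2 ^ card S - 1 / 2) ^ card M"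
      unfolding Few_def by (rule card_few_full[OF M S])
    moreover have "(1 / 2 :: real) powr a = 1 / 2 powr a" by (simp add: powr_divide)
    ultimately show "real (card Few) \<le> 2 powr a * (2 ^ card S - 1 / 2) ^ card M"
      by (simp add: divide_le_eq mult.commute)
    have "real (card \<Z>) * t powr z \<le> (1 + t) ^ card M" unfolding \<Z>_def by (rule card_subsets_exponential[OF M t])
    then show "real (card \<Z>) \<le> (1 + t) ^ card M / t powr z" using t by (simp add: field_simps)
    have "1 \<le> (2::real) ^ card S" by simp
    then have "0 \<le> (2::real) ^ card S - 1 / 2" by linarith
    then show "0 \<le> 2 powr a * (2 ^ card S - 1 / 2) ^ card M" by (intro mult_nonneg_nonneg zero_le_power) simp_all
  qed (use x0 t in auto)
  finally show ?thesis by (simp add: algebra_simps)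
qed

text \<open>The left side is a falling factorial, and each factor satisfies
  \<open>m - i \<le> x * exp (- i / x)\<close>.\<close>

lemma binomial_fact_exp_le:
  assumes "real m \<le> x" "0 < x" "l \<le> m"
  shows "real (m choose l) * fact l \<le> x ^ l * exp (- (real (l * (l - 1)) / (2 * x)))"
proof -
  have "real (m choose l) * fact l = (\<Prod>i<l. real m - real i)"
    by (simp add: binomial_gbinomial gbinomial_prod_rev atLeast0LessThan)
  also have "\<dots> \<le> (\<Prod>i<l. x * exp (- (real i / x)))"
  proof (intro prod_mono conjI)
    fix i assume i: "i \<in> {..<l}"
    show "0 \<le> real m - real i" using i assms by auto
    have "1 - real i / x \<le> exp (- (real i / x))" using exp_ge_add_one_self[of "- (real i / x)"] by simp
    then have "x * (1 - real i / x) \<le> x * exp (- (real i / x))" using assms by (intro mult_left_mono) auto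
    then show "real m - real i \<le> x * exp (- (real i / x))" using assms by (simp add: right_diff_distrib)
  qed
  also have "\<dots> = x ^ l * exp (\<Sum>i<l. - (real i / x))" by (simp add: prod.distrib exp_sum)
  also have "(\<Sum>i<l. - (real i / x)) = - ((\<Sum>i<l. real i) / x)" by (simp add: sum_negf sum_divide_distrib)
  also have "(\<Sum>i<l. real i) = real (l * (l - 1)) / 2"
  proof (induction l)
    case (Suc l)
    then show ?case by (cases l) (simp_all add: field_simps)
  qed simp
  finally show ?thesis by simp
qed

text \<open>Such a \<open>Y\<close> is a union of at most \<open>d\<close> upward paths of the
  forest, with at least \<open>l\<close> vertices in total: on \<open>Y'\<close> the parent map is
  injective, moves every vertex and stays inside \<open>Y\<close>.\<close>

definition long_paths ::
  "nat \<Rightarrow> 'a set \<Rightarrow> 'a set \<Rightarrow> nat \<Rightarrow> nat \<Rightarrow> (('a \<Rightarrow> 'a) \<times> ('a \<Rightarrow> 'a set)) set" where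
  "long_paths n M S l d = {(p, N). p \<in> parent_maps n M \<and> N \<in> M \<rightarrow>\<^sub>E Pow S \<and>
     (\<exists>Y\<subseteq>M. \<exists>Y'\<subseteq>Y. l \<le> card Y \<and> card (Y - Y') \<le> d \<and> inj_on p Y' \<and> p ` Y' \<subseteq> Y \<and> (\<forall>u\<in>Y'. p u \<noteq> u))}"

text \<open>On \<open>Y'\<close> the map is an injection into \<open>Y\<close>, which leaves at most
  \<open>fact (card Y)\<close> choices, and it has no roots there; elsewhere it is
  arbitrary.\<close>

lemma sum_weight_injective_le:
  assumes M: "finite M" and x: "real (card M) + C \<le> x" and C: "1 \<le> C" and Y: "Y' \<subseteq> Y" "Y \<subseteq> M"
    and K: "K \<subseteq> {p \<in> parent_maps n M. inj_on p Y' \<and> p ` Y' \<subseteq> Y \<and> (\<forall>u\<in>Y'. p u \<noteq> u)}"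
  shows "(\<Sum>p\<in>K. weight C M p) \<le> fact (card Y) * x ^ (card M - card Y')"
proof -
  have fY: "finite Y" by (rule finite_subset[OF Y(2) M])
  then have fY': "finite Y'" by (rule finite_subset[OF Y(1)])
  note fY = fY fY'
  have x0: "0 < x" using x C by linarith
  let ?I = "{f \<in> Y' \<rightarrow>\<^sub>E Y. inj_on f Y'}"
  let ?h = "\<lambda>p. (restrict p Y', restrict p (M - Y'))"
  have inj: "inj_on ?h K"
  proof (rule inj_onI)
    fix p q assume pq: "p \<in> K" "q \<in> K" "?h p = ?h q"
    then have M: "p \<in> M \<rightarrow>\<^sub>E M" "q \<in> M \<rightarrow>\<^sub>E M" using K by (auto simp: parent_maps_def)
    have eq: "restrict p Y' = restrict q Y'" "restrict p (M - Y') = restrict q (M - Y')"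
      using pq(3) by simp_all
    show "p = q"
    proof (rule PiE_ext[OF M])
      fix u assume u: "u \<in> M"
      show "p u = q u"
      proof (cases "u \<in> Y'")
        case True
        then show ?thesis using fun_cong[OF eq(1), of u] by simp
      next
        case False
        then show ?thesis using fun_cong[OF eq(2), of u] u by simp
      qed
    qed
  qed
  have sub: "?h ` K \<subseteq> ?I \<times> (M - Y' \<rightarrow>\<^sub>E M)"
  proof (rule image_subsetI)
    fix p assume "p \<in> K"
    then have p: "p \<in> M \<rightarrow>\<^sub>E M" "inj_on p Y'" "p ` Y' \<subseteq> Y" using K by (auto simp: parent_maps_def)
    then show "?h p \<in> ?I \<times> (M - Y' \<rightarrow>\<^sub>E M)" by (auto simp: inj_on_def)
  qed
  have finI: "finite (?I \<times> (M - Y' \<rightarrow>\<^sub>E M))"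
    using fY M by (intro finite_cartesian_product finite_subset[of ?I "Y' \<rightarrow>\<^sub>E Y"] finite_PiE) auto
  have "(\<Sum>p\<in>K. weight C M p) = (\<Sum>p\<in>K. weight C (M - Y') (snd (?h p)))"
  proof (rule sum.cong)
    fix p assume "p \<in> K"
    then have ne: "\<forall>u\<in>Y'. p u \<noteq> u" using K by auto
    have "weight C M p = (\<Prod>u\<in>M - Y'. if p u = u then C else 1) * (\<Prod>u\<in>Y'. if p u = u then C else 1)"
      unfolding weight_def using M Y by (intro prod.subset_diff) auto
    also have "(\<Prod>u\<in>Y'. if p u = u then C else 1) = 1" using ne by (intro prod.neutral) auto
    finally show "weight C M p = weight C (M - Y') (snd (?h p))" by (simp add: weight_def)
  qed simp
  also have "\<dots> = (\<Sum>y\<in>?h ` K. weight C (M - Y') (snd y))" by (simp add: sum.reindex[OF inj])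
  also have "\<dots> \<le> (\<Sum>y\<in>?I \<times> (M - Y' \<rightarrow>\<^sub>E M). weight C (M - Y') (snd y))"
    using finI sub C by (intro sum_mono2) (auto intro: weight_nonneg)
  also have "\<dots> = (\<Sum>f\<in>?I. \<Sum>p\<in>M - Y' \<rightarrow>\<^sub>E M. weight C (M - Y') p)"
    by (subst sum.cartesian_product) (auto simp: case_prod_unfold)
  also have "\<dots> = real (card ?I) * (\<Sum>p\<in>M - Y' \<rightarrow>\<^sub>E M. weight C (M - Y') p)" by simp
  also have "(\<Sum>p\<in>M - Y' \<rightarrow>\<^sub>E M. weight C (M - Y') p) = (\<Prod>u\<in>M - Y'. real (card M) - 1 + C)"
    using M by (intro sum_weight_PiE) auto
  also have "real (card ?I) * (\<Prod>u\<in>M - Y'. real (card M) - 1 + C) \<le> fact (card Y) * (\<Prod>u\<in>M - Y'. x)"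
  proof (intro mult_mono prod_mono conjI)
    have "card ?I = (\<Prod>i = 0..<card Y'. card Y - i)"
      using card_inj_on_subset_funcset[OF fY(2,1) order_refl] by simp
    also have "\<dots> \<le> fact (card Y)"
    proof -
      have "card Y' \<le> card Y" using Y fY by (simp add: card_mono)
      have "(\<Prod>i = 0..<j. y - i) \<le> fact y" if "j \<le> y" for j y :: nat
      proof -
        have "(\<Prod>i = 0..<j. y - i) \<le> (\<Prod>i = 0..<j. y - i) * fact (y - j)" by simp
        also have "(\<Prod>i = 0..<j. y - i) * fact (y - j) = fact y" using that
        proof (induction j)
          case (Suc j)
          have "fact (y - j) = (y - j) * fact (y - Suc j)" using Suc.prems by (simp add: fact_reduce)
          then show ?case using Suc by (simp add: mult.assoc)
        qed simp
        finally show ?thesis .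
      qed
      then show ?thesis using \<open>card Y' \<le> card Y\<close> by blast
    qed
    finally show "real (card ?I) \<le> fact (card Y)" by (metis of_nat_fact of_nat_le_iff)
  qed (use x C in \<open>auto intro!: prod_nonneg\<close>)
  also have "(\<Prod>u\<in>M - Y'. x) = x ^ (card M - card Y')"
    using Y fY by (simp add: card_Diff_subset)
  finally show ?thesis .
qed

text \<open>Choosing \<open>Y\<close> of size \<open>i\<close> and an injective part gives
  \<open>(card M choose i) * fact i\<close>, where arbitrary maps would give about
  \<open>x ^ i\<close>; the falling factorial bound supplies the gain. In the exponent
  \<open>Suc (d + d)\<close>, one \<open>d\<close> pays for choosing \<open>Y - Y'\<close>, one for
  the unrestricted parents on it, and 1 for the sum over the sizes.\<close>

lemma sum_weight_long_paths_le:
  assumes M: "finite M" and S: "finite S" and x: "real (card M) + C \<le> x" and C: "1 \<le> C"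
  shows "(\<Sum>y\<in>long_paths n M S l d. weight C M (fst y)) \<le> 2 ^ (card S * card M) *
    (x ^ (Suc (d + d)) * x ^ card M * exp (- (real (l * (l - 1)) / (2 * x))))"
proof -
  have x1: "real (Suc (card M)) \<le> x" "1 \<le> x" "real (card M) \<le> x" "0 < x" using x C by linarith+
  let ?Q = "\<lambda>Y Y'. {p \<in> parent_maps n M. inj_on p Y' \<and> p ` Y' \<subseteq> Y \<and> (\<forall>u\<in>Y'. p u \<noteq> u)}"
  define \<Y> where "\<Y> = {Y. Y \<subseteq> M \<and> l \<le> card Y}"
  define X where "X = (\<lambda>Y :: 'a set. {Y'. Y' \<subseteq> Y \<and> card (Y - Y') \<le> d})"
  define P where "P = (\<Union>Y\<in>\<Y>. \<Union>Y'\<in>X Y. ?Q Y Y')"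
  have f\<Y>: "finite \<Y>" using M by (simp add: \<Y>_def)
  have fY: "finite Y" if "Y \<in> \<Y>" for Y using that M finite_subset by (auto simp: \<Y>_def)
  have "finite (X Y)" if "Y \<in> \<Y>" for Y using fY[OF that] by (simp add: X_def)
  moreover have "finite P" using M by (intro finite_subset[of P "parent_maps n M"]) (auto simp: P_def)
  ultimately have fin: "finite \<Y>" "\<And>Y. Y \<in> \<Y> \<Longrightarrow> finite (X Y)" "finite P" "\<And>Y. Y \<in> \<Y> \<Longrightarrow> finite Y"
    using f\<Y> fY by auto
  have cX: "card (X Y) \<le> Suc (card M) ^ d" if Y: "Y \<in> \<Y>" for Y
  proof -
    have "X Y \<subseteq> (\<lambda>Z. Y - Z) ` {Z. Z \<subseteq> Y \<and> card Z \<le> d}"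
    proof
      fix Y' assume "Y' \<in> X Y"
      then have "Y' = Y - (Y - Y')" "Y - Y' \<in> {Z. Z \<subseteq> Y \<and> card Z \<le> d}" by (auto simp: X_def)
      then show "Y' \<in> (\<lambda>Z. Y - Z) ` {Z. Z \<subseteq> Y \<and> card Z \<le> d}" by (rule image_eqI)
    qed
    then have "card (X Y) \<le> card {Z. Z \<subseteq> Y \<and> card Z \<le> d}"
      using fin(4)[OF Y] by (intro surj_card_le) auto
    also have "\<dots> \<le> Suc (card Y) ^ d" by (rule card_small_subsets_le[OF fin(4)[OF Y]])
    also have "\<dots> \<le> Suc (card M) ^ d" using Y M by (intro power_mono) (auto simp: \<Y>_def card_mono)
    finally show ?thesis .
  qed
  have "long_paths n M S l d = P \<times> (M \<rightarrow>\<^sub>E Pow S)"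
    by (auto simp: long_paths_def P_def \<Y>_def X_def)
  then have "(\<Sum>y\<in>long_paths n M S l d. weight C M (fst y)) = (\<Sum>p\<in>P. \<Sum>N\<in>M \<rightarrow>\<^sub>E Pow S. weight C M p)"
    by (subst sum.cartesian_product) (auto simp: case_prod_unfold)
  also have "\<dots> = 2 ^ (card S * card M) * (\<Sum>p\<in>P. weight C M p)"
    using card_patterns[OF M S] by (simp add: sum_distrib_left)
  also have "(\<Sum>p\<in>P. weight C M p) \<le> (\<Sum>Y\<in>\<Y>. \<Sum>p\<in>(\<Union>Y'\<in>X Y. ?Q Y Y'). weight C M p)"
    unfolding P_def using fin M C by (intro sum_UNION_le) (auto intro: weight_nonneg)
  also have "\<dots> \<le> (\<Sum>Y\<in>\<Y>. \<Sum>Y'\<in>X Y. \<Sum>p\<in>?Q Y Y'. weight C M p)"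
    using fin M C by (intro sum_mono sum_UNION_le) (auto intro: weight_nonneg)
  also have "\<dots> \<le> (\<Sum>Y\<in>\<Y>. \<Sum>Y'\<in>X Y. fact (card Y) * x ^ (card M - card Y + d))"
  proof (intro sum_mono)
    fix Y Y' assume Y: "Y \<in> \<Y>" "Y' \<in> X Y"
    then have "Y' \<subseteq> Y" "Y \<subseteq> M" by (auto simp: X_def \<Y>_def)
    then have "(\<Sum>p\<in>?Q Y Y'. weight C M p) \<le> fact (card Y) * x ^ (card M - card Y')"
      by (rule sum_weight_injective_le[OF M x C _ _ order_refl])
    also have "\<dots> \<le> fact (card Y) * x ^ (card M - card Y + d)"
    proof (intro mult_left_mono power_increasing)
      have "card (Y - Y') = card Y - card Y'"
        using \<open>Y' \<subseteq> Y\<close> fin(4)[OF Y(1)] by (simp add: card_Diff_subset finite_subset)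
      then show "card M - card Y' \<le> card M - card Y + d" using Y by (auto simp: X_def)
    qed (use x1 in auto)
    finally show "(\<Sum>p\<in>?Q Y Y'. weight C M p) \<le> fact (card Y) * x ^ (card M - card Y + d)" .
  qed
  also have "\<dots> \<le> (\<Sum>Y\<in>\<Y>. x ^ d * (fact (card Y) * x ^ (card M - card Y + d)))"
  proof (intro sum_mono)
    fix Y assume Y: "Y \<in> \<Y>"
    have "real (card (X Y)) \<le> real (Suc (card M) ^ d)" using cX[OF Y] by (rule of_nat_mono)
    also have "\<dots> \<le> x ^ d" using x1 by (simp only: of_nat_power) (intro power_mono, auto)
    finally show "(\<Sum>Y'\<in>X Y. fact (card Y) * x ^ (card M - card Y + d)) \<le> x ^ d * (fact (card Y) * x ^ (card M - card Y + d))"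
      using x1 by (simp add: mult_right_mono)
  qed
  also have "\<dots> = (\<Sum>i\<in>{l..card M}. \<Sum>Y\<in>{Y \<in> \<Y>. card Y = i}. x ^ d * (fact (card Y) * x ^ (card M - card Y + d)))"
  proof (rule sum.group[symmetric])
    show "card ` \<Y> \<subseteq> {l..card M}" using M by (auto simp: \<Y>_def intro: card_mono)
  qed (use f\<Y> in auto)
  also have "\<dots> \<le> (\<Sum>i\<in>{l..card M}. x ^ (d + d) * x ^ card M * exp (- (real (l * (l - 1)) / (2 * x))))"
  proof (rule sum_mono)
    fix i assume i: "i \<in> {l..card M}"
    then have "{Y \<in> \<Y>. card Y = i} = {Y. Y \<subseteq> M \<and> card Y = i}" by (auto simp: \<Y>_def)
    then have "(\<Sum>Y\<in>{Y \<in> \<Y>. card Y = i}. x ^ d * (fact (card Y) * x ^ (card M - card Y + d))) =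
        (\<Sum>Y\<in>{Y. Y \<subseteq> M \<and> card Y = i}. x ^ d * (fact i * x ^ (card M - i + d)))"
      by (intro sum.cong) auto
    also have "\<dots> = x ^ d * x ^ d * x ^ (card M - i) * (real (card M choose i) * fact i)"
      using n_subsets[OF M] by (simp add: power_add mult_ac)
    also have "\<dots> \<le> x ^ d * x ^ d * x ^ (card M - i) * (x ^ i * exp (- (real (i * (i - 1)) / (2 * x))))"
      using x1 i by (intro mult_left_mono binomial_fact_exp_le) auto
    also have "\<dots> = x ^ (d + d) * x ^ card M * exp (- (real (i * (i - 1)) / (2 * x)))"
      using i by (simp add: mult_ac add_ac flip: power_add)
    also have "\<dots> \<le> x ^ (d + d) * x ^ card M * exp (- (real (l * (l - 1)) / (2 * x)))"
    proof (intro mult_left_mono)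
      have "l * (l - 1) \<le> i * (i - 1)" using i by (intro mult_le_mono) auto
      then have "real (l * (l - 1)) / (2 * x) \<le> real (i * (i - 1)) / (2 * x)"
        using x1 by (intro divide_right_mono of_nat_mono) auto
      then show "exp (- (real (i * (i - 1)) / (2 * x))) \<le> exp (- (real (l * (l - 1)) / (2 * x)))" by simp
    qed (use x1 in auto)
    finally show "(\<Sum>Y\<in>{Y \<in> \<Y>. card Y = i}. x ^ d * (fact (card Y) * x ^ (card M - card Y + d))) \<le>
      x ^ (d + d) * x ^ card M * exp (- (real (l * (l - 1)) / (2 * x)))" .
  qed
  also have "\<dots> = real (card {l..card M}) * (x ^ (d + d) * x ^ card M * exp (- (real (l * (l - 1)) / (2 * x))))" by simp
  also have "\<dots> \<le> x * (x ^ (d + d) * x ^ card M * exp (- (real (l * (l - 1)) / (2 * x))))"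
    using x1 by (intro mult_right_mono) auto
  finally show ?thesis by (simp add: mult_ac)
qed

subsection \<open>Graphs without a good blocker\<close>

text \<open>The condition does not depend on the edges inside \<open>B\<close>, and it determines \<open>B\<close>.\<close>

definition good_blocker :: "nat \<Rightarrow> 'a set set \<Rightarrow> 'a set \<Rightarrow> 'a set \<Rightarrow> bool" where
  "good_blocker k E V B \<longleftrightarrow> B \<subseteq> V \<and> card B = k \<and> forest E (V - B) \<and>
    (\<exists>\<M>\<subseteq>edges_in E (V - B). card \<M> = Suc k \<and> disjoint \<M> \<and> (\<forall>e\<in>\<M>. \<forall>u\<in>e. \<forall>b\<in>B. {b, u} \<in> E))"

lemma full_edge_cyclic:
  assumes E: "two_sets E" and e: "e \<in> E" and b: "\<And>u. u \<in> e \<Longrightarrow> {b, u} \<in> E"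
  shows "cyclic E (insert b e)"
proof -
  obtain u w where uw: "e = {u, w}" using E e by (metis two_setsE)
  have "cyclic E {b, u, w}" by (rule triangle_cyclic[OF E]) (use uw e b in auto)
  then show ?thesis by (simp add: uw)
qed

lemma card_edges_in_remove_le:
  assumes W: "finite W" and X: "X \<subseteq> W"
  shows "card (edges_in E W) \<le> card (edges_in E (W - X)) + (\<Sum>x\<in>X. deg E W x)"
proof -
  have fX: "finite X" using X W finite_subset by blast
  have "edges_in E W \<subseteq> edges_in E (W - X) \<union> (\<Union>x\<in>X. {e \<in> edges_in E W. x \<in> e})"
    by (auto simp: edges_in_def)
  then have "card (edges_in E W) \<le> card (edges_in E (W - X) \<union> (\<Union>x\<in>X. {e \<in> edges_in E W. x \<in> e}))"
    using W fX by (intro card_mono) auto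
  also have "\<dots> \<le> card (edges_in E (W - X)) + card (\<Union>x\<in>X. {e \<in> edges_in E W. x \<in> e})"
    by (rule card_Un_le)
  also have "card (\<Union>x\<in>X. {e \<in> edges_in E W. x \<in> e}) \<le> (\<Sum>x\<in>X. deg E W x)"
    unfolding deg_def by (rule card_UN_le[OF fX])
  finally show ?thesis by simp
qed

text \<open>A minimal cyclic set meets the forest in few paths. On such a path the parent map is
  injective below the turning points.\<close>

lemma cycle_in_forest_injective:
  assumes E: "two_sets E" and W: "cyclic E W" "\<And>y. y \<in> W \<Longrightarrow> \<not> cyclic E (W - {y})"
    and WM: "W \<subseteq> M \<union> R" "M \<inter> R = {}" and R: "finite R" "card R \<le> r"
    and p: "ranked M p h" "edges_in E M = parent_edges M p"
  obtains Y' where "Y' \<subseteq> W \<inter> M" "card (W \<inter> M - Y') \<le> 3 * r" "inj_on p Y'" "p ` Y' \<subseteq> W \<inter> M" "\<And>u. u \<in> Y' \<Longrightarrow> p u \<noteq> u"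
proof -
  have fW: "finite W" using W(1) by (simp add: cyclic_def)
  have eW: "card (edges_in E W) = card W" and dW: "\<And>x. x \<in> W \<Longrightarrow> deg E W x = 2"
    using minimal_cyclic[OF E W(1)] W(2) by auto
  define Y where "Y = W \<inter> M"
  define Y1 where "Y1 = {u \<in> Y. p u \<in> Y \<and> p u \<noteq> u}"
  \<comment> \<open>Vertices whose parent is a turning point are excluded. If two vertices of
    \<open>Y2\<close> had the same parent, that parent would have a third neighbour in
    \<open>W\<close>, namely its own parent, contradicting degree two.\<close>
  define Y2 where "Y2 = {u \<in> Y1. p u \<in> Y1}"
  have fY: "finite Y" using fW by (simp add: Y_def)
  have \<rho>: "card (W \<inter> R) \<le> r" using R card_mono[of R "W \<inter> R"] by simp
  have WY: "W - W \<inter> R = Y" using WM by (auto simp: Y_def)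
  have "card W = card Y + card (W \<inter> R)"
    using fW WY by (metis Int_lower1 card_Diff_subset card_mono finite_Int le_add_diff_inverse2)
  moreover have "card W \<le> card (edges_in E Y) + 2 * card (W \<inter> R)"
    using card_edges_in_remove_le[OF fW, of "W \<inter> R" E] dW unfolding WY eW by simp
  ultimately have 1: "card Y \<le> card (edges_in E Y) + card (W \<inter> R)" by simp
  have nbr: "{u, p u} \<in> E" if "u \<in> M" "p u \<noteq> u" for u
  proof -
    have "{u, p u} \<in> edges_in E M" unfolding p(2) parent_edges_def using that by blast
    then show ?thesis by (simp add: edges_in_def)
  qed
  have "edges_in E Y \<subseteq> (\<lambda>u. {u, p u}) ` Y1"
  proof
    fix e assume e: "e \<in> edges_in E Y"
    then have "e \<in> edges_in E M" by (auto simp: edges_in_def Y_def)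
    then obtain u where u: "u \<in> M" "p u \<noteq> u" "e = {u, p u}" unfolding p(2) parent_edges_def by auto
    then have "u \<in> Y1" using e by (auto simp: edges_in_def Y1_def)
    then show "e \<in> (\<lambda>u. {u, p u}) ` Y1" using u(3) by blast
  qed
  then have "card (edges_in E Y) \<le> card Y1" using fY by (intro surj_card_le) (auto simp: Y1_def)
  moreover have "card (Y - Y1) = card Y - card Y1" using fY by (intro card_Diff_subset) (auto simp: Y1_def)
  ultimately have 2: "card (Y - Y1) \<le> card (W \<inter> R)" using 1 by linarith
  \<comment> \<open>The vertices lost here have their parent in \<open>Y - Y1\<close>, and each such
    parent has at most two neighbours in \<open>W\<close>. With \<open>Y - Y1\<close> itself this
    makes the bound \<open>3 * r\<close>.\<close>
  have "Y1 - Y2 \<subseteq> (\<Union>y\<in>Y - Y1. {u \<in> Y1. p u = y})" by (auto simp: Y1_def Y2_def)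
  then have "card (Y1 - Y2) \<le> card (\<Union>y\<in>Y - Y1. {u \<in> Y1. p u = y})"
    using fY by (intro card_mono) (auto simp: Y1_def)
  also have "\<dots> \<le> (\<Sum>y\<in>Y - Y1. card {u \<in> Y1. p u = y})" using fY by (intro card_UN_le) auto
  also have "\<dots> \<le> (\<Sum>y\<in>Y - Y1. 2)"
  proof (rule sum_mono)
    fix y assume "y \<in> Y - Y1"
    then have y: "y \<in> W" by (auto simp: Y_def)
    have "{u \<in> Y1. p u = y} \<subseteq> {u \<in> W. {y, u} \<in> E}"
      using nbr by (auto simp: Y1_def Y_def insert_commute)
    then have "card {u \<in> Y1. p u = y} \<le> card {u \<in> W. {y, u} \<in> E}" using fW by (intro card_mono) auto
    then show "card {u \<in> Y1. p u = y} \<le> 2" using dW[OF y] deg_eq[OF E y] by simp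
  qed
  finally have 3: "card (Y1 - Y2) \<le> 2 * card (W \<inter> R)" using 2 by simp
  have "Y - Y2 \<subseteq> (Y - Y1) \<union> (Y1 - Y2)" by auto
  then have "card (Y - Y2) \<le> card ((Y - Y1) \<union> (Y1 - Y2))" using fY by (intro card_mono) (auto simp: Y1_def)
  also have "\<dots> \<le> card (Y - Y1) + card (Y1 - Y2)" by (rule card_Un_le)
  finally have c: "card (Y - Y2) \<le> 3 * r" using 2 3 \<rho> by linarith
  have inj: "inj_on p Y2"
  proof (rule inj_onI, rule ccontr)
    fix u w assume u: "u \<in> Y2" and w: "w \<in> Y2" and eq: "p u = p w" and ne: "u \<noteq> w"
    let ?y = "p u"
    have y: "?y \<in> Y1" "?y \<in> W" "?y \<in> M" using u by (auto simp: Y2_def Y1_def Y_def)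
    have m: "u \<in> M" "w \<in> M" "u \<in> W" "w \<in> W" "p ?y \<in> W" "p u \<noteq> u" "p w \<noteq> w" "p ?y \<noteq> ?y"
      using u w y(1) by (auto simp: Y2_def Y1_def Y_def)
    have "h ?y < h u" "h ?y < h w" "h (p ?y) < h ?y"
      using p(1) m y(3) eq unfolding ranked_def by metis+
    then have "p ?y \<noteq> u" "p ?y \<noteq> w" by auto
    then have "card {u, w, p ?y} = 3" using ne by auto
    moreover have "{u, w, p ?y} \<subseteq> {v \<in> W. {?y, v} \<in> E}"
    proof -
      have "{?y, u} \<in> E" using nbr[of u] m by (simp add: insert_commute)
      moreover have "{?y, w} \<in> E" using nbr[of w] m eq by (simp add: insert_commute)
      moreover have "{?y, p ?y} \<in> E" using nbr[of ?y] m y by simp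
      ultimately show ?thesis using m by auto
    qed
    then have "card {u, w, p ?y} \<le> card {v \<in> W. {?y, v} \<in> E}" using fW by (intro card_mono) auto
    ultimately show False using dW[OF y(2)] deg_eq[OF E y(2)] by simp
  qed
  show thesis
    by (rule that[of Y2]) (use c inj in \<open>auto simp: Y2_def Y1_def Y_def\<close>)
qed

lemma maximal_matching:
  assumes E: "two_sets E" and U: "finite U"
  obtains \<M> where "\<M> \<subseteq> edges_in E U" "disjoint \<M>"
    "\<And>x y. x \<in> U - \<Union>\<M> \<Longrightarrow> y \<in> U - \<Union>\<M> \<Longrightarrow> {x, y} \<notin> E"
proof -
  define ok where "ok = (\<lambda>\<M>. \<M> \<subseteq> edges_in E U \<and> disjoint \<M>)"
  have "ok {}" by (simp add: ok_def pairwise_empty)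
  moreover have "\<forall>\<M>. ok \<M> \<longrightarrow> card \<M> \<le> card (edges_in E U)"
    using U by (auto simp: ok_def intro: card_mono)
  ultimately obtain \<M> where M: "ok \<M>" and max: "\<And>\<N>. ok \<N> \<Longrightarrow> card \<N> \<le> card \<M>"
    using ex_has_greatest_nat[of ok "{}" card "Suc (card (edges_in E U))"] by (metis le_imp_less_Suc)
  have fM: "finite \<M>" using M U by (auto simp: ok_def intro: finite_subset)
  show thesis
  proof (rule that[of \<M>])
    fix x y assume xy: "x \<in> U - \<Union>\<M>" "y \<in> U - \<Union>\<M>"
    show "{x, y} \<notin> E"
    proof
      assume "{x, y} \<in> E"
      then have "ok (insert {x, y} \<M>)" using M xy by (auto simp: ok_def pairwise_insert disjnt_def)
      moreover have "{x, y} \<notin> \<M>" using xy by auto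
      ultimately show False using max[of "insert {x, y} \<M>"] fM by simp
    qed
  qed (use M in \<open>auto simp: ok_def\<close>)
qed

text \<open>Each hub receives an edge of its own, with which it forms a triangle.\<close>

lemma packs_full_matching:
  assumes E: "two_sets E" and S: "finite S" "S \<subseteq> V" and \<M>: "finite \<M>" "\<M> \<subseteq> edges_in E (V - S)" "disjoint \<M>"
    and card: "card S \<le> card \<M>" and full: "\<And>e u b. e \<in> \<M> \<Longrightarrow> u \<in> e \<Longrightarrow> b \<in> S \<Longrightarrow> {b, u} \<in> E"
  shows "packs E V (card S)"
proof -
  obtain g where g: "inj_on g S" "g ` S \<subseteq> \<M>"
    using card S(1) \<M>(1) inj_on_iff_card_le by blast
  have gM: "g s \<in> \<M>" if "s \<in> S" for s using g(2) that by auto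
  have gE: "g s \<in> E" "g s \<subseteq> V - S" if "s \<in> S" for s using gM[OF that] \<M>(2) by (auto simp: edges_in_def)
  have "disjoint_family_on (\<lambda>s. insert s (g s)) S"
    unfolding disjoint_family_on_def
  proof (intro ballI impI)
    fix s t assume st: "s \<in> S" "t \<in> S" "s \<noteq> t"
    then have "g s \<noteq> g t" using g(1) by (auto simp: inj_on_def)
    then have "g s \<inter> g t = {}" using \<M>(3) gM st by (auto simp: pairwise_def disjnt_def)
    then show "insert s (g s) \<inter> insert t (g t) = {}" using st gE by blast
  qed
  then show ?thesis
    using S gE full_edge_cyclic[OF E gE(1)] full[OF gM]
    by (intro packsI[of S _ "\<lambda>s. insert s (g s)"]) auto
qed

text \<open>Let \<open>W\<close> be a minimal cyclic set avoiding the hubs, or empty if there is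
  none, and take a maximal matching among the vertices outside \<open>W\<close> that are joined to
  all hubs. With more than \<open>k\<close> edges it would make \<open>S\<close> a good blocker if
  \<open>W\<close> is empty, and otherwise yield \<open>k\<close> triangles disjoint from
  \<open>W\<close>, hence a packing of size \<open>k + 1\<close>. So deleting \<open>W\<close> and
  at most \<open>2 * k\<close> matched vertices leaves an independent set, which is affordable if
  \<open>W\<close> has fewer than \<open>l\<close> vertices in the forest; otherwise
  \<open>W\<close> provides the long paths.\<close>

lemma not_good_cases:
  assumes E: "two_sets E" and V: "finite V" and np: "\<not> packs E V (Suc k)" and ng: "\<not> good_blocker k E V S"
    and SR: "S \<subseteq> V" "R \<subseteq> V" "S \<inter> R = {}" "card S = k" "card R \<le> r" and M: "M = V - S - R"
    and p: "p \<in> parent_maps n M" "ranked M p h" "edges_in E M = parent_edges M p"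
    and N: "N = (\<lambda>u\<in>M. {s \<in> S. {s, u} \<in> E})" and z: "real (l + 2 * k) \<le> z"
  shows "(p, N) \<in> nearly_independent n M S z \<union> long_paths n M S l (3 * r)"
proof -
  have fin: "finite S" "finite R" "finite M" using V SR M finite_subset by auto
  have NP: "N \<in> M \<rightarrow>\<^sub>E Pow S" by (auto simp: N)
  have full: "u \<in> full M S N \<Longrightarrow> u \<in> M \<and> (\<forall>s\<in>S. {s, u} \<in> E)" for u by (auto simp: full_def N)
  obtain W where W: "W \<subseteq> V - S" "W = {} \<and> forest E (V - S) \<or> cyclic E W \<and> (\<forall>y\<in>W. \<not> cyclic E (W - {y}))"
  proof (cases "forest E (V - S)")
    case False
    then obtain U where U: "U \<subseteq> V - S" "cyclic E U" by (auto simp: forest_def)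
    obtain W where "W \<subseteq> U" "cyclic E W" "\<And>y. y \<in> W \<Longrightarrow> \<not> cyclic E (W - {y})"
      using ex_minimal_cyclic[OF U(2)] by metis
    then show ?thesis using that[of W] U(1) by auto
  qed (use that in blast)
  have fU: "finite (full M S N - W)" using fin(3) by (simp add: full_def)
  obtain \<M> where \<M>: "\<M> \<subseteq> edges_in E (full M S N - W)" "disjoint \<M>"
    "\<And>x y. x \<in> full M S N - W - \<Union>\<M> \<Longrightarrow> y \<in> full M S N - W - \<Union>\<M> \<Longrightarrow> {x, y} \<notin> E"
    using maximal_matching[OF E fU] by metis
  have fM: "finite \<M>" using \<M>(1) finite_edges_in[OF fU] by (rule finite_subset)
  have sub: "edges_in E (full M S N - W) \<subseteq> edges_in E (V - W - S)"
    by (intro edges_in_mono) (auto simp: full_def M)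
  have fe: "{b, u} \<in> E" if "e \<in> \<M>" "u \<in> e" "b \<in> S" for e u b
    using that \<M>(1) full[of u] by (auto simp: edges_in_def)
  have small: "card \<M> \<le> k"
  proof (rule ccontr)
    assume "\<not> card \<M> \<le> k"
    then obtain \<M>' where \<M>': "\<M>' \<subseteq> \<M>" "card \<M>' = Suc k" using fM by (metis not_less_eq_eq obtain_subset_with_card_n)
    from W(2) show False
    proof
      assume w: "W = {} \<and> forest E (V - S)"
      have "\<M>' \<subseteq> edges_in E (V - S)" using \<M>' \<M>(1) sub w by auto
      moreover have "disjoint \<M>'" using \<M>(2) \<M>'(1) by (rule pairwise_subset)
      moreover have "\<forall>e\<in>\<M>'. \<forall>u\<in>e. \<forall>b\<in>S. {b, u} \<in> E" using fe \<M>'(1) by blast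
      ultimately have "good_blocker k E V S" using SR(1,4) \<M>'(2) w unfolding good_blocker_def by metis
      then show False using ng by simp
    next
      assume w: "cyclic E W \<and> (\<forall>y\<in>W. \<not> cyclic E (W - {y}))"
      have "packs E (V - W) (card S)"
        by (rule packs_full_matching[OF E fin(1) _ fM]) (use SR W \<M> sub fe \<open>\<not> card \<M> \<le> k\<close> in auto)
      then show False using packs_Suc[of E V W k] w W(1) SR(4) np by auto
    qed
  qed
  show ?thesis
  proof (cases "card (W \<inter> M) < l")
    case True
    let ?Z = "(W \<inter> M) \<union> \<Union>\<M>"
    have "card ?Z \<le> card (W \<inter> M) + card (\<Union>\<M>)" by (rule card_Un_le)
    also have "card (\<Union>\<M>) \<le> (\<Sum>e\<in>\<M>. card e)" using fM card_UN_le[of \<M> id] by simp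
    also have "\<dots> = (\<Sum>e\<in>\<M>. 2)"
      using E \<M>(1) by (intro sum.cong) (auto simp: two_sets_def edges_in_def)
    finally have "card ?Z \<le> l + 2 * k" using True small by simp
    then have "real (card ?Z) \<le> z" using z by linarith
    moreover have "?Z \<subseteq> M" using \<M>(1) by (auto simp: edges_in_def full_def)
    moreover have "independent_map p (full M S N - ?Z)"
      unfolding independent_map_def
    proof (intro ballI impI, rule ccontr)
      fix u assume u: "u \<in> full M S N - ?Z" "p u \<in> full M S N - ?Z" "p u \<noteq> u"
      then have "u \<in> M" by (auto simp: full_def)
      then have "{u, p u} \<in> edges_in E M" unfolding p(3) parent_edges_def using u(3) by blast
      then have "{u, p u} \<in> E" by (simp add: edges_in_def)
      moreover have "u \<in> full M S N - W - \<Union>\<M>" "p u \<in> full M S N - W - \<Union>\<M>" using u by (auto simp: full_def)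
      ultimately show False using \<M>(3) by blast
    qed
    ultimately have "(p, N) \<in> nearly_independent n M S z"
      unfolding nearly_independent_def using p(1) NP by blast
    then show ?thesis by simp
  next
    case False
    show ?thesis
    proof (cases "W = {}")
      case True
      then have "l = 0" using False by simp
      then have "(p, N) \<in> long_paths n M S l (3 * r)"
        unfolding long_paths_def using p(1) NP by (auto intro!: exI[of _ "{}"])
      then show ?thesis by simp
    next
      case ne: False
      then have w: "cyclic E W" "\<And>y. y \<in> W \<Longrightarrow> \<not> cyclic E (W - {y})" using W(2) by auto
      have "W \<subseteq> M \<union> R" "M \<inter> R = {}" using W(1) M by auto
      then obtain Y' where Y': "Y' \<subseteq> W \<inter> M" "card (W \<inter> M - Y') \<le> 3 * r" "inj_on p Y'" "p ` Y' \<subseteq> W \<inter> M" "\<And>u. u \<in> Y' \<Longrightarrow> p u \<noteq> u"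
        using cycle_in_forest_injective[OF E w _ _ fin(2) SR(5) p(2,3)] by metis
      have "\<exists>Y\<subseteq>M. \<exists>Y'\<subseteq>Y. l \<le> card Y \<and> card (Y - Y') \<le> 3 * r \<and> inj_on p Y' \<and> p ` Y' \<subseteq> Y \<and> (\<forall>u\<in>Y'. p u \<noteq> u)"
        by (rule exI[of _ "W \<inter> M"], intro conjI exI[of _ Y']) (use Y' False in auto)
      then have "(p, N) \<in> long_paths n M S l (3 * r)"
        unfolding long_paths_def using p(1) NP by simp
      then show ?thesis by simp
    qed
  qed
qed

text \<open>With fewer than \<open>k\<close> hubs no further condition is needed, since a missing
  hub already saves a factor of two per vertex.\<close>

definition bad_codes :: "nat \<Rightarrow> nat \<Rightarrow> 'a set \<Rightarrow> 'a set \<Rightarrow> real \<Rightarrow> nat \<Rightarrow> nat \<Rightarrow> (('a \<Rightarrow> 'a) \<times> ('a \<Rightarrow> 'a set)) set" where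
  "bad_codes k n M S z l d =
    (if card S < k then parent_maps n M \<times> (M \<rightarrow>\<^sub>E Pow S)
     else nearly_independent n M S z \<union> long_paths n M S l d)"

text \<open>The order of quantifiers matters: \<open>r\<close> depends on \<open>k\<close> alone, so
  the rates, which will depend on \<open>r\<close>, and the thresholds \<open>l\<close> and
  \<open>z\<close>, which will grow with \<open>n\<close>, can be chosen afterwards.\<close>

theorem bad_cover:
  "\<exists>r. \<forall>(E :: 'a set set) V n l z. two_sets E \<longrightarrow> finite V \<longrightarrow> \<Union>E \<subseteq> V \<longrightarrow> \<not> packs E V (Suc k) \<longrightarrow>
     (\<forall>B. \<not> good_blocker k E V B) \<longrightarrow> card V \<le> n \<longrightarrow> real (l + 2 * k) \<le> z \<longrightarrow>
     (\<exists>S R. S \<subseteq> V \<and> R \<subseteq> V \<and> card S \<le> k \<and> card R \<le> r \<and>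
       E \<in> assembled n (V - S - R) R (S \<union> R) (bad_codes k n (V - S - R) S z l (3 * r)))"
proof -
  obtain r where r: "\<And>(E :: 'a set set) V. two_sets E \<Longrightarrow> finite V \<Longrightarrow> \<not> packs E V (Suc k) \<Longrightarrow>
    \<exists>S R. S \<subseteq> V \<and> R \<subseteq> V \<and> S \<inter> R = {} \<and> card S \<le> k \<and> card R \<le> r \<and> forest E (V - S - R) \<and>
      (\<forall>v\<in>R. forest E (insert v (V - S - R)))" using hub_structure[of k] by blast
  have main: "\<exists>S R. S \<subseteq> V \<and> R \<subseteq> V \<and> card S \<le> k \<and> card R \<le> r \<and>
       E \<in> assembled n (V - S - R) R (S \<union> R) (bad_codes k n (V - S - R) S z l (3 * r))"
    if E: "two_sets E" and V: "finite V" "\<Union>E \<subseteq> V" and np: "\<not> packs E V (Suc k)"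
      and ng: "\<forall>B. \<not> good_blocker k E V B" and n: "card V \<le> n" and z: "real (l + 2 * k) \<le> z"
    for E :: "'a set set" and V n l z
  proof -
    obtain S R where SR: "S \<subseteq> V" "R \<subseteq> V" "S \<inter> R = {}" "card S \<le> k" "card R \<le> r" "forest E (V - S - R)"
      "\<And>v. v \<in> R \<Longrightarrow> forest E (insert v (V - S - R))" using r[OF E V(1) np] by metis
    define M where "M = V - S - R"
    have "card M \<le> card V" using V(1) by (auto simp: M_def intro: card_mono)
    then have cM: "card M \<le> n" using n by simp
    have eV: "\<And>e. e \<in> E \<Longrightarrow> e \<subseteq> V" using V(2) by auto
    obtain p h att where p: "p \<in> parent_maps n M" "ranked M p h" "edges_in E M = parent_edges M p"
      and att: "att \<in> R \<rightarrow>\<^sub>E transversals n p M"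
      and asm: "E = assemble M R (edges_in E (S \<union> R)) p att (\<lambda>u\<in>M. {s \<in> S. {s, u} \<in> E})"
      by (rule assemble_cover[OF E V(1) eV M_def SR(1-3) _ _ cM]) (use SR(6,7) in \<open>auto simp: M_def\<close>)
    define N where "N = (\<lambda>u\<in>M. {s \<in> S. {s, u} \<in> E})"
    have "(p, N) \<in> bad_codes k n M S z l (3 * r)"
    proof (cases "card S < k")
      case True
      then show ?thesis using p(1) by (auto simp: bad_codes_def N_def)
    next
      case False
      then have "card S = k" using SR(4) by simp
      then show ?thesis
        using not_good_cases[OF E V(1) np _ SR(1-3) _ SR(5) M_def p N_def z] ng False by (auto simp: bad_codes_def)
    qed
    moreover have "edges_in E (S \<union> R) \<in> Pow (Pow (S \<union> R))" by (auto simp: edges_in_def)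
    ultimately have "(edges_in E (S \<union> R), (p, N), att) \<in>
        Pow (Pow (S \<union> R)) \<times> (SIGMA x : bad_codes k n M S z l (3 * r). R \<rightarrow>\<^sub>E transversals n (fst x) M)"
      using att by simp
    then have "E \<in> assembled n M R (S \<union> R) (bad_codes k n M S z l (3 * r))"
      unfolding assembled_def by (rule rev_image_eqI) (simp add: N_def flip: asm)
    then show ?thesis using SR(1,2,4,5) unfolding M_def by blast
  qed
  show ?thesis by (rule exI[of _ r], (rule allI)+, (rule impI)+, rule main; assumption)
qed

subsection \<open>A lower bound from rooted forests\<close>

text \<open>Every tree of a member contains exactly one vertex of \<open>A\<close>.\<close>

definition rooted_forests :: "'a set \<Rightarrow> 'a set \<Rightarrow> 'a set set set" where
  "rooted_forests V A = {E. two_sets E \<and> \<Union>E \<subseteq> V \<union> A \<and>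
     (\<forall>W\<subseteq>V \<union> A. W \<noteq> {} \<longrightarrow> card (edges_in E W) < card W \<and> card (edges_in E W) \<le> card (W - A))}"

lemma finite_rooted_forests:
  assumes "finite V" "finite A"
  shows "finite (rooted_forests V A)"
  by (rule finite_subset[of _ "Pow (Pow (V \<union> A))"]) (use assms in \<open>auto simp: rooted_forests_def\<close>)

text \<open>Absorb the factor \<open>i\<close> into the binomial coefficient and apply the binomial
  theorem with exponent \<open>m - 1\<close>. This is the recursion satisfied by the number
  \<open>j * (m + j) ^ (m - 1)\<close> of forests on \<open>m + j\<close> vertices with
  \<open>j\<close> prescribed roots; quotients replace exponents lowered by one.\<close>

lemma sum_binomial_abel:
  assumes "m \<ge> 1"
  shows "(\<Sum>i\<le>m. real (m choose i) * (real j ^ i * (real i * real m ^ (m - i) / real m))) =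
    real j * real (m + j) ^ m / real (m + j)"
proof -
  obtain m' where m: "m = Suc m'" using assms by (cases m) auto
  let ?t = "\<lambda>i. real (m choose i) * (real j ^ i * (real i * real m ^ (m - i) / real m))"
  have "(\<Sum>i\<le>m. ?t i) = ?t 0 + (\<Sum>i\<le>m'. ?t (Suc i))"
    unfolding m by (rule sum.atMost_Suc_shift)
  also have "\<dots> = (\<Sum>i\<le>m'. ?t (Suc i))" by simp
  also have "\<dots> = (\<Sum>i\<le>m'. real j * (real (m' choose i) * real j ^ i * real m ^ (m' - i)))"
  proof (rule sum.cong)
    fix i
    have "Suc i * (m choose Suc i) = m * (m' choose i)" unfolding m by (rule Suc_times_binomial)
    then have c: "real (Suc i) * real (m choose Suc i) = real m * real (m' choose i)"
      by (metis of_nat_mult)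
    have "?t (Suc i) = (real (Suc i) * real (m choose Suc i)) * (real j ^ Suc i * real m ^ (m' - i)) / real m"
      by (simp add: m mult_ac)
    also have "\<dots> = real j * (real (m' choose i) * real j ^ i * real m ^ (m' - i))"
      unfolding c using m by simp
    finally show "?t (Suc i) = real j * (real (m' choose i) * real j ^ i * real m ^ (m' - i))" .
  qed simp
  also have "\<dots> = real j * (real j + real m) ^ m'"
    by (simp add: binomial_ring sum_distrib_left)
  also have "\<dots> = real j * real (m + j) ^ m / real (m + j)"
    by (simp add: m add_ac)
  finally show ?thesis .
qed

lemma empty_in_rooted_forests:
  assumes "finite V" "finite A"
  shows "{} \<in> rooted_forests V A"
proof -
  have "card (edges_in {} W) < card W" if "W \<subseteq> V \<union> A" "W \<noteq> {}" for W
    using that assms finite_subset[of W "V \<union> A"] by (simp add: edges_in_def card_gt_0_iff)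
  then show ?thesis by (auto simp: rooted_forests_def two_sets_def edges_in_def)
qed

text \<open>A set \<open>W\<close> spans at most \<open>card (W - A - J)\<close> old edges and at
  most \<open>card (W \<inter> J)\<close> new ones, together at most \<open>card (W - A)\<close>.
  Strictness against \<open>card W\<close> comes from a root in \<open>W\<close>, or from the
  smaller forest if there is none.\<close>

lemma rooted_forests_extend:
  assumes VA: "finite V" "finite A" "V \<inter> A = {}" and J: "J \<subseteq> V" and f: "f \<in> J \<rightarrow>\<^sub>E A"
    and E: "E \<in> rooted_forests (V - J) J"
  shows "E \<union> (\<lambda>v. {v, f v}) ` J \<in> rooted_forests V A"
proof -
  let ?E = "E \<union> (\<lambda>v. {v, f v}) ` J"
  have eq: "V - J \<union> J = V" using J by auto
  have E2: "two_sets E" and EV: "\<Union>E \<subseteq> V" using E unfolding rooted_forests_def eq by auto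
  have Elt: "card (edges_in E W) < card W" "card (edges_in E W) \<le> card (W - J)" if "W \<subseteq> V" "W \<noteq> {}" for W
    using E that unfolding rooted_forests_def eq by auto
  have fA: "f v \<in> A" if "v \<in> J" for v using PiE_mem[OF f that] .
  then have fv: "f v \<in> A" "f v \<noteq> v" "f v \<notin> V" if "v \<in> J" for v
    using that J VA(3) by force+
  have "two_sets ?E" using E2 fv(2) by (auto simp: two_sets_def card_2_iff)
  moreover have "\<Union>?E \<subseteq> V \<union> A" using EV J fv(1) by auto
  moreover have "card (edges_in ?E W) < card W \<and> card (edges_in ?E W) \<le> card (W - A)"
    if W: "W \<subseteq> V \<union> A" "W \<noteq> {}" for W
  proof -
    have fW: "finite W" using W(1) VA finite_subset by blast
    have WV: "W - A \<subseteq> V" using W by auto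
    have "edges_in ?E W \<subseteq> edges_in E (W - A) \<union> (\<lambda>v. {v, f v}) ` (W \<inter> J)"
      using EV VA(3) by (auto simp: edges_in_def)
    then have "card (edges_in ?E W) \<le> card (edges_in E (W - A) \<union> (\<lambda>v. {v, f v}) ` (W \<inter> J))"
      using fW by (intro card_mono) auto
    also have "\<dots> \<le> card (edges_in E (W - A)) + card ((\<lambda>v. {v, f v}) ` (W \<inter> J))" by (rule card_Un_le)
    also have "card (edges_in E (W - A)) \<le> card (W - A - J)"
    proof (cases "W - A = {}")
      case True
      have "edges_in E (W - A) = {}" unfolding True using E2 by (auto simp: edges_in_def two_sets_def)
      then show ?thesis by simp
    qed (use Elt(2)[OF WV] in auto)
    also have "card ((\<lambda>v. {v, f v}) ` (W \<inter> J)) \<le> card (W \<inter> J)" using fW by (intro card_image_le) auto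
    also have "card (W - A - J) + card (W \<inter> J) = card (W - A)"
    proof -
      have "(W - A) \<inter> J = W \<inter> J" using J VA(3) by auto
      then show ?thesis using card_Int_Diff[of "W - A" J] fW by simp
    qed
    finally have le: "card (edges_in ?E W) \<le> card (W - A)" by simp
    moreover have "card (edges_in ?E W) < card W"
    proof (cases "W \<inter> A = {}")
      case True
      then have "edges_in ?E W = edges_in E W" using fv(1) by (auto simp: edges_in_def)
      moreover have "W \<subseteq> V" using W True by auto
      ultimately show ?thesis using Elt(1) W(2) by simp
    next
      case False
      then have "W - A \<subset> W" by auto
      then have "card (W - A) < card W" using fW by (rule psubset_card_mono[rotated])
      then show ?thesis using le by simp
    qed
    ultimately show ?thesis by simp
  qed
  ultimately show ?thesis unfolding rooted_forests_def by blast
qed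

text \<open>From the union one recovers \<open>J\<close> as the vertices adjacent to
  \<open>A\<close>, \<open>f\<close> as their neighbours in \<open>A\<close>, and the smaller forest
  as the edges inside \<open>V\<close>.\<close>

lemma inj_on_rooted_forests_extend:
  assumes VA: "V \<inter> A = {}"
  shows "inj_on (\<lambda>(J, f, E). E \<union> (\<lambda>v. {v, f v}) ` J)
    (SIGMA J : {J. J \<subseteq> V \<and> J \<noteq> {}}. (J \<rightarrow>\<^sub>E A) \<times> rooted_forests (V - J) J)"
proof -
  have rec: "J = {v \<in> V. \<exists>a\<in>A. {v, a} \<in> F}" "\<And>v a. v \<in> J \<Longrightarrow> a \<in> A \<Longrightarrow> {v, a} \<in> F \<longleftrightarrow> f v = a" "E = edges_in F V"
    if J: "J \<subseteq> V" and f: "f \<in> J \<rightarrow>\<^sub>E A" and E: "E \<in> rooted_forests (V - J) J"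
      and F: "F = E \<union> (\<lambda>v. {v, f v}) ` J" for J f E F
  proof -
    have "V - J \<union> J = V" using J by auto
    then have EV: "\<Union>E \<subseteq> V" using E unfolding rooted_forests_def by auto
    have fA: "f v \<in> A" "f v \<notin> V" if "v \<in> J" for v using f that VA by auto
    have iff: "{v, a} \<in> F \<longleftrightarrow> v \<in> J \<and> f v = a" if "v \<in> V" "a \<in> A" for v a
    proof
      assume "{v, a} \<in> F"
      moreover have "a \<notin> V" using that VA by auto
      then have "{v, a} \<notin> E" using EV by auto
      ultimately obtain w where "w \<in> J" "{v, a} = {w, f w}" unfolding F by auto
      then show "v \<in> J \<and> f v = a" using that fA J VA by (auto simp: doubleton_eq_iff)
    qed (auto simp: F)
    show "J = {v \<in> V. \<exists>a\<in>A. {v, a} \<in> F}" using iff J fA by auto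
    show "{v, a} \<in> F \<longleftrightarrow> f v = a" if "v \<in> J" "a \<in> A" for v a using iff that J by auto
    show "E = edges_in F V" using EV fA J unfolding F by (auto simp: edges_in_def)
  qed
  show ?thesis
  proof (rule inj_onI)
    fix x y assume x: "x \<in> (SIGMA J : {J. J \<subseteq> V \<and> J \<noteq> {}}. (J \<rightarrow>\<^sub>E A) \<times> rooted_forests (V - J) J)"
      and y: "y \<in> (SIGMA J : {J. J \<subseteq> V \<and> J \<noteq> {}}. (J \<rightarrow>\<^sub>E A) \<times> rooted_forests (V - J) J)"
      and xy: "(\<lambda>(J, f, E). E \<union> (\<lambda>v. {v, f v}) ` J) x = (\<lambda>(J, f, E). E \<union> (\<lambda>v. {v, f v}) ` J) y"
    obtain J f E where x': "x = (J, f, E)" by (cases x) auto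
    obtain J' f' E' where y': "y = (J', f', E')" by (cases y) auto
    have 1: "J \<subseteq> V" "f \<in> J \<rightarrow>\<^sub>E A" "E \<in> rooted_forests (V - J) J" using x x' by auto
    have 2: "J' \<subseteq> V" "f' \<in> J' \<rightarrow>\<^sub>E A" "E' \<in> rooted_forests (V - J') J'" using y y' by auto
    have eq: "E \<union> (\<lambda>v. {v, f v}) ` J = E' \<union> (\<lambda>v. {v, f' v}) ` J'" using xy x' y' by simp
    note r1 = rec[OF 1 refl] and r2 = rec[OF 2 refl, folded eq]
    have J: "J = J'" using r1(1) r2(1) by metis
    have "f = f'"
    proof (rule PiE_ext[OF 1(2)])
      show "f' \<in> J \<rightarrow>\<^sub>E A" using 2(2) J by simp
      fix v assume v: "v \<in> J"
      then have "f v \<in> A" using 1(2) by auto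
      then show "f v = f' v" using r1(2)[OF v] r2(2)[of v "f v"] v J by auto
    qed
    then show "x = y" unfolding x' y' using J r1(3) r2(3) by metis
  qed
qed

text \<open>The recursion peels off the set \<open>J\<close> of vertices attached directly to the roots.\<close>

lemma card_rooted_forests_ge:
  "finite V \<Longrightarrow> finite A \<Longrightarrow> A \<noteq> {} \<Longrightarrow> V \<inter> A = {} \<Longrightarrow>
    real (card A) * real (card V + card A) ^ card V / real (card V + card A) \<le> real (card (rooted_forests V A))"
proof (induction "card V" arbitrary: V A rule: less_induct)
  case less
  note V = less.prems(1) and A = less.prems(2,3) and VA = less.prems(4)
  have fin: "finite (rooted_forests V A)" using V A(1) by (rule finite_rooted_forests)
  show ?case
  proof (cases "V = {}")
    case True
    have "0 < card (rooted_forests V A)"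
      using empty_in_rooted_forests[OF V A(1)] fin by (auto simp: card_gt_0_iff)
    moreover have "0 < card A" using A by (simp add: card_gt_0_iff)
    ultimately show ?thesis using True by (simp add: Suc_le_eq)
  next
    case False
    let ?m = "card V" and ?j = "card A"
    have m1: "?m \<ge> 1" using False V by (simp add: Suc_le_eq card_gt_0_iff)
    let ?X = "SIGMA J : {J. J \<subseteq> V \<and> J \<noteq> {}}. (J \<rightarrow>\<^sub>E A) \<times> rooted_forests (V - J) J"
    let ?g = "\<lambda>(J, f, E). E \<union> (\<lambda>v. {v, f v}) ` J"
    have "card (?g ` ?X) \<le> card (rooted_forests V A)"
      using fin rooted_forests_extend[OF V A(1) VA] by (intro card_mono) auto
    then have le: "card ?X \<le> card (rooted_forests V A)"
      using card_image[OF inj_on_rooted_forests_extend[OF VA]] by simp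
    moreover have cX: "card ?X = (\<Sum>J\<in>{J. J \<subseteq> V \<and> J \<noteq> {}}. card ((J \<rightarrow>\<^sub>E A) \<times> rooted_forests (V - J) J))"
      using V A(1) by (intro card_SigmaI) (auto intro!: finite_cartesian_product finite_PiE finite_rooted_forests dest: finite_subset)
    moreover have "(\<Sum>J\<in>{J. J \<subseteq> V \<and> J \<noteq> {}}. real ?j ^ card J * (real (card J) * real ?m ^ (?m - card J) / real ?m)) \<le>
        (\<Sum>J\<in>{J. J \<subseteq> V \<and> J \<noteq> {}}. real (card ((J \<rightarrow>\<^sub>E A) \<times> rooted_forests (V - J) J)))"
    proof (rule sum_mono)
      fix J assume "J \<in> {J. J \<subseteq> V \<and> J \<noteq> {}}"
      then have J: "J \<subseteq> V" "J \<noteq> {}" by auto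
      have fJ: "finite J" using J(1) V finite_subset by blast
      have c: "card (V - J) = ?m - card J" "card J \<le> ?m" "0 < card J"
        using J V fJ by (auto simp: card_Diff_subset card_mono card_gt_0_iff)
      \<comment> \<open>The new roots and the remaining vertices together always number
        \<open>card V\<close>; this is why the resulting sum is the binomial one above.\<close>
      have "real (card J) * real (card (V - J) + card J) ^ card (V - J) / real (card (V - J) + card J)
          \<le> real (card (rooted_forests (V - J) J))"
        using c m1 V fJ J by (intro less.hyps) auto
      then have "real (card J) * real ?m ^ (?m - card J) / real ?m \<le> real (card (rooted_forests (V - J) J))"
        using c by simp
      then have "real ?j ^ card J * (real (card J) * real ?m ^ (?m - card J) / real ?m) \<le>
          real ?j ^ card J * real (card (rooted_forests (V - J) J))" by (intro mult_left_mono) auto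
      also have "\<dots> = real (card ((J \<rightarrow>\<^sub>E A) \<times> rooted_forests (V - J) J))"
        using fJ by (simp add: card_cartesian_product card_funcsetE)
      finally show "real ?j ^ card J * (real (card J) * real ?m ^ (?m - card J) / real ?m) \<le>
          real (card ((J \<rightarrow>\<^sub>E A) \<times> rooted_forests (V - J) J))" .
    qed
    moreover have "(\<Sum>J\<in>{J. J \<subseteq> V \<and> J \<noteq> {}}. real ?j ^ card J * (real (card J) * real ?m ^ (?m - card J) / real ?m)) =
        real ?j * real (?m + ?j) ^ ?m / real (?m + ?j)"
    proof -
      let ?F = "\<lambda>i. real ?j ^ i * (real i * real ?m ^ (?m - i) / real ?m)"
      have "(\<Sum>J\<in>{J. J \<subseteq> V \<and> J \<noteq> {}}. ?F (card J)) = (\<Sum>J\<in>Pow V. ?F (card J))"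
        using V by (intro sum.mono_neutral_left) auto
      also have "\<dots> = (\<Sum>i\<le>?m. \<Sum>J\<in>{J \<in> Pow V. card J = i}. ?F (card J))"
      proof (rule sum.group[symmetric])
        show "card ` Pow V \<subseteq> {..?m}" using V by (auto intro: card_mono)
      qed (use V in auto)
      also have "\<dots> = (\<Sum>i\<le>?m. real (?m choose i) * ?F i)"
      proof (rule sum.cong)
        fix i
        have "(\<Sum>J\<in>{J \<in> Pow V. card J = i}. ?F (card J)) = (\<Sum>J\<in>{J \<in> Pow V. card J = i}. ?F i)"
          by (rule sum.cong) auto
        also have "\<dots> = real (card {J. J \<subseteq> V \<and> card J = i}) * ?F i" by (simp only: sum_constant Pow_iff)
        also have "\<dots> = real (?m choose i) * ?F i" using n_subsets[OF V] by simp
        finally show "(\<Sum>J\<in>{J \<in> Pow V. card J = i}. ?F (card J)) = real (?m choose i) * ?F i" .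
      qed simp
      also have "\<dots> = real ?j * real (?m + ?j) ^ ?m / real (?m + ?j)" by (rule sum_binomial_abel[OF m1])
      finally show ?thesis .
    qed
    moreover have "(\<Sum>J\<in>{J. J \<subseteq> V \<and> J \<noteq> {}}. real (card ((J \<rightarrow>\<^sub>E A) \<times> rooted_forests (V - J) J))) \<le>
        real (card (rooted_forests V A))"
      using of_nat_mono[OF le[unfolded cX], where 'a = real] by (simp only: of_nat_sum)
    ultimately show ?thesis by linarith
  qed
qed

lemma finite_edge_sets: "finite U \<Longrightarrow> finite {E. two_sets E \<and> \<Union>E \<subseteq> U \<and> P E}"
  by (rule finite_subset[of _ "Pow (Pow U)"]) blast+

lemma card_forests_ge:
  assumes U: "finite U" "U \<noteq> {}"
  shows "real (card U) ^ (card U - 1) / real (card U) \<le> real (card {E. two_sets E \<and> \<Union>E \<subseteq> U \<and> forest E U})"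
proof -
  obtain a where a: "a \<in> U" using U by blast
  have c: "card (U - {a}) = card U - 1" "0 < card U" using a U by (auto simp: card_gt_0_iff)
  have eq: "U - {a} \<union> {a} = U" using a by auto
  have "rooted_forests (U - {a}) {a} \<subseteq> {E. two_sets E \<and> \<Union>E \<subseteq> U \<and> forest E U}"
  proof
    fix E assume "E \<in> rooted_forests (U - {a}) {a}"
    then have E: "two_sets E" "\<Union>E \<subseteq> U" "\<And>W. W \<subseteq> U \<Longrightarrow> W \<noteq> {} \<Longrightarrow> card (edges_in E W) < card W"
      unfolding rooted_forests_def eq by auto
    then have "forest E U" unfolding forest_def cyclic_def by (metis not_le)
    then show "E \<in> {E. two_sets E \<and> \<Union>E \<subseteq> U \<and> forest E U}" using E by simp
  qed
  moreover have "finite {E. two_sets E \<and> \<Union>E \<subseteq> U \<and> forest E U}"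
    using U(1) by (rule finite_edge_sets)
  ultimately have "real (card (rooted_forests (U - {a}) {a})) \<le> real (card {E. two_sets E \<and> \<Union>E \<subseteq> U \<and> forest E U})"
    by (intro of_nat_mono card_mono)
  moreover have "real (card U) ^ (card U - 1) / real (card U) \<le> real (card (rooted_forests (U - {a}) {a}))"
    using card_rooted_forests_ge[of "U - {a}" "{a}"] U c by simp
  ultimately show ?thesis by linarith
qed

lemma blocker_not_packs:
  assumes F: "forest E (V - B)" and B: "finite B" "card B < m"
  shows "\<not> packs E V m"
proof
  assume "packs E V m"
  then obtain f where f: "\<And>i. i < m \<Longrightarrow> f i \<subseteq> V \<and> cyclic E (f i)" "disjoint_family_on f {..<m}"
    by (auto simp: packs_def)
  have "\<exists>b. b \<in> f i \<inter> B" if "i < m" for i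
  proof (rule ccontr)
    assume "\<nexists>b. b \<in> f i \<inter> B"
    then have "f i \<subseteq> V - B" using f(1)[OF that] by auto
    then show False using F f(1)[OF that] by (auto simp: forest_def)
  qed
  then obtain g where g: "\<And>i. i < m \<Longrightarrow> g i \<in> f i \<inter> B" by metis
  have "inj_on g {..<m}"
  proof (rule inj_onI, rule ccontr)
    fix i j assume ij: "i \<in> {..<m}" "j \<in> {..<m}" "g i = g j" "i \<noteq> j"
    then have "f i \<inter> f j = {}" using f(2) by (auto simp: disjoint_family_on_def)
    then show False using g[of i] g[of j] ij by auto
  qed
  then have "card {..<m} \<le> card B" using g B(1) by (intro card_inj_on_le[of g]) auto
  then show False using B(2) by simp
qed

section \<open>The class as a family of edge sets, and its size from below\<close>

definition Ex_edges :: "nat \<Rightarrow> 'a set \<Rightarrow> 'a set set set" where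
  "Ex_edges k V = {E. two_sets E \<and> \<Union>E \<subseteq> V \<and> \<not> packs E V (Suc k)}"

lemma finite_Ex_edges: "finite V \<Longrightarrow> finite (Ex_edges k V)"
  by (rule finite_subset[of _ "Pow (Pow V)"]) (auto simp: Ex_edges_def)

lemma on_vertices_Ex_cycles_eq: "on_vertices (Ex_cycles (k + 1)) n = Pair {1..n} ` Ex_edges k {1..n}"
proof -
  have "G \<in> on_vertices (Ex_cycles (k + 1)) n \<longleftrightarrow> fst G = {1..n} \<and> snd G \<in> Ex_edges k {1..n}" for G
  proof -
    have "G \<in> simple_graphs \<and> fst G = {1..n} \<longleftrightarrow> fst G = {1..n} \<and> two_sets (snd G) \<and> \<Union>(snd G) \<subseteq> {1..n}"
      by (auto simp: simple_graphs_def two_sets_def)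
    then show ?thesis
      using has_disjoint_cycles_iff_packs[of G "k + 1"]
      by (auto simp: on_vertices_def Ex_cycles_def Ex_edges_def)
  qed
  then show ?thesis by (force simp: image_iff)
qed

text \<open>Fix one set \<open>B\<close> of \<open>k\<close> vertices and combine any forest outside
  it with any set of edges between \<open>B\<close> and the rest. The two parts are recovered by
  asking whether an edge meets \<open>B\<close>. Edges inside \<open>B\<close> are left out, at the
  cost of a constant factor.\<close>

lemma card_Ex_edges_ge:
  assumes V: "finite V" and k: "k < card V"
  shows "2 ^ (k * (card V - k)) * (real (card V - k) ^ (card V - k - 1) / real (card V - k)) \<le> real (card (Ex_edges k V))"
proof -
  obtain B where B: "B \<subseteq> V" "card B = k" using k by (meson obtain_subset_with_card_n less_imp_le)
  have fB: "finite B" using B(1) V finite_subset by blast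
  let ?U = "V - B"
  have cU: "card ?U = card V - k" using B V fB by (simp add: card_Diff_subset)
  have "0 < card ?U" using cU k by simp
  then have U: "finite ?U" "?U \<noteq> {}" by (metis card_gt_0_iff)+
  let ?F = "{E. two_sets E \<and> \<Union>E \<subseteq> ?U \<and> forest E ?U}"
  define Y where "Y = (\<lambda>(b, u). {b, u}) ` (B \<times> ?U)"
  have "inj_on (\<lambda>(b, u). {b, u}) (B \<times> ?U)" by (auto simp: inj_on_def doubleton_eq_iff)
  then have cX: "card Y = k * (card V - k)"
    using B(2) cU by (simp add: Y_def card_image card_cartesian_product)
  have fX: "finite Y" using fB U by (auto simp: Y_def)
  have Y2: "card x = 2" and YB: "x \<inter> B \<noteq> {}" and YV: "x \<subseteq> V" if "x \<in> Y" for x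
    using that B(1) by (auto simp: Y_def card_2_iff)
  have sub: "(\<lambda>(E, X). E \<union> X) ` (?F \<times> Pow Y) \<subseteq> Ex_edges k V"
  proof (rule image_subsetI)
    fix z assume z: "z \<in> ?F \<times> Pow Y"
    obtain E X where z': "z = (E, X)" by (cases z) auto
    have E: "two_sets E" "\<Union>E \<subseteq> ?U" "forest E ?U" and X: "X \<subseteq> Y" using z unfolding z' by auto
    have "two_sets (E \<union> X)" using E(1) X Y2 unfolding two_sets_def by blast
    moreover have "\<Union>(E \<union> X) \<subseteq> V" using E(2) X YV by blast
    moreover have "forest (E \<union> X) ?U"
    proof -
      have "edges_in (E \<union> X) W = edges_in E W" if "W \<subseteq> ?U" for W
        using that X YB unfolding edges_in_def by blast
      then show ?thesis using E(3) unfolding forest_def cyclic_def by metis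
    qed
    then have "\<not> packs (E \<union> X) V (Suc k)" using fB B(2) by (intro blocker_not_packs) auto
    ultimately show "(\<lambda>(E, X). E \<union> X) z \<in> Ex_edges k V" unfolding z' by (simp add: Ex_edges_def)
  qed
  have "inj_on (\<lambda>(E, X). E \<union> X) (?F \<times> Pow Y)"
  proof (rule inj_onI)
    fix x y assume x: "x \<in> ?F \<times> Pow Y" and y: "y \<in> ?F \<times> Pow Y"
      and xy: "(\<lambda>(E, X). E \<union> X) x = (\<lambda>(E, X). E \<union> X) y"
    obtain E X where x': "x = (E, X)" by (cases x) auto
    obtain E' X' where y': "y = (E', X')" by (cases y) auto
    have E: "\<Union>E \<subseteq> ?U" "\<Union>E' \<subseteq> ?U" and X: "X \<subseteq> Y" "X' \<subseteq> Y" and eq: "E \<union> X = E' \<union> X'"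
      using x y xy unfolding x' y' by simp_all
    have 1: "e \<inter> B = {}" if "e \<in> E \<union> E'" for e using that E by blast
    have 2: "e \<inter> B \<noteq> {}" if "e \<in> X \<union> X'" for e using that X YB by blast
    have "E = {e \<in> E \<union> X. e \<inter> B = {}}" "X = {e \<in> E \<union> X. e \<inter> B \<noteq> {}}" using 1 2 by blast+
    moreover have "E' = {e \<in> E \<union> X. e \<inter> B = {}}" "X' = {e \<in> E \<union> X. e \<inter> B \<noteq> {}}" unfolding eq using 1 2 by blast+
    ultimately show "x = y" unfolding x' y' by metis
  qed
  then have "card (?F \<times> Pow Y) = card ((\<lambda>(E, X). E \<union> X) ` (?F \<times> Pow Y))" by (simp add: card_image)
  also have "\<dots> \<le> card (Ex_edges k V)" by (rule card_mono[OF finite_Ex_edges[OF V] sub])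
  finally have le: "card ?F * 2 ^ (k * (card V - k)) \<le> card (Ex_edges k V)"
    using cX fX by (simp add: card_cartesian_product card_Pow)
  have "real (card ?F) * 2 ^ (k * (card V - k)) \<le> real (card (Ex_edges k V))"
    using of_nat_mono[OF le, where 'a = real]
    by (simp only: of_nat_mult of_nat_power of_nat_numeral)
  moreover have "real (card ?U) ^ (card ?U - 1) / real (card ?U) \<le> real (card ?F)" by (rule card_forests_ge[OF U])
  then have "2 ^ (k * (card V - k)) * (real (card V - k) ^ (card V - k - 1) / real (card V - k)) \<le> 2 ^ (k * (card V - k)) * real (card ?F)"
    unfolding cU by (intro mult_left_mono) auto
  ultimately show ?thesis by (simp add: mult.commute)
qed

subsection \<open>Clique and chromatic numbers of good graphs\<close>

lemma finite_cliques: "finite (verts G) \<Longrightarrow> finite {card C | C. is_clique G C}"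
  by (rule finite_subset[of _ "card ` Pow (verts G)"]) (auto simp: is_clique_def)

lemma clique_card_le:
  assumes "finite (verts G)" "is_clique G C"
  shows "card C \<le> clique_number G"
  unfolding clique_number_def by (rule Max_ge[OF finite_cliques[OF assms(1)]]) (use assms in blast)

lemma clique_number_attained:
  assumes "finite (verts G)"
  obtains C where "is_clique G C" "card C = clique_number G"
proof -
  have "is_clique G {}" by (simp add: is_clique_def)
  then have "clique_number G \<in> {card C | C. is_clique G C}"
    unfolding clique_number_def by (intro Max_in finite_cliques assms) auto
  then show thesis using that by auto
qed

lemma chromatic_number_le: "proper_colouring G q f \<Longrightarrow> chromatic_number G \<le> q"
  unfolding chromatic_number_def by (rule Least_le) blast

lemma card_colouring:
  assumes "finite (verts G)" "two_sets (edges G)"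
  obtains f where "proper_colouring G (card (verts G)) f"
proof -
  obtain f where f: "bij_betw f (verts G) {0..<card (verts G)}"
    using ex_bij_betw_finite_nat[OF assms(1)] by blast
  have "proper_colouring G (card (verts G)) f"
    unfolding proper_colouring_def
  proof (intro conjI ballI impI)
    fix v assume "v \<in> verts G"
    then show "f v < card (verts G)" using bij_betwE[OF f] by auto
  next
    fix u v assume "u \<in> verts G" "v \<in> verts G" "{u, v} \<in> edges G"
    then show "f u \<noteq> f v" using bij_betw_imp_inj_on[OF f] two_setsD[OF assms(2)] by (auto simp: inj_on_def)
  qed
  then show thesis by (rule that)
qed

lemma chromatic_number_attained:
  assumes "finite (verts G)" "two_sets (edges G)"
  obtains f where "proper_colouring G (chromatic_number G) f"
proof -
  obtain f where "proper_colouring G (card (verts G)) f" using card_colouring[OF assms] .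
  then have "\<exists>f. proper_colouring G (chromatic_number G) f"
    unfolding chromatic_number_def by (intro LeastI[of "\<lambda>q. \<exists>f. proper_colouring G q f"]) blast
  then show thesis using that by blast
qed

lemma clique_number_le_chromatic_number:
  assumes G: "finite (verts G)" "two_sets (edges G)"
  shows "clique_number G \<le> chromatic_number G"
proof -
  obtain C where C: "is_clique G C" "card C = clique_number G" using clique_number_attained[OF G(1)] .
  obtain f where f: "proper_colouring G (chromatic_number G) f" using chromatic_number_attained[OF G] .
  have "inj_on f C"
  proof (rule inj_onI, rule ccontr)
    fix u v assume uv: "u \<in> C" "v \<in> C" "f u = f v" "u \<noteq> v"
    then have "{u, v} \<in> edges G" "u \<in> verts G" "v \<in> verts G" using C(1) by (auto simp: is_clique_def)
    then show False using f uv(3) unfolding proper_colouring_def by blast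
  qed
  moreover have "f ` C \<subseteq> {..<chromatic_number G}" using f C(1) by (auto simp: proper_colouring_def is_clique_def)
  ultimately have "card C \<le> card {..<chromatic_number G}" by (intro card_inj_on_le[of f]) auto
  then show ?thesis using C(2) by simp
qed

lemma clique_number_pos:
  assumes "finite (verts G)" "verts G \<noteq> {}"
  shows "1 \<le> clique_number G"
proof -
  obtain v where "v \<in> verts G" using assms by blast
  then have "is_clique G {v}" by (simp add: is_clique_def)
  then show ?thesis using clique_card_le[OF assms(1)] by fastforce
qed

lemma chromatic_number_le_card:
  assumes "finite (verts G)" "two_sets (edges G)"
  shows "chromatic_number G \<le> card (verts G)"
  using card_colouring[OF assms] chromatic_number_le by metis

section \<open>Invariance under relabelling\<close>

definition pair_sets :: "'a set \<Rightarrow> 'a set set set" where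
  "pair_sets B = {Q. two_sets Q \<and> \<Union>Q \<subseteq> B}"

lemma finite_pair_sets: "finite B \<Longrightarrow> finite (pair_sets B)"
  unfolding pair_sets_def using finite_edge_sets[of B "\<lambda>_. True"] by simp

text \<open>One inequality for each number suffices; the reverse ones follow by applying these to
  the inverse bijection.\<close>

lemma isomorphic_numbers_aux:
  assumes h: "bij_betw h A B" and A: "finite A" and Q: "Q \<in> pair_sets A"
  shows "clique_number (A, Q) \<le> clique_number (B, (`) h ` Q)"
    and "chromatic_number (A, Q) \<le> chromatic_number (B, (`) h ` Q)"
    and "(`) h ` Q \<in> pair_sets B"
proof -
  have B: "finite B" and inj: "inj_on h A" and im: "h ` A = B" using h A by (auto simp: bij_betw_def)
  have card2: "card (h ` e) = 2" if "e \<in> Q" for e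
  proof -
    have "e \<subseteq> A" "card e = 2" using that Q by (auto simp: pair_sets_def two_sets_def)
    then show ?thesis using inj by (metis card_image inj_on_subset)
  qed
  then have "two_sets ((`) h ` Q)" unfolding two_sets_def by blast
  moreover have "\<Union>((`) h ` Q) \<subseteq> B" using Q unfolding im[symmetric] pair_sets_def by blast
  ultimately show m: "(`) h ` Q \<in> pair_sets B" by (simp add: pair_sets_def)
  obtain C where C: "is_clique (A, Q) C" "card C = clique_number (A, Q)"
    using clique_number_attained[of "(A, Q)"] A by auto
  have "is_clique (B, (`) h ` Q) (h ` C)"
    unfolding is_clique_def
  proof (intro conjI ballI impI)
    show "h ` C \<subseteq> verts (B, (`) h ` Q)" using C(1) im by (auto simp: is_clique_def)
    fix u v assume "u \<in> h ` C" "v \<in> h ` C" "u \<noteq> v"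
    then obtain x y where "u = h x" "v = h y" "x \<in> C" "y \<in> C" "x \<noteq> y" by auto
    then have xy: "{x, y} \<in> Q" "{u, v} = h ` {x, y}" using C(1) by (auto simp: is_clique_def)
    have "h ` {x, y} \<in> (`) h ` Q" by (rule imageI[OF xy(1)])
    then show "{u, v} \<in> edges (B, (`) h ` Q)" unfolding xy(2) by simp
  qed
  moreover have "card (h ` C) = card C" using C(1) inj by (intro card_image) (auto simp: is_clique_def inj_on_def)
  ultimately show "clique_number (A, Q) \<le> clique_number (B, (`) h ` Q)"
    using clique_card_le[of "(B, (`) h ` Q)" "h ` C"] B C(2) by simp
  obtain f where f: "proper_colouring (B, (`) h ` Q) (chromatic_number (B, (`) h ` Q)) f"
    using chromatic_number_attained[of "(B, (`) h ` Q)"] B m by (auto simp: pair_sets_def)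
  have "proper_colouring (A, Q) (chromatic_number (B, (`) h ` Q)) (f \<circ> h)"
    unfolding proper_colouring_def
  proof (intro conjI ballI impI)
    fix v assume "v \<in> verts (A, Q)"
    then show "(f \<circ> h) v < chromatic_number (B, (`) h ` Q)" using f im by (auto simp: proper_colouring_def)
  next
    fix u v assume uv: "u \<in> verts (A, Q)" "v \<in> verts (A, Q)" "{u, v} \<in> edges (A, Q)"
    then have "h ` {u, v} \<in> (`) h ` Q" by (intro imageI) simp
    then have "{h u, h v} \<in> (`) h ` Q" by simp
    moreover have "h u \<in> B" "h v \<in> B" using uv im by auto
    ultimately show "(f \<circ> h) u \<noteq> (f \<circ> h) v" using f unfolding proper_colouring_def by simp
  qed
  then show "chromatic_number (A, Q) \<le> chromatic_number (B, (`) h ` Q)" by (rule chromatic_number_le)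
qed

lemma isomorphic_numbers:
  assumes h: "bij_betw h A B" and A: "finite A" and Q: "Q \<in> pair_sets A"
  shows "clique_number (B, (`) h ` Q) = clique_number (A, Q)"
    and "chromatic_number (B, (`) h ` Q) = chromatic_number (A, Q)"
proof -
  let ?h = "inv_into A h" and ?Q = "(`) h ` Q"
  have inv: "bij_betw ?h B A" using h by (rule bij_betw_inv_into)
  have B: "finite B" using h A bij_betw_finite by blast
  have "?h ` h ` e = e" if "e \<in> Q" for e
    using that Q h by (auto simp: pair_sets_def bij_betw_def intro!: inv_into_image_cancel)
  then have "(`) ?h ` ?Q = Q" by (simp add: image_image)
  then show "clique_number (B, ?Q) = clique_number (A, Q)" "chromatic_number (B, ?Q) = chromatic_number (A, Q)"
    using isomorphic_numbers_aux[OF h A Q] isomorphic_numbers_aux[OF inv B, of ?Q] by auto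
qed

text \<open>This moves the random graph from a varying blocker to one fixed vertex set of size
  \<open>k\<close>.\<close>

lemma card_pair_sets_isomorphic:
  assumes B: "finite B" "card B = card A" and A: "finite A"
  shows "card {Q \<in> pair_sets B. P (clique_number (B, Q)) (chromatic_number (B, Q))} =
    card {Q \<in> pair_sets A. P (clique_number (A, Q)) (chromatic_number (A, Q))}"
proof -
  have le: "card {Q \<in> pair_sets A. P (clique_number (A, Q)) (chromatic_number (A, Q))} \<le>
      card {Q \<in> pair_sets B. P (clique_number (B, Q)) (chromatic_number (B, Q))}"
    if AB: "finite A" "finite B" "card A = card B" for A :: "'c set" and B :: "'d set"
  proof -
    obtain h where h: "bij_betw h A B" using finite_same_card_bij[OF AB] by blast
    let ?X = "{Q \<in> pair_sets A. P (clique_number (A, Q)) (chromatic_number (A, Q))}"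
    have "inj_on ((`) ((`) h)) ?X"
    proof (rule inj_on_subset)
      have "inj_on ((`) h) (Pow A)" using h by (simp add: inj_on_image_Pow bij_betw_def)
      then show "inj_on ((`) ((`) h)) (Pow (Pow A))" by (rule inj_on_image_Pow)
    qed (auto simp: pair_sets_def)
    moreover have "(`) ((`) h) ` ?X \<subseteq> {Q \<in> pair_sets B. P (clique_number (B, Q)) (chromatic_number (B, Q))}"
      using isomorphic_numbers[OF h AB(1)] isomorphic_numbers_aux(3)[OF h AB(1)] by auto
    ultimately show ?thesis using finite_pair_sets[OF AB(2)] by (intro card_inj_on_le) auto
  qed
  show ?thesis by (rule antisym) (use le[of A B] le[of B A] assms in auto)
qed

lemma good_blocker_edge:
  assumes "good_blocker k E V B" "two_sets E"
  obtains u w where "u \<in> V - B" "w \<in> V - B" "{u, w} \<in> E" "u \<noteq> w" "\<And>b. b \<in> B \<Longrightarrow> {b, u} \<in> E \<and> {b, w} \<in> E"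
proof -
  obtain \<M> where M: "\<M> \<subseteq> edges_in E (V - B)" "card \<M> = Suc k" "\<And>e u b. e \<in> \<M> \<Longrightarrow> u \<in> e \<Longrightarrow> b \<in> B \<Longrightarrow> {b, u} \<in> E"
    using assms(1) by (auto simp: good_blocker_def)
  then obtain e where e: "e \<in> \<M>" by fastforce
  then have eE: "e \<in> E" "e \<subseteq> V - B" using M(1) by (auto simp: edges_in_def)
  then obtain u w where uw: "e = {u, w}" "u \<noteq> w" using assms(2) by (metis two_setsE)
  show thesis by (rule that[of u w]) (use uw eE M(3)[OF e] in auto)
qed

text \<open>A clique has at most two vertices outside the blocker, since a forest has no triangle.
  Conversely, the ends of an edge joined to all of \<open>B\<close> extend any clique of
  \<open>B\<close>.\<close>

lemma good_clique_number:
  assumes g: "good_blocker k E V B" and E: "two_sets E" and V: "finite V"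
  shows "clique_number (V, E) = clique_number (B, edges_in E B) + 2"
proof -
  have BV: "B \<subseteq> V" and F: "forest E (V - B)" using g by (auto simp: good_blocker_def)
  have fB: "finite B" using BV V finite_subset by blast
  obtain u w where uw: "u \<in> V - B" "w \<in> V - B" "{u, w} \<in> E" "u \<noteq> w" "\<And>b. b \<in> B \<Longrightarrow> {b, u} \<in> E \<and> {b, w} \<in> E"
    using good_blocker_edge[OF g E] by metis
  show ?thesis
  proof (rule antisym)
    obtain C where C: "is_clique (V, E) C" "card C = clique_number (V, E)"
      using clique_number_attained[of "(V, E)"] V by auto
    have CV: "C \<subseteq> V" and CE: "\<And>x y. x \<in> C \<Longrightarrow> y \<in> C \<Longrightarrow> x \<noteq> y \<Longrightarrow> {x, y} \<in> E"
      using C(1) by (auto simp: is_clique_def)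
    have fC: "finite C" using CV V finite_subset by blast
    have "is_clique (B, edges_in E B) (C \<inter> B)" using CE by (auto simp: is_clique_def)
    then have 1: "card (C \<inter> B) \<le> clique_number (B, edges_in E B)"
      using clique_card_le[of "(B, edges_in E B)"] fB by simp
    have "card (C - B) \<le> 2"
    proof (rule ccontr)
      assume "\<not> card (C - B) \<le> 2"
      then have "3 \<le> card (C - B)" by simp
      then obtain T where T: "T \<subseteq> C - B" "card T = 3" by (meson obtain_subset_with_card_n)
      then obtain a b c where abc: "T = {a, b, c}" "a \<noteq> b" "b \<noteq> c" "a \<noteq> c" by (auto simp: card_3_iff)
      then have "cyclic E {a, b, c}" using T(1) CE by (intro triangle_cyclic[OF E]) auto
      moreover have "{a, b, c} \<subseteq> V - B" using T(1) abc(1) CV by auto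
      ultimately show False using F unfolding forest_def by blast
    qed
    then show "clique_number (V, E) \<le> clique_number (B, edges_in E B) + 2"
      using 1 C(2) card_Int_Diff[OF fC, of B] by linarith
  next
    obtain C where C: "is_clique (B, edges_in E B) C" "card C = clique_number (B, edges_in E B)"
      using clique_number_attained[of "(B, edges_in E B)"] fB by auto
    have CB: "C \<subseteq> B" and CE: "\<And>x y. x \<in> C \<Longrightarrow> y \<in> C \<Longrightarrow> x \<noteq> y \<Longrightarrow> {x, y} \<in> E"
      using C(1) by (auto simp: is_clique_def)
    have "{x, y} \<in> E" if "x \<in> insert u (insert w C)" "y \<in> insert u (insert w C)" "x \<noteq> y" for x y
      using that CE uw(3) uw(5)[of x] uw(5)[of y] CB by (auto simp: insert_commute)
    then have "is_clique (V, E) (insert u (insert w C))"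
      using CB BV uw(1,2) by (auto simp: is_clique_def)
    then have "card (insert u (insert w C)) \<le> clique_number (V, E)"
      using clique_card_le[of "(V, E)"] V by simp
    moreover have "u \<notin> insert w C" "w \<notin> C" "finite C" using uw CB fB finite_subset by auto
    ultimately show "clique_number (B, edges_in E B) + 2 \<le> clique_number (V, E)" using C(2) by simp
  qed
qed

text \<open>Two fresh colours suffice for the forest. Conversely, the ends of an edge joined to all
  of \<open>B\<close> use two different colours that cannot occur on \<open>B\<close>, so
  \<open>B\<close> is coloured by the remaining ones, renumbered by \<open>h\<close>.\<close>

lemma good_chromatic_number:
  assumes g: "good_blocker k E V B" and E: "two_sets E" and V: "finite V"
  shows "chromatic_number (V, E) = chromatic_number (B, edges_in E B) + 2"
proof -
  have BV: "B \<subseteq> V" and F: "forest E (V - B)" using g by (auto simp: good_blocker_def)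
  have fB: "finite B" using BV V finite_subset by blast
  have EB: "two_sets (edges_in E B)" using E by (auto simp: two_sets_def edges_in_def)
  obtain u w where uw: "u \<in> V - B" "w \<in> V - B" "{u, w} \<in> E" "u \<noteq> w" "\<And>b. b \<in> B \<Longrightarrow> {b, u} \<in> E \<and> {b, w} \<in> E"
    using good_blocker_edge[OF g E] by metis
  let ?q = "chromatic_number (B, edges_in E B)" and ?p = "chromatic_number (V, E)"
  show ?thesis
  proof (rule antisym)
    obtain f where f: "proper_colouring (B, edges_in E B) ?q f"
      using chromatic_number_attained[of "(B, edges_in E B)"] fB EB by auto
    obtain c :: "'a \<Rightarrow> nat" where c: "\<And>u. u \<in> V - B \<Longrightarrow> c u < 2"
      "\<And>u v. u \<in> V - B \<Longrightarrow> v \<in> V - B \<Longrightarrow> {u, v} \<in> E \<Longrightarrow> c u \<noteq> c v"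
      using forest_two_colouring[OF E _ F] V by (metis finite_Diff)
    have fq: "f v < ?q" if "v \<in> B" for v using f that by (auto simp: proper_colouring_def)
    have ff: "f x \<noteq> f y" if "x \<in> B" "y \<in> B" "{x, y} \<in> E" for x y using f that by (auto simp: proper_colouring_def)
    let ?f = "\<lambda>v. if v \<in> B then f v else ?q + c v"
    have "proper_colouring (V, E) (?q + 2) ?f"
      unfolding proper_colouring_def
    proof (intro conjI ballI impI)
      fix v assume "v \<in> verts (V, E)"
      then show "?f v < ?q + 2" using fq[of v] c(1)[of v] by auto
    next
      fix x y assume "x \<in> verts (V, E)" "y \<in> verts (V, E)" "{x, y} \<in> edges (V, E)"
      then show "?f x \<noteq> ?f y" using fq[of x] fq[of y] ff[of x y] c(2)[of x y] by auto
    qed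
    then show "?p \<le> ?q + 2" by (rule chromatic_number_le)
  next
    obtain f where "proper_colouring (V, E) ?p f"
      using chromatic_number_attained[of "(V, E)"] V E by auto
    then have fp: "\<And>v. v \<in> V \<Longrightarrow> f v < ?p" and ff: "\<And>x y. x \<in> V \<Longrightarrow> y \<in> V \<Longrightarrow> {x, y} \<in> E \<Longrightarrow> f x \<noteq> f y"
      by (auto simp: proper_colouring_def)
    let ?D = "{..<?p} - {f u, f w}"
    have fuw: "f u \<noteq> f w" "f u < ?p" "f w < ?p" using ff[of u w] fp uw by auto
    then have "card {f u, f w} = 2" "{f u, f w} \<subseteq> {..<?p}" by auto
    then have cD: "card ?D = ?p - 2" "2 \<le> ?p"
      using card_mono[of "{..<?p}" "{f u, f w}"] by (auto simp: card_Diff_subset)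
    obtain h where h: "bij_betw h ?D {0..<?p - 2}"
      using ex_bij_betw_finite_nat[of ?D] cD(1) by auto
    have fD: "f b \<in> ?D" if "b \<in> B" for b
      using that fp[of b] ff[of b u] ff[of b w] uw BV by auto
    have "proper_colouring (B, edges_in E B) (?p - 2) (h \<circ> f)"
      unfolding proper_colouring_def
    proof (intro conjI ballI impI)
      fix v assume "v \<in> verts (B, edges_in E B)"
      then show "(h \<circ> f) v < ?p - 2" using fD[of v] bij_betwE[OF h] by auto
    next
      fix x y assume "x \<in> verts (B, edges_in E B)" "y \<in> verts (B, edges_in E B)" "{x, y} \<in> edges (B, edges_in E B)"
      then have "f x \<noteq> f y" "f x \<in> ?D" "f y \<in> ?D" using ff[of x y] fD BV by auto
      then show "(h \<circ> f) x \<noteq> (h \<circ> f) y" using bij_betw_imp_inj_on[OF h] unfolding inj_on_def comp_def by blast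
    qed
    then have "?q \<le> ?p - 2" by (rule chromatic_number_le)
    then show "?q + 2 \<le> ?p" using cD(2) by simp
  qed
qed

text \<open>Let \<open>b\<close> lie in \<open>B\<close> but not in \<open>B'\<close>. Each of the
  \<open>k + 1\<close> matching edges forms a triangle with \<open>b\<close>, which
  \<open>B'\<close> must meet in the edge itself; the edges being disjoint, \<open>B'\<close> would
  have more than \<open>k\<close> vertices.\<close>

lemma good_blocker_unique:
  assumes g: "good_blocker k E V B" "good_blocker k E V B'" and E: "two_sets E" and V: "finite V"
  shows "B = B'"
proof -
  have B': "B' \<subseteq> V" "card B' = k" "forest E (V - B')" using g(2) by (auto simp: good_blocker_def)
  have fB': "finite B'" using B'(1) V finite_subset by blast
  obtain \<M> where M: "\<M> \<subseteq> edges_in E (V - B)" "card \<M> = Suc k" "disjoint \<M>"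
    "\<And>e u b. e \<in> \<M> \<Longrightarrow> u \<in> e \<Longrightarrow> b \<in> B \<Longrightarrow> {b, u} \<in> E" and BV: "B \<subseteq> V" "card B = k"
    using g(1) by (auto simp: good_blocker_def)
  have "B \<subseteq> B'"
  proof (rule ccontr)
    assume "\<not> B \<subseteq> B'"
    then obtain b where b: "b \<in> B" "b \<notin> B'" by blast
    have "\<exists>x. x \<in> e \<inter> B'" if e: "e \<in> \<M>" for e
    proof (rule ccontr)
      assume "\<nexists>x. x \<in> e \<inter> B'"
      moreover have "e \<in> E" "e \<subseteq> V" using e M(1) by (auto simp: edges_in_def)
      ultimately have "insert b e \<subseteq> V - B'" "cyclic E (insert b e)"
        using b BV full_edge_cyclic[OF E, of e b] M(4)[OF e] by auto
      then show False using B'(3) unfolding forest_def by blast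
    qed
    then obtain x where x: "\<And>e. e \<in> \<M> \<Longrightarrow> x e \<in> e \<inter> B'" by metis
    have "inj_on x \<M>"
    proof (rule inj_onI, rule ccontr)
      fix e e' assume "e \<in> \<M>" "e' \<in> \<M>" "x e = x e'" "e \<noteq> e'"
      then show False using M(3) x[of e] x[of e'] unfolding pairwise_def disjnt_def by auto
    qed
    then have "card \<M> \<le> card B'" using x fB' by (intro card_inj_on_le[of x]) auto
    then show False using M(2) B'(2) by simp
  qed
  then show ?thesis using card_subset_eq[OF fB'] B'(2) BV(2) by simp
qed

lemma good_blocker_cong:
  assumes g: "good_blocker k E V B" and E: "two_sets E" "two_sets E'"
    and eq: "{e \<in> E. \<not> e \<subseteq> B} = {e \<in> E'. \<not> e \<subseteq> B}"
  shows "good_blocker k E' V B"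
proof -
  have iff: "e \<in> E \<longleftrightarrow> e \<in> E'" if "\<not> e \<subseteq> B" for e using eq that by blast
  have "edges_in E W = edges_in E' W" if "W \<subseteq> V - B" for W
  proof -
    have "\<not> e \<subseteq> B" if "e \<in> E \<union> E'" "e \<subseteq> W" for e
    proof
      assume "e \<subseteq> B"
      then have "e = {}" using that \<open>W \<subseteq> V - B\<close> by auto
      then show False using that(1) E by (auto simp: two_sets_def)
    qed
    then show ?thesis using iff unfolding edges_in_def by blast
  qed
  note ein = this
  have F: "forest E' (V - B) \<longleftrightarrow> forest E (V - B)"
    unfolding forest_def cyclic_def using ein by (metis (no_types, lifting))
  obtain \<M> where M: "\<M> \<subseteq> edges_in E (V - B)" "card \<M> = Suc k" "disjoint \<M>"
    "\<forall>e\<in>\<M>. \<forall>u\<in>e. \<forall>b\<in>B. {b, u} \<in> E" and B: "B \<subseteq> V" "card B = k" "forest E (V - B)"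
    using g by (auto simp: good_blocker_def)
  have "{b, u} \<in> E'" if "e \<in> \<M>" "u \<in> e" "b \<in> B" for e u b
  proof -
    have "u \<notin> B" using that M(1) by (auto simp: edges_in_def)
    then show ?thesis using iff[of "{b, u}"] M(4) that by blast
  qed
  moreover have "\<M> \<subseteq> edges_in E' (V - B)" using M(1) ein[of "V - B"] by simp
  ultimately show ?thesis using M(2,3) B F unfolding good_blocker_def by blast
qed

definition good_edges :: "nat \<Rightarrow> 'a set \<Rightarrow> 'a set set set" where
  "good_edges k V = {E. two_sets E \<and> \<Union>E \<subseteq> V \<and> (\<exists>B. good_blocker k E V B)}"

lemma good_edges_subset:
  assumes "finite V"
  shows "good_edges k V \<subseteq> Ex_edges k V"
proof
  fix E assume "E \<in> good_edges k V"
  then obtain B where E: "two_sets E" "\<Union>E \<subseteq> V" and B: "good_blocker k E V B" by (auto simp: good_edges_def)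
  then have "forest E (V - B)" "finite B" "card B < Suc k"
    using assms finite_subset by (auto simp: good_blocker_def)
  then have "\<not> packs E V (Suc k)" by (rule blocker_not_packs)
  then show "E \<in> Ex_edges k V" using E by (simp add: Ex_edges_def)
qed

text \<open>Splitting off the edges inside the blocker exhibits the good graphs as a disjoint union of
  products in which the graph on the blocker is arbitrary.\<close>

lemma card_good_edges:
  fixes V :: "'a set" and A :: "'b set"
  assumes V: "finite V" and A: "finite A" "card A = k"
  shows "\<exists>c. \<forall>P. card {E \<in> good_edges k V. P (clique_number (V, E)) (chromatic_number (V, E))} =
    c * card {Q \<in> pair_sets A. P (clique_number (A, Q) + 2) (chromatic_number (A, Q) + 2)}"
proof -
  \<comment> \<open>\<open>Out B\<close> collects the parts of good graphs outside the blocker. The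
    factor \<open>c\<close> is the number of all such parts, and it does not depend on
    \<open>P\<close>; so it cancels when the count for an event is divided by the count of all good
    graphs.\<close>
  define Out where "Out = (\<lambda>B. {E. two_sets E \<and> \<Union>E \<subseteq> V \<and> good_blocker k E V B \<and> edges_in E B = {}})"
  define \<B> where "\<B> = {B. B \<subseteq> V \<and> card B = k}"
  have f\<B>: "finite \<B>" using V by (simp add: \<B>_def)
  have fOut: "finite (Out B)" for B unfolding Out_def by (rule finite_edge_sets[OF V])
  have "card {E \<in> good_edges k V. P (clique_number (V, E)) (chromatic_number (V, E))} =
    (\<Sum>B\<in>\<B>. card (Out B)) * card {Q \<in> pair_sets A. P (clique_number (A, Q) + 2) (chromatic_number (A, Q) + 2)}"
    (is "card ?X = _ * ?N") for P
  proof -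
    define G where "G = (\<lambda>B. {E. two_sets E \<and> \<Union>E \<subseteq> V \<and> (good_blocker k E V B \<and> P (clique_number (V, E)) (chromatic_number (V, E)))})"
    have fG: "finite (G B)" for B unfolding G_def by (rule finite_edge_sets[OF V])
    have "?X = (\<Union>B\<in>\<B>. G B)" by (auto simp: good_edges_def G_def \<B>_def good_blocker_def)
    moreover have "G B \<inter> G B' = {}" if "B \<noteq> B'" for B B'
      using that good_blocker_unique[OF _ _ _ V] by (auto simp: G_def)
    ultimately have "card ?X = (\<Sum>B\<in>\<B>. card (G B))" using f\<B> fG by (simp add: card_UN_disjoint)
    also have "\<dots> = (\<Sum>B\<in>\<B>. card (Out B) * ?N)"
    proof (rule sum.cong)
      fix B assume "B \<in> \<B>"
      then have B: "B \<subseteq> V" "card B = k" "finite B" using V finite_subset by (auto simp: \<B>_def)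
      let ?Q = "{Q \<in> pair_sets B. P (clique_number (B, Q) + 2) (chromatic_number (B, Q) + 2)}"
      have split: "edges_in (E \<union> Q) B = Q" "{e \<in> E \<union> Q. \<not> e \<subseteq> B} = E"
        if "E \<in> Out B" "Q \<in> pair_sets B" for E Q
        using that by (auto simp: Out_def pair_sets_def edges_in_def)
      have "bij_betw (\<lambda>(E, Q). E \<union> Q) (Out B \<times> ?Q) (G B)"
        unfolding bij_betw_def
      proof (intro conjI equalityI)
        show "inj_on (\<lambda>(E, Q). E \<union> Q) (Out B \<times> ?Q)"
        proof (rule inj_onI)
          fix x y assume x: "x \<in> Out B \<times> ?Q" and y: "y \<in> Out B \<times> ?Q"
            and eq: "(\<lambda>(E, Q). E \<union> Q) x = (\<lambda>(E, Q). E \<union> Q) y"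
          obtain E Q where x': "x = (E, Q)" by (cases x) auto
          obtain E' Q' where y': "y = (E', Q')" by (cases y) auto
          have "E \<in> Out B" "Q \<in> pair_sets B" "E' \<in> Out B" "Q' \<in> pair_sets B" "E \<union> Q = E' \<union> Q'"
            using x y eq unfolding x' y' by simp_all
          then show "x = y" unfolding x' y' using split by metis
        qed
        show "(\<lambda>(E, Q). E \<union> Q) ` (Out B \<times> ?Q) \<subseteq> G B"
        proof (rule image_subsetI)
          fix x assume x: "x \<in> Out B \<times> ?Q"
          obtain E Q where x': "x = (E, Q)" by (cases x) auto
          have E: "E \<in> Out B" and Q: "Q \<in> pair_sets B" "P (clique_number (B, Q) + 2) (chromatic_number (B, Q) + 2)"
            using x unfolding x' by simp_all
          have two: "two_sets (E \<union> Q)" and sub: "\<Union>(E \<union> Q) \<subseteq> V"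
            using E Q B(1) by (auto simp: Out_def pair_sets_def two_sets_def)
          have E': "good_blocker k E V B" "two_sets E" using E by (auto simp: Out_def)
          have "{e \<in> E. \<not> e \<subseteq> B} = {e \<in> E \<union> Q. \<not> e \<subseteq> B}"
            using split(2)[OF E Q(1)] by blast
          then have g: "good_blocker k (E \<union> Q) V B" by (rule good_blocker_cong[OF E' two])
          show "(\<lambda>(E, Q). E \<union> Q) x \<in> G B"
            unfolding x' G_def
            using two sub g Q(2) good_clique_number[OF g two V] good_chromatic_number[OF g two V] split(1)[OF E Q(1)]
            by simp
        qed
        show "G B \<subseteq> (\<lambda>(E, Q). E \<union> Q) ` (Out B \<times> ?Q)"
        proof
          fix F assume "F \<in> G B"
          then have F: "two_sets F" "\<Union>F \<subseteq> V" "good_blocker k F V B" "P (clique_number (V, F)) (chromatic_number (V, F))"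
            by (auto simp: G_def)
          let ?E = "{e \<in> F. \<not> e \<subseteq> B}" and ?R = "edges_in F B"
          have two: "two_sets ?E" using F(1) by (auto simp: two_sets_def)
          have "good_blocker k ?E V B" by (rule good_blocker_cong[OF F(3,1) two]) auto
          then have "?E \<in> Out B" using two F(2) by (auto simp: Out_def edges_in_def)
          moreover have "?R \<in> ?Q"
            using F good_clique_number[OF F(3,1) V] good_chromatic_number[OF F(3,1) V]
            by (auto simp: pair_sets_def edges_in_def two_sets_def)
          moreover have "F = ?E \<union> ?R" by (auto simp: edges_in_def)
          ultimately show "F \<in> (\<lambda>(E, Q). E \<union> Q) ` (Out B \<times> ?Q)" by (intro image_eqI[of _ _ "(?E, ?R)"]) auto
        qed
      qed
      then have "card (G B) = card (Out B \<times> ?Q)" by (simp add: bij_betw_same_card)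
      also have "\<dots> = card (Out B) * card ?Q" by (rule card_cartesian_product)
      also have "card ?Q = ?N"
        using card_pair_sets_isomorphic[OF B(3) _ A(1), of "\<lambda>a b. P (a + 2) (b + 2)"] B(2) A(2) by simp
      finally show "card (G B) = card (Out B) * ?N" .
    qed simp
    finally show ?thesis by (simp add: sum_distrib_right)
  qed
  then show ?thesis by blast
qed

subsection \<open>Good graphs prevail\<close>

lemma finite_bad_codes: "finite M \<Longrightarrow> finite S \<Longrightarrow> finite (bad_codes k n M S z l d)"
  by (rule finite_subset[of _ "parent_maps n M \<times> (M \<rightarrow>\<^sub>E Pow S)"])
    (auto simp: bad_codes_def nearly_independent_def long_paths_def intro!: finite_PiE)

lemma bad_codes_subset: "bad_codes k n M S z l d \<subseteq> parent_maps n M \<times> (M \<rightarrow>\<^sub>E Pow S)"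
  by (auto simp: bad_codes_def nearly_independent_def long_paths_def)

text \<open>\<open>L\<close> is a common bound for four exponentially small quantities: a missing
  hub (\<open>h0\<close>), few vertices joined to all hubs (\<open>h1\<close>), a large independent
  set (\<open>h2\<close>) and long paths (\<open>h3\<close>). The factor 3 allows two terms for
  nearly independent codes and one for long paths.\<close>

lemma sum_weight_bad_codes_le:
  assumes M: "finite M" "card M \<le> n" and S: "finite S" "card S \<le> k" and k: "1 \<le> k"
    and C: "1 \<le> C" and x: "x = real n + C" and t: "0 < t" "t \<le> 1" and za: "0 \<le> z" "z \<le> a"
    and h0: "(1 / 2) ^ n \<le> L"
    and h1: "2 powr a * (2 ^ k - 1 / 2) ^ n \<le> 2 ^ (k * n) * L"
    and h2: "((1 + t) ^ n / t powr z) * exp (- ((a - z)\<^sup>2 / x)) \<le> L"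
    and h3: "exp (- (real (l * (l - 1)) / (2 * x))) \<le> L"
  shows "(\<Sum>y\<in>bad_codes k n M S z l d. weight C M (fst y)) \<le> 3 * (2 ^ (k * n) * L * x ^ (Suc (d + d) + n))"
proof -
  let ?m = "card M" and ?B = "2 ^ (k * n) * L * x ^ (Suc (d + d) + n)"
  have x1: "1 \<le> x" "real ?m + C \<le> x" using x C M(2) by auto
  have xm: "x ^ ?m \<le> x ^ n" "x ^ n \<le> x ^ (Suc (d + d) + n)"
    by (rule power_increasing[OF M(2) x1(1)], rule power_increasing[OF le_add2 x1(1)])
  have "0 < (1 / 2 :: real) ^ n" by simp
  then have L: "0 < L" using h0 by linarith
  have km: "(2::real) ^ (k * ?m) \<le> 2 ^ (k * n)" using M(2) by (intro power_increasing) auto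
  show ?thesis
  proof (cases "card S < k")
    case True
    have "(\<Sum>y\<in>bad_codes k n M S z l d. weight C M (fst y)) \<le> 2 ^ (card S * ?m) * x ^ ?m"
      using True sum_weight_all_le[OF M(1) S(1) x1(2) C] by (simp add: bad_codes_def)
    also have "\<dots> \<le> 2 ^ ((k - 1) * n) * x ^ n"
      using True M(2) x1 xm by (intro mult_mono power_increasing mult_le_mono) auto
    also have "(2::real) ^ ((k - 1) * n) = 2 ^ (k * n) * (1 / 2) ^ n"
    proof -
      have "k * n = (k - 1) * n + n" using k by (simp add: algebra_simps)
      then show ?thesis by (simp add: power_add power_one_over)
    qed
    also have "2 ^ (k * n) * (1 / 2) ^ n * x ^ n \<le> ?B"
      using h0 x1 xm L by (intro mult_mono) auto
    finally have "(\<Sum>y\<in>bad_codes k n M S z l d. weight C M (fst y)) \<le> ?B" .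
    moreover have "0 \<le> ?B" using L x1 by simp
    ultimately show ?thesis by linarith
  next
    case False
    then have Sk: "card S = k" using S(2) by simp
    have "(\<Sum>y\<in>bad_codes k n M S z l d. weight C M (fst y)) \<le>
        (\<Sum>y\<in>nearly_independent n M S z. weight C M (fst y)) + (\<Sum>y\<in>long_paths n M S l d. weight C M (fst y))"
    proof -
      have fin: "finite (nearly_independent n M S z)" "finite (long_paths n M S l d)"
        using finite_bad_codes[OF M(1) S(1), of k n z l d] False by (auto simp: bad_codes_def)
      have "(\<Sum>y\<in>nearly_independent n M S z \<inter> long_paths n M S l d. weight C M (fst y)) \<ge> 0"
        using C by (intro sum_nonneg weight_nonneg) auto
      then show ?thesis using False sum.union_inter[OF fin, of "\<lambda>y. weight C M (fst y)"] by (simp add: bad_codes_def)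
    qed
    also have "(\<Sum>y\<in>nearly_independent n M S z. weight C M (fst y)) \<le> 2 * ?B"
    proof -
      have "(\<Sum>y\<in>nearly_independent n M S z. weight C M (fst y)) \<le> x ^ ?m *
        (2 powr a * (2 ^ k - 1 / 2) ^ ?m + 2 ^ (k * ?m) * ((1 + t) ^ ?m / t powr z) * exp (- ((a - z)\<^sup>2 / x)))"
        using sum_weight_nearly_independent_le[OF M(1) S(1) x1(2) C t za] unfolding Sk .
      also have "\<dots> \<le> x ^ n * (2 ^ (k * n) * L + 2 ^ (k * n) * L)"
      proof (rule mult_mono[OF xm(1) add_mono])
        have "(2::real) ^ 1 \<le> 2 ^ k" using k by (intro power_increasing) auto
        then have k1: "1 \<le> (2::real) ^ k - 1 / 2" by simp
        then have "2 powr a * (2 ^ k - 1 / 2) ^ ?m \<le> 2 powr a * (2 ^ k - 1 / 2) ^ n"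
          using M(2) by (intro mult_left_mono power_increasing) auto
        then show "2 powr a * (2 ^ k - 1 / 2) ^ ?m \<le> 2 ^ (k * n) * L" using h1 by linarith
        have "2 ^ (k * ?m) * ((1 + t) ^ ?m / t powr z) * exp (- ((a - z)\<^sup>2 / x)) =
            2 ^ (k * ?m) * (((1 + t) ^ ?m / t powr z) * exp (- ((a - z)\<^sup>2 / x)))" by simp
        also have "\<dots> \<le> 2 ^ (k * n) * (((1 + t) ^ n / t powr z) * exp (- ((a - z)\<^sup>2 / x)))"
          using t M(2) by (intro mult_mono km mult_right_mono divide_right_mono power_increasing) auto
        also have "\<dots> \<le> 2 ^ (k * n) * L" using h2 by (intro mult_left_mono) auto
        finally show "2 ^ (k * ?m) * ((1 + t) ^ ?m / t powr z) * exp (- ((a - z)\<^sup>2 / x)) \<le> 2 ^ (k * n) * L" .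
        show "0 \<le> 2 powr a * (2 ^ k - 1 / 2) ^ ?m + 2 ^ (k * ?m) * ((1 + t) ^ ?m / t powr z) * exp (- ((a - z)\<^sup>2 / x))"
          using k1 t by (intro add_nonneg_nonneg mult_nonneg_nonneg) auto
      qed (use x1 in auto)
      also have "\<dots> = 2 * (2 ^ (k * n) * L * x ^ n)" by simp
      also have "\<dots> \<le> 2 * ?B" using xm L by (intro mult_left_mono) auto
      finally show ?thesis .
    qed
    also have "(\<Sum>y\<in>long_paths n M S l d. weight C M (fst y)) \<le> ?B"
    proof -
      have "(\<Sum>y\<in>long_paths n M S l d. weight C M (fst y)) \<le> 2 ^ (k * ?m) *
          (x ^ (Suc (d + d)) * x ^ ?m * exp (- (real (l * (l - 1)) / (2 * x))))"
        using sum_weight_long_paths_le[OF M(1) S(1) x1(2) C] unfolding Sk .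
      also have "\<dots> \<le> 2 ^ (k * n) * (x ^ (Suc (d + d)) * x ^ n * L)"
        using x1 by (intro mult_mono km xm h3 order_refl) auto
      also have "\<dots> = ?B" by (simp add: power_add)
      finally show ?thesis .
    qed
    finally show ?thesis by linarith
  qed
qed

text \<open>In the exponent of \<open>x\<close>, \<open>k + r\<close> pays for the choice of
  \<open>S\<close> and \<open>R\<close>, and \<open>Suc (3 * r + 3 * r)\<close> is the loss from
  long paths with \<open>d = 3 * r\<close>.\<close>

lemma card_not_good_le:
  assumes k: "1 \<le> k"
    and cover: "\<And>(E :: nat set set) V n l z. two_sets E \<Longrightarrow> finite V \<Longrightarrow> \<Union>E \<subseteq> V \<Longrightarrow> \<not> packs E V (Suc k) \<Longrightarrow>
     \<forall>B. \<not> good_blocker k E V B \<Longrightarrow> card V \<le> n \<Longrightarrow> real (l + 2 * k) \<le> z \<Longrightarrow>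
     \<exists>S R. S \<subseteq> V \<and> R \<subseteq> V \<and> card S \<le> k \<and> card R \<le> r \<and>
       E \<in> assembled n (V - S - R) R (S \<union> R) (bad_codes k n (V - S - R) S z l (3 * r))"
    and C: "1 \<le> C" "\<And>a::nat. (1 + real a) ^ r \<le> C * (1 + \<epsilon>) ^ a" and \<epsilon>: "0 \<le> \<epsilon>"
    and x: "x = real n + C" and t: "0 < t" "t \<le> 1" and za: "0 \<le> z" "z \<le> a" and l: "real (l + 2 * k) \<le> z"
    and h: "(1 / 2) ^ n \<le> L" "2 powr a * (2 ^ k - 1 / 2) ^ n \<le> 2 ^ (k * n) * L"
      "((1 + t) ^ n / t powr z) * exp (- ((a - z)\<^sup>2 / x)) \<le> L"
      "exp (- (real (l * (l - 1)) / (2 * x))) \<le> L"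
  shows "real (card (Ex_edges k {1..n} - good_edges k {1..n})) \<le>
    3 * 2 ^ 2 ^ (k + r) * (2 ^ (k * n) * ((1 + \<epsilon>) ^ n * L) * x ^ (Suc (k + 7 * r) + n))"
proof -
  define V where "V = {1..n}"
  define A where "A = (\<lambda>(S, R). assembled n (V - S - R) R (S \<union> R) (bad_codes k n (V - S - R) S z l (3 * r)))"
  define I where "I = {S. S \<subseteq> V \<and> card S \<le> k} \<times> {R. R \<subseteq> V \<and> card R \<le> r}"
  have V: "finite V" "card V = n" by (auto simp: V_def)
  have fI: "finite I" using V by (auto simp: I_def)
  have x1: "1 \<le> x" "real (Suc n) \<le> x" using x C(1) by auto
  have "0 < (1 / 2 :: real) ^ n" by simp
  then have L: "0 < L" using h(1) by linarith
  let ?b = "2 ^ 2 ^ (k + r) * (1 + \<epsilon>) ^ n * (3 * (2 ^ (k * n) * L * x ^ (Suc (3 * r + 3 * r) + n)))"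
  have bound: "real (card (A i)) \<le> ?b" and fA: "finite (A i)" if i: "i \<in> I" for i
  proof -
    obtain S R where SR: "i = (S, R)" "S \<subseteq> V" "R \<subseteq> V" "card S \<le> k" "card R \<le> r" using i by (auto simp: I_def)
    have fin: "finite S" "finite R" using SR V finite_subset by auto
    let ?M = "V - S - R"
    have cM: "card ?M \<le> n" using card_mono[of V ?M] V by auto
    have fM: "finite ?M" using V by simp
    have cT: "card (S \<union> R) \<le> k + r" using card_Un_le[of S R] SR by linarith
    show "finite (A i)" unfolding A_def SR(1) prod.case
      using fin fM by (intro finite_assembled finite_bad_codes) auto
    have "real (card (A i)) \<le> 2 ^ 2 ^ (k + r) * (1 + \<epsilon>) ^ card ?M *
        (\<Sum>y\<in>bad_codes k n ?M S z l (3 * r). weight C ?M (fst y))"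
      unfolding A_def SR(1) prod.case
      by (rule card_assembled_weight[OF fM fin(2) _ bad_codes_subset fin(1) C(2) SR(5) \<epsilon> cT]) (use fin in auto)
    also have "\<dots> \<le> ?b"
    proof (intro mult_mono)
      show "(1 + \<epsilon>) ^ card ?M \<le> (1 + \<epsilon>) ^ n" using cM \<epsilon> by (intro power_increasing) auto
      show "(\<Sum>y\<in>bad_codes k n ?M S z l (3 * r). weight C ?M (fst y)) \<le>
          3 * (2 ^ (k * n) * L * x ^ (Suc (3 * r + 3 * r) + n))"
        by (rule sum_weight_bad_codes_le[OF fM cM fin(1) SR(4) k C(1) x t za h])
    qed (use \<epsilon> C(1) in \<open>auto intro!: sum_nonneg weight_nonneg\<close>)
    finally show "real (card (A i)) \<le> ?b" .
  qed
  have sub: "Ex_edges k V - good_edges k V \<subseteq> (\<Union>i\<in>I. A i)"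
  proof
    fix E assume "E \<in> Ex_edges k V - good_edges k V"
    then have E: "two_sets E" "\<Union>E \<subseteq> V" "\<not> packs E V (Suc k)" "\<forall>B. \<not> good_blocker k E V B"
      by (auto simp: Ex_edges_def good_edges_def)
    obtain S R where "S \<subseteq> V" "R \<subseteq> V" "card S \<le> k" "card R \<le> r" "E \<in> A (S, R)"
      using cover[OF E(1) V(1) E(2-4) eq_refl[OF V(2)] l] by (auto simp: A_def)
    then have "(S, R) \<in> I" "E \<in> A (S, R)" by (auto simp: I_def)
    then show "E \<in> (\<Union>i\<in>I. A i)" by blast
  qed
  have "card (Ex_edges k V - good_edges k V) \<le> card (\<Union>i\<in>I. A i)"
    using fI fA by (intro card_mono sub) auto
  also have "\<dots> \<le> (\<Sum>i\<in>I. card (A i))" by (rule card_UN_le[OF fI])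
  finally have "real (card (Ex_edges k V - good_edges k V)) \<le> (\<Sum>i\<in>I. real (card (A i)))"
    by (simp flip: of_nat_sum)
  also have "\<dots> \<le> (\<Sum>i\<in>I. ?b)" by (rule sum_mono) (rule bound)
  also have "\<dots> = real (card I) * ?b" by simp
  also have "\<dots> \<le> x ^ (k + r) * ?b"
  proof (intro mult_right_mono)
    have "card I \<le> Suc n ^ k * Suc n ^ r"
      unfolding I_def card_cartesian_product using card_small_subsets_le[OF V(1)] V(2) by (intro mult_le_mono) auto
    then have "card I \<le> Suc n ^ (k + r)" by (simp add: power_add)
    then have "real (card I) \<le> real (Suc n ^ (k + r))" by (rule of_nat_mono)
    also have "\<dots> \<le> x ^ (k + r)" using x1 by (simp only: of_nat_power) (intro power_mono, auto)
    finally show "real (card I) \<le> x ^ (k + r)" .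
  qed (use \<epsilon> L x1 in auto)
  also have "\<dots> = 3 * 2 ^ 2 ^ (k + r) * (2 ^ (k * n) * ((1 + \<epsilon>) ^ n * L) * x ^ (Suc (k + 7 * r) + n))"
  proof -
    have "Suc (k + 7 * r) + n = (k + r) + (Suc (3 * r + 3 * r) + n)" by simp
    then have "x ^ (Suc (k + 7 * r) + n) = x ^ (k + r) * x ^ (Suc (3 * r + 3 * r) + n)" by (metis power_add)
    then show ?thesis by (simp only: mult_ac)
  qed
  finally show ?thesis by (simp add: V_def)
qed

lemma power_times_exponential_tendsto_0:
  fixes \<rho> :: real
  assumes "0 < \<rho>" "\<rho> < 1"
  shows "(\<lambda>n. real n ^ d * \<rho> ^ n) \<longlonglongrightarrow> 0"
  using assms by real_asymp

lemma polynomial_le_exponential: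
  fixes \<epsilon> :: real
  assumes "0 < \<epsilon>"
  obtains C where "1 \<le> C" "\<And>a::nat. (1 + real a) ^ r \<le> C * (1 + \<epsilon>) ^ a"
proof -
  have "(\<lambda>a. (1 + real a) ^ r / (1 + \<epsilon>) ^ a) \<longlonglongrightarrow> 0"
    using assms by real_asymp
  then have "Bseq (\<lambda>a. (1 + real a) ^ r / (1 + \<epsilon>) ^ a)" by (intro convergent_imp_Bseq convergentI)
  then obtain K where K: "0 < K" "\<And>a. norm ((1 + real a) ^ r / (1 + \<epsilon>) ^ a) \<le> K" by (auto simp: Bseq_def)
  show thesis
  proof (rule that[of "max 1 K"])
    fix a :: nat
    have "(1 + real a) ^ r / (1 + \<epsilon>) ^ a \<le> K" using K(2)[of a] assms by simp
    then have "(1 + real a) ^ r \<le> K * (1 + \<epsilon>) ^ a" using assms by (simp add: divide_le_eq)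
    also have "\<dots> \<le> max 1 K * (1 + \<epsilon>) ^ a" using assms by (intro mult_right_mono) auto
    finally show "(1 + real a) ^ r \<le> max 1 K * (1 + \<epsilon>) ^ a" .
  qed simp
qed

text \<open>The lower bound is brought to the shape of the upper one. Passing from
  \<open>n - k\<close> to \<open>n + C\<close> in the base of an \<open>n\<close>-th power costs
  only a constant factor, because \<open>n \<le> 2 * (n - k)\<close>.\<close>

lemma card_Ex_edges_ge':
  assumes n: "2 * k < n" and C: "0 \<le> C"
  shows "2 ^ (k * n) * (real n + C) ^ n \<le>
    real (card (Ex_edges k {1..n})) * (2 ^ (k * k) * exp (2 * (C + real k)) * (real n + C) ^ (k + 2))"
proof -
  define y where "y = real (n - k)"
  have y: "0 < y" "real n = y + real k" "real n \<le> 2 * y" "y \<le> real n + C" using n C by (auto simp: y_def of_nat_diff)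
  have Ex: "2 ^ (k * (n - k)) * (y ^ (n - k - 1) / y) \<le> real (card (Ex_edges k {1..n}))"
    using card_Ex_edges_ge[of "{1..n}" k] n by (simp add: y_def)
  have "real n + C = y * (1 + (C + real k) / y)" using y by (simp add: field_simps)
  then have "(real n + C) ^ n = (y * (1 + (C + real k) / y)) ^ n" by simp
  also have "\<dots> \<le> (y * exp ((C + real k) / y)) ^ n"
    using y C by (intro power_mono mult_left_mono exp_ge_add_one_self) auto
  also have "\<dots> = y ^ n * exp (real n * ((C + real k) / y))"
    by (simp add: power_mult_distrib flip: exp_of_nat_mult)
  also have "\<dots> \<le> y ^ n * exp (2 * (C + real k))"
  proof -
    have "real n * ((C + real k) / y) \<le> (2 * y) * ((C + real k) / y)" using y C by (intro mult_right_mono) auto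
    then show ?thesis using y by simp
  qed
  finally have 1: "(real n + C) ^ n \<le> y ^ n * exp (2 * (C + real k))" .
  have "n = (n - k - 1) + (k + 1)" using n by simp
  then have "y ^ n = y ^ (n - k - 1) * y ^ (k + 1)" by (metis power_add)
  also have "\<dots> = (y ^ (n - k - 1) / y) * y ^ (k + 2)" using y by simp
  also have "\<dots> \<le> (y ^ (n - k - 1) / y) * (real n + C) ^ (k + 2)"
    using y by (intro mult_left_mono power_mono) auto
  finally have 2: "y ^ n \<le> (y ^ (n - k - 1) / y) * (real n + C) ^ (k + 2)" .
  have "k * n = k * (n - k + k)" using n by simp
  then have "k * n = k * (n - k) + k * k" by (simp only: distrib_left)
  then have 3: "(2::real) ^ (k * n) = 2 ^ (k * (n - k)) * 2 ^ (k * k)" by (metis power_add)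
  have "2 ^ (k * n) * (real n + C) ^ n \<le>
      2 ^ (k * n) * (((y ^ (n - k - 1) / y) * (real n + C) ^ (k + 2)) * exp (2 * (C + real k)))"
    using 1 2 by (intro mult_left_mono order_trans[OF 1] mult_right_mono) auto
  also have "\<dots> = (2 ^ (k * (n - k)) * (y ^ (n - k - 1) / y)) *
      (2 ^ (k * k) * exp (2 * (C + real k)) * (real n + C) ^ (k + 2))" unfolding 3 by (simp only: mult_ac)
  also have "\<dots> \<le> real (card (Ex_edges k {1..n})) * (2 ^ (k * k) * exp (2 * (C + real k)) * (real n + C) ^ (k + 2))"
    using Ex C by (intro mult_right_mono) auto
  finally show ?thesis .
qed

theorem not_good_ratio_tendsto_0:
  assumes k: "1 \<le> k"
  shows "(\<lambda>n. real (card (Ex_edges k {1..n} - good_edges k {1..n})) / real (card (Ex_edges k {1..n}))) \<longlonglongrightarrow> 0"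
proof -
  obtain r where cover: "\<And>(E :: nat set set) V n l z. two_sets E \<Longrightarrow> finite V \<Longrightarrow> \<Union>E \<subseteq> V \<Longrightarrow> \<not> packs E V (Suc k) \<Longrightarrow>
     \<forall>B. \<not> good_blocker k E V B \<Longrightarrow> card V \<le> n \<Longrightarrow> real (l + 2 * k) \<le> z \<Longrightarrow>
     \<exists>S R. S \<subseteq> V \<and> R \<subseteq> V \<and> card S \<le> k \<and> card R \<le> r \<and>
       E \<in> assembled n (V - S - R) R (S \<union> R) (bad_codes k n (V - S - R) S z l (3 * r))"
    using bad_cover[where 'a = nat and k = k] by metis
  \<comment> \<open>Chosen so that \<open>2 ^ k - 1 / 2 = 2 ^ k * q\<close>.\<close>
  define q :: real where "q = 1 - 1 / 2 ^ (k + 1)"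
  have "(2::real) ^ 0 < 2 ^ (k + 1)" by (intro power_strict_increasing) auto
  then have q: "0 < q" "q < 1" by (auto simp: q_def)
  \<comment> \<open>With this value \<open>2 powr \<alpha> * q = sqrt q < 1\<close>, so having at
    most \<open>\<alpha> * n\<close> vertices joined to all hubs is still exponentially
    unlikely.\<close>
  define \<alpha> where "\<alpha> = - log 2 q / 2"
  have \<alpha>: "0 < \<alpha>" using q by (simp add: \<alpha>_def)
  have "2 powr \<alpha> = (2 powr log 2 q) powr (- 1 / 2)" by (simp add: \<alpha>_def powr_powr)
  also have "\<dots> = 1 / sqrt q" using q by (simp add: powr_half_sqrt powr_minus_divide)
  finally have \<alpha>q: "2 powr \<alpha> * q = sqrt q" using q by (simp add: real_div_sqrt)
  \<comment> \<open>Independence of about \<open>\<alpha> * n / 2\<close> vertices gains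
    \<open>exp (- 3 * \<mu> * n)\<close>. One \<open>\<mu>\<close> is spent on
    \<open>(1 + t) ^ n\<close>, one on the power of \<open>1 / t\<close>, and one is left
    over.\<close>
  define \<mu> where "\<mu> = \<alpha>\<^sup>2 / 24"
  have \<mu>: "0 < \<mu>" using \<alpha> by (simp add: \<mu>_def)
  define t where "t = min 1 (exp \<mu> - 1)"
  have t: "0 < t" "t \<le> 1" "1 + t \<le> exp \<mu>" using \<mu> by (auto simp: t_def)
  define c where "c = - ln t"
  have c: "0 \<le> c" using t by (simp add: c_def)
  \<comment> \<open>The first bound keeps \<open>\<alpha> - \<zeta>\<close> at least
    \<open>\<alpha> / 2\<close>, the second keeps \<open>\<zeta> * c\<close> at most
    \<open>\<mu>\<close>; adding 1 to \<open>c\<close> avoids dividing by zero when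
    \<open>t = 1\<close>.\<close>
  define \<zeta> where "\<zeta> = min (\<alpha> / 2) (\<mu> / (1 + c))"
  have \<zeta>: "0 < \<zeta>" "\<zeta> \<le> \<alpha> / 2"
    using \<alpha> \<mu> c unfolding \<zeta>_def by (simp, intro min.cobounded1)
  have "\<zeta> \<le> \<mu> / (1 + c)" unfolding \<zeta>_def by (rule min.cobounded2)
  then have "\<zeta> * (1 + c) \<le> \<mu>" using c by (simp add: le_divide_eq)
  then have \<zeta>c: "\<zeta> * c \<le> \<mu>" using \<zeta> by (simp add: distrib_left)
  define \<Lambda> where "\<Lambda> = max (max (1 / 2) (sqrt q)) (max (exp (- \<mu>)) (exp (- (\<zeta>\<^sup>2 / 64))))"
  have \<Lambda>: "0 < \<Lambda>" "\<Lambda> < 1" "1 / 2 \<le> \<Lambda>" "sqrt q \<le> \<Lambda>" "exp (- \<mu>) \<le> \<Lambda>" "exp (- (\<zeta>\<^sup>2 / 64)) \<le> \<Lambda>"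
    using q \<mu> \<zeta> by (auto simp: \<Lambda>_def less_max_iff_disj)
  \<comment> \<open>Half of the exponential gain is given away: \<open>\<epsilon>\<close> is chosen
    so that \<open>(1 + \<epsilon>) * \<Lambda>\<close> equals \<open>sqrt \<Lambda>\<close>, which
    is still below 1.\<close>
  define \<rho> where "\<rho> = sqrt \<Lambda>"
  have \<rho>: "0 < \<rho>" "\<rho> < 1" "\<rho> * \<rho> = \<Lambda>" using \<Lambda> by (auto simp: \<rho>_def)
  define \<epsilon> where "\<epsilon> = 1 / \<rho> - 1"
  have \<epsilon>: "0 < \<epsilon>" "(1 + \<epsilon>) * \<Lambda> = \<rho>" using \<rho> by (auto simp: \<epsilon>_def \<rho>(3)[symmetric])
  obtain C where C: "1 \<le> C" "\<And>a::nat. (1 + real a) ^ r \<le> C * (1 + \<epsilon>) ^ a"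
    using polynomial_le_exponential[OF \<epsilon>(1)] by metis
  define d where "d = Suc (k + 7 * r)"
  define K where "K = (3 * 2 ^ 2 ^ (k + r)) * (2 ^ (k * k) * exp (2 * (C + real k))) * 2 ^ (d + (k + 2))"
  have bound: "real (card (Ex_edges k {1..n} - good_edges k {1..n})) / real (card (Ex_edges k {1..n})) \<le>
      K * (real n ^ (d + (k + 2)) * \<rho> ^ n)"
    if n: "C \<le> real n" "2 * k < n" "8 * real k + 8 \<le> \<zeta> * real n" for n
  proof -
    define x where "x = real n + C"
    have n0: "0 < real n" using n C by linarith
    have x: "0 < x" "x \<le> 2 * real n" "1 \<le> x" using n C n0 by (auto simp: x_def)
    \<comment> \<open>Half of the allowance \<open>\<zeta> * n\<close> goes to the cycle, and the
      rest easily accommodates the \<open>2 * k\<close> matched vertices. For large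
      \<open>n\<close>, \<open>l - 1\<close> is still at least \<open>\<zeta> * n / 4\<close>; with
      \<open>x \<le> 2 * n\<close> this is the origin of the denominator 64.\<close>
    define l where "l = nat \<lfloor>\<zeta> * real n / 2\<rfloor>"
    have l: "real l \<le> \<zeta> * real n / 2" "\<zeta> * real n / 2 - 1 \<le> real l"
      using \<zeta> n0 by (auto simp: l_def) linarith
    have l4: "\<zeta> * real n / 4 + 1 \<le> real l" using l(2) n(3) by linarith
    have "real l + 2 * real k \<le> \<zeta> * real n" using l(1) n(3) by linarith
    then have lz: "real (l + 2 * k) \<le> \<zeta> * real n" by simp
    have h1: "(1 / 2) ^ n \<le> \<Lambda> ^ n" using \<Lambda> by (intro power_mono) auto
    have h2: "2 powr (\<alpha> * real n) * (2 ^ k - 1 / 2) ^ n \<le> 2 ^ (k * n) * \<Lambda> ^ n"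
    proof -
      have "(2::real) ^ k - 1 / 2 = 2 ^ k * q" by (simp add: q_def field_simps)
      moreover have "2 powr (\<alpha> * real n) = (2 powr \<alpha>) ^ n" by (simp add: powr_powr flip: powr_realpow)
      ultimately have "2 powr (\<alpha> * real n) * (2 ^ k - 1 / 2) ^ n = 2 ^ (k * n) * (2 powr \<alpha> * q) ^ n"
        by (simp add: power_mult_distrib power_mult)
      also have "\<dots> \<le> 2 ^ (k * n) * \<Lambda> ^ n" unfolding \<alpha>q using \<Lambda> q by (intro mult_left_mono power_mono) auto
      finally show ?thesis .
    qed
    have h3: "((1 + t) ^ n / t powr (\<zeta> * real n)) * exp (- ((\<alpha> * real n - \<zeta> * real n)\<^sup>2 / x)) \<le> \<Lambda> ^ n"
    proof -
      have "(1 + t) ^ n \<le> exp \<mu> ^ n" using t by (intro power_mono) auto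
      moreover have "1 / t powr (\<zeta> * real n) = exp (real n * (\<zeta> * c))"
        using t by (simp add: powr_def c_def exp_minus divide_inverse mult_ac flip: exp_minus)
      moreover have "exp (real n * (\<zeta> * c)) \<le> exp (real n * \<mu>)" using \<zeta>c by (simp add: mult_left_mono)
      moreover have "exp (- ((\<alpha> * real n - \<zeta> * real n)\<^sup>2 / x)) \<le> exp (- (real n * (3 * \<mu>)))"
      proof -
        have "\<zeta> * real n \<le> \<alpha> / 2 * real n" using \<zeta> by (intro mult_right_mono) auto
        then have "\<alpha> * real n / 2 \<le> \<alpha> * real n - \<zeta> * real n" by simp
        then have "(\<alpha> * real n / 2)\<^sup>2 \<le> (\<alpha> * real n - \<zeta> * real n)\<^sup>2" using \<alpha> by (intro power_mono) auto
        then have "(\<alpha> * real n / 2)\<^sup>2 / (2 * real n) \<le> (\<alpha> * real n - \<zeta> * real n)\<^sup>2 / x"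
          using x n0 by (intro frac_le) auto
        moreover have "(\<alpha> * real n / 2)\<^sup>2 / (2 * real n) = real n * (3 * \<mu>)"
          using n0 by (simp add: \<mu>_def power2_eq_square field_simps)
        ultimately show ?thesis by simp
      qed
      ultimately have "((1 + t) ^ n * (1 / t powr (\<zeta> * real n))) * exp (- ((\<alpha> * real n - \<zeta> * real n)\<^sup>2 / x)) \<le>
          (exp \<mu> ^ n * exp (real n * \<mu>)) * exp (- (real n * (3 * \<mu>)))"
        using t by (intro mult_mono) auto
      also have "\<dots> = exp (- \<mu>) ^ n" by (simp flip: exp_of_nat_mult exp_add)
      also have "\<dots> \<le> \<Lambda> ^ n" using \<Lambda> by (intro power_mono) auto
      finally show ?thesis by simp
    qed
    have h4: "exp (- (real (l * (l - 1)) / (2 * x))) \<le> \<Lambda> ^ n"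
    proof -
      have zn: "0 < \<zeta> * real n" using \<zeta> n0 by simp
      then have "real (l - 1) = real l - 1" using l4 by (cases l) auto
      then have "(\<zeta> * real n / 4) * (\<zeta> * real n / 4) \<le> real (l * (l - 1))"
        unfolding of_nat_mult using l4 zn by (intro mult_mono) auto
      then have "(\<zeta> * real n / 4) * (\<zeta> * real n / 4) / (4 * real n) \<le> real (l * (l - 1)) / (2 * x)"
        using x by (intro frac_le) auto
      moreover have "(\<zeta> * real n / 4) * (\<zeta> * real n / 4) / (4 * real n) = real n * (\<zeta>\<^sup>2 / 64)"
        using n0 by (simp add: power2_eq_square field_simps)
      ultimately have "real n * (\<zeta>\<^sup>2 / 64) \<le> real (l * (l - 1)) / (2 * x)" by (simp only:)
      then have "exp (- (real (l * (l - 1)) / (2 * x))) \<le> exp (- (real n * (\<zeta>\<^sup>2 / 64)))"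
        by (simp only: exp_le_cancel_iff neg_le_iff_le)
      also have "\<dots> = exp (- (\<zeta>\<^sup>2 / 64)) ^ n" by (simp flip: exp_of_nat_mult)
      also have "\<dots> \<le> \<Lambda> ^ n" using \<Lambda> by (intro power_mono) auto
      finally show ?thesis .
    qed
    have "real (card (Ex_edges k {1..n} - good_edges k {1..n})) \<le>
        3 * 2 ^ 2 ^ (k + r) * (2 ^ (k * n) * ((1 + \<epsilon>) ^ n * \<Lambda> ^ n) * x ^ (d + n))"
      unfolding d_def
      by (rule card_not_good_le[OF k cover C _ x_def t(1,2) _ _ lz h1 h2 h3 h4])
        (use \<epsilon> \<zeta> n0 in \<open>auto intro: mult_right_mono\<close>)
    also have "(1 + \<epsilon>) ^ n * \<Lambda> ^ n = \<rho> ^ n" using \<epsilon>(2) by (simp flip: power_mult_distrib)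
    also have "3 * 2 ^ 2 ^ (k + r) * (2 ^ (k * n) * \<rho> ^ n * x ^ (d + n)) =
        (3 * 2 ^ 2 ^ (k + r) * \<rho> ^ n * x ^ d) * (2 ^ (k * n) * x ^ n)" by (simp add: power_add mult_ac)
    also have "\<dots> \<le> (3 * 2 ^ 2 ^ (k + r) * \<rho> ^ n * x ^ d) *
        (real (card (Ex_edges k {1..n})) * (2 ^ (k * k) * exp (2 * (C + real k)) * x ^ (k + 2)))"
      using card_Ex_edges_ge'[OF n(2), of C] C \<rho> x unfolding x_def by (intro mult_left_mono) auto
    also have "\<dots> = real (card (Ex_edges k {1..n})) *
        ((3 * 2 ^ 2 ^ (k + r)) * (2 ^ (k * k) * exp (2 * (C + real k))) * (x ^ (d + (k + 2)) * \<rho> ^ n))"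
      by (simp add: power_add mult_ac)
    also have "\<dots> \<le> real (card (Ex_edges k {1..n})) *
        ((3 * 2 ^ 2 ^ (k + r)) * (2 ^ (k * k) * exp (2 * (C + real k))) * ((2 * real n) ^ (d + (k + 2)) * \<rho> ^ n))"
      using x \<rho> by (intro mult_left_mono mult_right_mono power_mono) auto
    also have "\<dots> = real (card (Ex_edges k {1..n})) * (K * (real n ^ (d + (k + 2)) * \<rho> ^ n))"
      unfolding power_mult_distrib K_def by (simp only: mult_ac)
    finally have le: "real (card (Ex_edges k {1..n} - good_edges k {1..n})) \<le>
      real (card (Ex_edges k {1..n})) * (K * (real n ^ (d + (k + 2)) * \<rho> ^ n))" .
    have "0 \<le> K * (real n ^ (d + (k + 2)) * \<rho> ^ n)" using \<rho> by (simp add: K_def)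
    then show ?thesis using le
      by (cases "card (Ex_edges k {1..n}) = 0") (auto simp: divide_le_eq mult.commute)
  qed
  have "(\<lambda>n. K * (real n ^ (d + (k + 2)) * \<rho> ^ n)) \<longlonglongrightarrow> K * 0"
    by (intro tendsto_mult tendsto_const power_times_exponential_tendsto_0 \<rho>)
  then have lim: "(\<lambda>n. K * (real n ^ (d + (k + 2)) * \<rho> ^ n)) \<longlonglongrightarrow> 0" by simp
  have "\<forall>\<^sub>F n in sequentially. C \<le> real n" by real_asymp
  moreover have "\<forall>\<^sub>F n in sequentially. 2 * k < n" by (rule eventually_gt_at_top)
  moreover have "\<forall>\<^sub>F n in sequentially. 8 * real k + 8 \<le> \<zeta> * real n" using \<zeta>(1) by real_asymp
  ultimately have "\<forall>\<^sub>F n in sequentially.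
      real (card (Ex_edges k {1..n} - good_edges k {1..n})) / real (card (Ex_edges k {1..n})) \<le>
      K * (real n ^ (d + (k + 2)) * \<rho> ^ n)"
    by eventually_elim (rule bound)
  then show ?thesis
    by (intro tendsto_sandwich[OF _ _ tendsto_const lim]) auto
qed

section \<open>From counts to the limit law\<close>

lemma uniform_prob_Pair_image:
  assumes "finite A" "A \<noteq> {}"
  shows "uniform_prob (Pair V ` A) P = real (card {E \<in> A. P (V, E)}) / real (card A)"
proof -
  have inj: "inj_on (Pair V) X" for X by (auto simp: inj_on_def)
  have "Pair V ` A \<inter> {G. P G} = Pair V ` {E \<in> A. P (V, E)}" by auto
  then show ?thesis
    unfolding uniform_prob_def using assms by (simp add: measure_pmf_of_set card_image[OF inj])
qed

lemma on_vertices_simple_graphs_eq: "on_vertices simple_graphs n = Pair {1..n} ` pair_sets {1..n}"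
proof -
  have "G \<in> on_vertices simple_graphs n \<longleftrightarrow> fst G = {1..n} \<and> snd G \<in> pair_sets {1..n}" for G
    by (auto simp: on_vertices_def simple_graphs_def pair_sets_def two_sets_def)
  then show ?thesis by (force simp: image_iff)
qed

lemma empty_in_pair_sets: "{} \<in> pair_sets B"
  by (simp add: pair_sets_def two_sets_def)

text \<open>Conditioned on being good, the graph has exactly the limiting law for every
  \<open>n\<close>. The error comes only from the bad graphs, whose share tends to 0.\<close>

lemma joint_law_tendsto:
  assumes k: "1 \<le> k"
  shows "(\<lambda>n. uniform_prob (on_vertices (Ex_cycles (k + 1)) n) (\<lambda>G. P (clique_number G) (chromatic_number G)))
    \<longlonglongrightarrow> real (card {Q \<in> pair_sets {1..k}. P (clique_number ({1..k}, Q) + 2) (chromatic_number ({1..k}, Q) + 2)}) /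
      real (card (pair_sets {1..k}))"
proof -
  let ?X = "\<lambda>n::nat. Ex_edges k {1..n}" and ?G = "\<lambda>n::nat. good_edges k {1..n}"
  let ?N = "card {Q \<in> pair_sets {1..k}. P (clique_number ({1..k}, Q) + 2) (chromatic_number ({1..k}, Q) + 2)}"
  let ?T = "card (pair_sets {1..k})"
  let ?p = "\<lambda>(n::nat) E. P (clique_number ({1..n}, E)) (chromatic_number ({1..n}, E))"
  have T: "0 < ?T" using finite_pair_sets[of "{1..k}"] empty_in_pair_sets by (auto simp: card_gt_0_iff)
  have Xf: "finite (?X n)" for n by (rule finite_Ex_edges) simp
  have Xne: "?X n \<noteq> {}" for n
    using on_vertices_Ex_cycles_nonempty[of "k + 1" n] unfolding on_vertices_Ex_cycles_eq by auto
  have GX: "?G n \<subseteq> ?X n" for n by (rule good_edges_subset) simp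
  have X0: "0 < card (?X n)" for n using Xf Xne by (simp add: card_gt_0_iff)
  define bad where "bad = (\<lambda>n. real (card (?X n - ?G n)) / real (card (?X n)))"
  have bad: "bad \<longlonglongrightarrow> 0" unfolding bad_def by (rule not_good_ratio_tendsto_0[OF k])
  have good: "real (card {E \<in> ?G n. ?p n E}) / real (card (?X n)) = (1 - bad n) * (real ?N / real ?T)" for n
  proof -
    obtain c where c: "\<forall>P. card {E \<in> ?G n. P (clique_number ({1..n}, E)) (chromatic_number ({1..n}, E))} =
      c * card {Q \<in> pair_sets {1..k}. P (clique_number ({1..k}, Q) + 2) (chromatic_number ({1..k}, Q) + 2)}"
      using card_good_edges[of "{1..n}" "{1..k}" k] by auto
    have "card (?G n) = c * ?T" using c[rule_format, of "\<lambda>_ _. True"] by simp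
    moreover have "card {E \<in> ?G n. ?p n E} = c * ?N" by (rule c[rule_format])
    ultimately have split: "real (card {E \<in> ?G n. ?p n E}) = real (card (?G n)) * (real ?N / real ?T)"
      using T by simp
    have "card (?X n - ?G n) = card (?X n) - card (?G n)" "card (?G n) \<le> card (?X n)"
      using card_Diff_subset[OF finite_subset[OF GX Xf] GX] card_mono[OF Xf GX] by simp_all
    then have frac: "real (card (?G n)) / real (card (?X n)) = 1 - bad n"
      using X0[of n] by (simp add: bad_def of_nat_diff diff_divide_distrib)
    show ?thesis unfolding split frac[symmetric] by (simp only: times_divide_eq_left)
  qed
  define err where "err = (\<lambda>n. real (card {E \<in> ?X n - ?G n. ?p n E}) / real (card (?X n)))"
  have err: "err \<longlonglongrightarrow> 0"
  proof (rule tendsto_sandwich[OF _ _ tendsto_const bad])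
    have "card {E \<in> ?X n - ?G n. ?p n E} \<le> card (?X n - ?G n)" for n
      using Xf by (intro card_mono) auto
    then have "err n \<le> bad n" for n by (simp add: err_def bad_def divide_right_mono)
    then show "\<forall>\<^sub>F n in sequentially. err n \<le> bad n" by simp
  qed (simp add: err_def)
  have "uniform_prob (on_vertices (Ex_cycles (k + 1)) n) (\<lambda>G. P (clique_number G) (chromatic_number G)) =
      (1 - bad n) * (real ?N / real ?T) + err n" for n
  proof -
    have "{E \<in> ?X n. ?p n E} = {E \<in> ?G n. ?p n E} \<union> {E \<in> ?X n - ?G n. ?p n E}" using GX by blast
    moreover have "finite (?G n)" using GX Xf finite_subset by blast
    ultimately have "card {E \<in> ?X n. ?p n E} = card {E \<in> ?G n. ?p n E} + card {E \<in> ?X n - ?G n. ?p n E}"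
      using Xf by (simp only:) (rule card_Un_disjoint, auto)
    then show ?thesis
      unfolding on_vertices_Ex_cycles_eq uniform_prob_Pair_image[OF Xf Xne] good[symmetric] err_def
      by (simp add: add_divide_distrib)
  qed
  moreover have "(\<lambda>n. (1 - bad n) * (real ?N / real ?T) + err n) \<longlonglongrightarrow> (1 - 0) * (real ?N / real ?T) + 0"
    by (intro tendsto_intros bad err)
  ultimately show ?thesis by simp
qed

theorem theorem1p6:
  fixes k :: nat
  assumes "k \<ge> 1"
  shows "(\<forall>i j :: nat. 3 \<le> i \<and> i \<le> j \<and> j \<le> k + 2 \<longrightarrow>
           (\<lambda>n. uniform_prob (on_vertices (Ex_cycles (k + 1)) n)
                  (\<lambda>G. clique_number G = i \<and> chromatic_number G = j))
             \<longlonglongrightarrow> uniform_prob (on_vertices simple_graphs k)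
                  (\<lambda>G. clique_number G = i - 2 \<and> chromatic_number G = j - 2)) \<and>
         (\<forall>i j :: nat. \<not> (3 \<le> i \<and> i \<le> j \<and> j \<le> k + 2) \<longrightarrow>
           (\<lambda>n. uniform_prob (on_vertices (Ex_cycles (k + 1)) n)
                  (\<lambda>G. clique_number G = i \<and> chromatic_number G = j))
             \<longlonglongrightarrow> 0)"
proof (intro conjI allI impI)
  let ?L = "\<lambda>i j. real (card {Q \<in> pair_sets {1..k}. clique_number ({1..k}, Q) + 2 = i \<and> chromatic_number ({1..k}, Q) + 2 = j}) /
    real (card (pair_sets {1..k}))"
  have lim: "(\<lambda>n. uniform_prob (on_vertices (Ex_cycles (k + 1)) n)
      (\<lambda>G. clique_number G = i \<and> chromatic_number G = j)) \<longlonglongrightarrow> ?L i j" for i j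
    by (rule joint_law_tendsto[OF assms])
  fix i j :: nat
  {
    assume "3 \<le> i \<and> i \<le> j \<and> j \<le> k + 2"
    \<comment> \<open>As \<open>i\<close> and \<open>j\<close> are at least 3, the subtractions on
      natural numbers are not truncated.\<close>
    then have "a + 2 = i \<and> b + 2 = j \<longleftrightarrow> a = i - 2 \<and> b = j - 2" for a b by auto
    then have "?L i j = uniform_prob (on_vertices simple_graphs k)
        (\<lambda>G. clique_number G = i - 2 \<and> chromatic_number G = j - 2)"
      unfolding on_vertices_simple_graphs_eq
      using finite_pair_sets[of "{1..k}"] empty_in_pair_sets[of "{1..k}"]
      by (subst uniform_prob_Pair_image) auto
    then show "(\<lambda>n. uniform_prob (on_vertices (Ex_cycles (k + 1)) n)
        (\<lambda>G. clique_number G = i \<and> chromatic_number G = j))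
      \<longlonglongrightarrow> uniform_prob (on_vertices simple_graphs k)
        (\<lambda>G. clique_number G = i - 2 \<and> chromatic_number G = j - 2)"
      using lim[of i j] by simp
  next
    assume ij: "\<not> (3 \<le> i \<and> i \<le> j \<and> j \<le> k + 2)"
    \<comment> \<open>A graph on \<open>k \<ge> 1\<close> vertices has clique number at least 1, at
      most its chromatic number, which is at most \<open>k\<close>. Shifted by two, this is exactly
      the excluded range.\<close>
    have "\<not> (clique_number ({1..k}, Q) + 2 = i \<and> chromatic_number ({1..k}, Q) + 2 = j)"
      if "Q \<in> pair_sets {1..k}" for Q
    proof -
      have Q: "finite (verts ({1..k}, Q))" "two_sets (edges ({1..k}, Q))" "verts ({1..k}, Q) \<noteq> {}"
        using that assms by (auto simp: pair_sets_def)
      have "chromatic_number ({1..k}, Q) \<le> k" using chromatic_number_le_card[OF Q(1,2)] by simp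
      then show ?thesis
        using clique_number_pos[OF Q(1,3)] clique_number_le_chromatic_number[OF Q(1,2)] ij by linarith
    qed
    then have "{Q \<in> pair_sets {1..k}. clique_number ({1..k}, Q) + 2 = i \<and> chromatic_number ({1..k}, Q) + 2 = j} = {}"
      by blast
    then have "?L i j = 0" by (simp only: card.empty of_nat_0 div_0)
    then show "(\<lambda>n. uniform_prob (on_vertices (Ex_cycles (k + 1)) n)
        (\<lambda>G. clique_number G = i \<and> chromatic_number G = j)) \<longlonglongrightarrow> 0"
      using lim[of i j] by (simp only:)
  }
qed

end
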